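(* Let $\lambda$ be a partition and write $\lambda=(1^{r_1}2^{r_2}\cdots)$. Then $$a^+_\lambda=(r_1+1)(r_2+1)\cdots$$ and $$a^-_\lambda=\begin{cases}1&\text{if the conjugate partition }\lambda'\text{ has only even parts},\\0&\text{otherwise.}\end{cases}$$ Here $a^+_\lambda:=\sum_{\pi\vdash|\lambda|}\mathrm{sgn}(\pi)\,C_\pi\,\chi^\lambda_\pi$ and $a^-_\lambda:=\sum_{\pi\vdash|\lambda|}\mathrm{sgn}(\pi)\,D_\pi\,\chi^\lambda_\pi$, with $C_\pi,D_\pi$ the rational numbers defined in the context.
   Context: Notation: $(1^{r_1}2^{r_2}\cdots)$ is the partition with $r_i$ parts equal to $i$; $\ell(\pi)$ is the number of parts; $\mathrm{sgn}(\pi)=(-1)^{e}$ with $e$ the number of even parts of $\pi$; $\chi^\lambda_\pi$ is the value of the irreducible character of the symmetric group $S_{|\lambda|}$ attached to $\lambda$ (with $\chi^{(n)}$ trivial) on permutations of cycle type $\pi$; $z_\mu=\prod_ii^{m_i}m_i!$ for $\mu=(1^{m_1}2^{m_2}\cdots)$; $\lambda\cup\mu$ is the partition whose multiset of parts is the union of those of $\lambda$ and $\mu$; $2\tau=\tau\cup\tau$; $2\cdot\tau$ is obtained from $\tau$ by doubling every part. For a partition $\pi$ define $$C_\pi^{+}=\sum\frac{(-1)^{\ell(\tau_s)}}{z_{\rho_+}z_{\rho_-}z_{2\cdot\tau_s}z_{2\cdot\tau_p}},$$ the sum over all quadruples of partitions $(\rho_+,\rho_-,\tau_s,\tau_p)$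 with $\rho_+\cup\rho_-\cup(2\cdot\tau_s)\cup(2\tau_p)=\pi$ and $|\rho_-|$ even; $C^-_\pi$ is the same sum with $|\rho_-|$ odd. Put $C_\pi=C_\pi^++C_\pi^-$ and $D_\pi=C_\pi^+-C_\pi^-$. *)

theory Defs
  imports Complex_Main
    "HOL-Library.Multiset"
    "HOL-Library.Function_Algebras"
    "HOL-Combinatorics.Orbits"
begin

section \<open>Integer partitions\<close>

text \<open>A partition is the multiset of its parts, a \<^typ>\<open>nat multiset\<close> without the element 0.
  Thus \<^term>\<open>count p i\<close> is the number of parts equal to \<^term>\<open>i\<close>, \<^term>\<open>size p\<close> is the number
  of parts, \<^term>\<open>sum_mset p\<close> is the number being partitioned and the sum of multisets is the
  union of partitions.\<close>

definition is_partition :: "nat multiset \<Rightarrow> bool" where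
  "is_partition p \<longleftrightarrow> 0 \<notin># p"

definition partitions_of :: "nat \<Rightarrow> nat multiset set" where
  "partitions_of n = {p. is_partition p \<and> sum_mset p = n}"

definition part_sgn :: "nat multiset \<Rightarrow> int" where
  "part_sgn p = (-1) ^ size (filter_mset even p)"

definition z_part :: "nat multiset \<Rightarrow> nat" where
  "z_part p = (\<Prod>i\<in>set_mset p. i ^ count p i * fact (count p i))"

definition double_parts :: "nat multiset \<Rightarrow> nat multiset" where
  "double_parts p = image_mset (\<lambda>i. 2 * i) p"

text \<open>The parts of the conjugate partition are the lengths of the nonempty columns of the Young
  diagram: column \<^term>\<open>j\<close> (counted from 1) meets the rows of length at least \<^term>\<open>j\<close>.\<close>

definition conjugate_part :: "nat multiset \<Rightarrow> nat multiset" where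
  "conjugate_part p =
     image_mset (\<lambda>j. size (filter_mset (\<lambda>i. j \<le> i) p)) (mset_set {j. 1 \<le> j \<and> (\<exists>i\<in>#p. j \<le> i)})"


section \<open>The coefficients $C_\pi$ and $D_\pi$\<close>

text \<open>Quadruples are ordered as $(\rho_+,\rho_-,\tau_s,\tau_p)$.\<close>

definition quadruples ::
  "nat multiset \<Rightarrow> (nat multiset \<times> nat multiset \<times> nat multiset \<times> nat multiset) set" where
  "quadruples \<pi> = {(\<rho>p, \<rho>m, \<tau>s, \<tau>p).
     is_partition \<rho>p \<and> is_partition \<rho>m \<and> is_partition \<tau>s \<and> is_partition \<tau>p \<and>
     \<rho>p + \<rho>m + double_parts \<tau>s + (\<tau>p + \<tau>p) = \<pi>}"

definition quad_weight ::
  "nat multiset \<times> nat multiset \<times> nat multiset \<times> nat multiset \<Rightarrow> rat" where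
  "quad_weight = (\<lambda>(\<rho>p, \<rho>m, \<tau>s, \<tau>p).
     (-1) ^ size \<tau>s /
     of_nat (z_part \<rho>p * z_part \<rho>m * z_part (double_parts \<tau>s) * z_part (double_parts \<tau>p)))"

definition C_even :: "nat multiset \<Rightarrow> rat" where
  "C_even \<pi> = (\<Sum>q \<in> {(\<rho>p, \<rho>m, \<tau>s, \<tau>p) \<in> quadruples \<pi>. even (sum_mset \<rho>m)}. quad_weight q)"

definition C_odd :: "nat multiset \<Rightarrow> rat" where
  "C_odd \<pi> = (\<Sum>q \<in> {(\<rho>p, \<rho>m, \<tau>s, \<tau>p) \<in> quadruples \<pi>. odd (sum_mset \<rho>m)}. quad_weight q)"

definition C_coeff :: "nat multiset \<Rightarrow> rat" where
  "C_coeff \<pi> = C_even \<pi> + C_odd \<pi>"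

definition D_coeff :: "nat multiset \<Rightarrow> rat" where
  "D_coeff \<pi> = C_even \<pi> - C_odd \<pi>"


section \<open>Irreducible characters of the symmetric groups\<close>

text \<open>\<^term>\<open>\<chi> p m\<close> below is the character of the Specht module attached to \<^term>\<open>p\<close>, realised as the
  left ideal of the complex group algebra of $S_n$ generated by a Young symmetrizer. Here $S_n$
  consists of the permutations of \<^term>\<open>{..<n::nat}\<close>, and a group algebra element is a
  complex-valued function on permutations that vanishes outside $S_n$.\<close>

definition sym_grp :: "nat \<Rightarrow> (nat \<Rightarrow> nat) set" where
  "sym_grp n = {g. g permutes {..<n}}"

definition cycle_type :: "nat \<Rightarrow> (nat \<Rightarrow> nat) \<Rightarrow> nat multiset" where
  "cycle_type n g = image_mset card (mset_set (orbit g ` {..<n}))"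

type_synonym galg = "(nat \<Rightarrow> nat) \<Rightarrow> complex"

definition gscale :: "complex \<Rightarrow> galg \<Rightarrow> galg" where
  "gscale c x = (\<lambda>g. c * x g)"

global_interpretation galg: vector_space gscale
  by unfold_locales (simp_all add: gscale_def fun_eq_iff algebra_simps)

definition group_algebra :: "nat \<Rightarrow> galg set" where
  "group_algebra n = {x. \<forall>g. g \<notin> sym_grp n \<longrightarrow> x g = 0}"

definition gmult :: "nat \<Rightarrow> galg \<Rightarrow> galg \<Rightarrow> galg" where
  "gmult n x y = (\<lambda>g. if g \<in> sym_grp n then \<Sum>h\<in>sym_grp n. x h * y (inv h \<circ> g) else 0)"

definition gbasis :: "(nat \<Rightarrow> nat) \<Rightarrow> galg" where
  "gbasis g = (\<lambda>h. if h = g then 1 else 0)"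

text \<open>The standard filling of the Young diagram: its boxes (row, column) are listed row by row and
  \<^term>\<open>k\<close> is placed in the \<^term>\<open>k\<close>-th box, counting from 0.\<close>

definition rows :: "nat multiset \<Rightarrow> nat list" where
  "rows p = rev (sorted_list_of_multiset p)"

definition boxes :: "nat multiset \<Rightarrow> (nat \<times> nat) list" where
  "boxes p = concat (map (\<lambda>i. map (Pair i) [0..<rows p ! i]) [0..<length (rows p)])"

definition row_group :: "nat multiset \<Rightarrow> (nat \<Rightarrow> nat) set" where
  "row_group p = {g \<in> sym_grp (sum_mset p).
     \<forall>k<sum_mset p. fst (boxes p ! g k) = fst (boxes p ! k)}"

definition column_group :: "nat multiset \<Rightarrow> (nat \<Rightarrow> nat) set" where
  "column_group p = {g \<in> sym_grp (sum_mset p).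
     \<forall>k<sum_mset p. snd (boxes p ! g k) = snd (boxes p ! k)}"

definition young_symmetrizer :: "nat multiset \<Rightarrow> galg" where
  "young_symmetrizer p = gmult (sum_mset p)
     (\<Sum>g\<in>row_group p. gbasis g)
     (\<Sum>g\<in>column_group p. gscale (of_int (sign g)) (gbasis g))"

definition specht :: "nat multiset \<Rightarrow> galg set" where
  "specht p = {gmult (sum_mset p) x (young_symmetrizer p) | x. x \<in> group_algebra (sum_mset p)}"

text \<open>The trace, in terms of an arbitrary basis, of an operator mapping the finite-dimensional
  subspace \<^term>\<open>V\<close> to itself.\<close>

definition trace_on :: "galg set \<Rightarrow> (galg \<Rightarrow> galg) \<Rightarrow> complex" where
  "trace_on V f =
     (let B = (SOME B. galg.independent B \<and> galg.span B = V)
      in \<Sum>b\<in>B. galg.representation B (f b) b)"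

definition specht_character :: "nat multiset \<Rightarrow> (nat \<Rightarrow> nat) \<Rightarrow> complex" where
  "specht_character p g = trace_on (specht p) (gmult (sum_mset p) (gbasis g))"

definition \<chi> :: "nat multiset \<Rightarrow> nat multiset \<Rightarrow> complex" where
  "\<chi> p m = specht_character p (SOME g. g \<in> sym_grp (sum_mset p) \<and> cycle_type (sum_mset p) g = m)"


section \<open>The multiplicities\<close>

definition a_plus :: "nat multiset \<Rightarrow> complex" where
  "a_plus p = (\<Sum>\<pi>\<in>partitions_of (sum_mset p). of_int (part_sgn \<pi>) * of_rat (C_coeff \<pi>) * \<chi> p \<pi>)"

definition a_minus :: "nat multiset \<Rightarrow> complex" where
  "a_minus p = (\<Sum>\<pi>\<in>partitions_of (sum_mset p). of_int (part_sgn \<pi>) * of_rat (D_coeff \<pi>) * \<chi> p \<pi>)"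

end

theory Submission
  imports Defs "HOL-Library.FuncSet"
begin

text \<open>Write twisted characters sgn * chi for the Specht characters and let l be the conjugate of the
  partition p. In terms of power sums, the series with coefficients C and D are
  H(1) H(1) Q and H(1) H(-1) Q, where H(e) is the sum of e^m h_m and Q = exp(sum (p_k^2 - p_2k) / 2k),
  and H(1) Q is the sum of all Schur functions. By Pieri's rule the coefficient of the Schur function
  of l in H(e) H(1) Q is therefore the sum of e^(|l| - |m|) over all m such that l/m is a horizontal
  strip, which is a product over the differences of consecutive rows of l, i.e. over the multiplicities
  of the parts of p.

  Schur functions are never constructed. A power series F in the p_k is paired with a function a on
  Young diagrams such that multiplication by h_m corresponds to adding horizontal strips and the
  adjoint operator to removing them; both pairs of operators satisfy the same commutation rule, the
  first by Newton's identities and the second by a reflection of strips. Hence scalar products of F with products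
  h_l are sums of a against the (unitriangular) Kostka numbers. The twisted Specht characters
  are orthonormal and have scalar product 1 with the matching product h_l, and by a Gram-Schmidt
  argument this forces their scalar product with F to be a(l). These facts about the characters follow from
  the trace formula chi(g) = (1/c) sum_h y(h^-1 g^-1 h) for the Young symmetrizer y = a b with
  y y = c y, and from the fact that b h a is a multiple of b a for every permutation h.\<close>

text \<open>The twist by sgn is chosen because the Young symmetrizer carries its signs on the
  columns: averaging sgn * chi over the column group then meets the plain cycle index of a Young
  subgroup, which is the product h_l for the column lengths l, so elementary symmetric functions
  never enter. That H(1) Q belongs to the constant weight 1 is put into \<open>corresponds\<close>
  as a clause. It is consistent because both sides react alike to the adjoint of h_k: on series the
  result is (h_0 + ... + h_k) H(1) Q, and a diagram admits as many horizontal strips of size k to be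
  added as strips of size at most k to be removed. Moving the factors of h_l to the other side one
  at a time therefore reduces every scalar product to constant terms, and these agree. The parameter
  e marks the size of \<rho>_-, so C is the case e = 1 and D the case e = -1. A difference d of
  consecutive rows contributes 1 + e + ... + e^d, which is d + 1 or the indicator that d is even;
  this is where the two formulas part.\<close>

type_synonym series = "nat multiset \<Rightarrow> real"
type_synonym weight = "(nat \<Rightarrow> nat) \<Rightarrow> real"

section \<open>Operators on the coefficients of power sums\<close>

lemma sum_fun_apply: "(\<Sum>i\<in>A. f i) x = (\<Sum>i\<in>A. f i x)"
  by (induction A rule: infinite_finite_induct) auto

text \<open>A function F on partitions stands for the formal series with coefficient F(pi) at the power sum
  product p_pi. On such series, \<open>p_mult k\<close> is multiplication by p_k, \<open>p_skew k\<close> its adjoint k d/dp_k, and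
  \<open>h_mult m\<close> multiplication by the complete symmetric function h_m. Since \<open>z_part\<close> vanishes on
  multisets containing 0 and division by 0 gives 0, \<open>h_coeff\<close> and the explicit series below vanish there.\<close>

definition p_mult :: "nat \<Rightarrow> series \<Rightarrow> series" where
  "p_mult k F \<pi> = (if k \<in># \<pi> then F (\<pi> - {#k#}) else 0)"

definition p_skew :: "nat \<Rightarrow> series \<Rightarrow> series" where
  "p_skew k F \<pi> = real k * (real (count \<pi> k) + 1) * F (add_mset k \<pi>)"

text \<open>The product of series: power sum products multiply by uniting their index multisets, so
  each distinct splitting of \<pi> occurs once.\<close>

definition conv :: "series \<Rightarrow> series \<Rightarrow> series" where
  "conv F G \<pi> = (\<Sum>\<sigma> | \<sigma> \<subseteq># \<pi>. F \<sigma> * G (\<pi> - \<sigma>))"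

definition h_coeff :: "nat \<Rightarrow> series" where
  "h_coeff m \<pi> = (if sum_mset \<pi> = m then 1 / real (z_part \<pi>) else 0)"

abbreviation h_mult :: "nat \<Rightarrow> series \<Rightarrow> series" where
  "h_mult m F \<equiv> conv (h_coeff m) F"

lemma finite_submultisets: "finite {\<sigma>. \<sigma> \<subseteq># (\<pi> :: 'a multiset)}"
proof (induction \<pi>)
  case (add x \<pi>)
  have "{\<sigma>. \<sigma> \<subseteq># add_mset x \<pi>} \<subseteq> {\<sigma>. \<sigma> \<subseteq># \<pi>} \<union> add_mset x ` {\<sigma>. \<sigma> \<subseteq># \<pi>}"
  proof
    fix \<sigma> assume \<sigma>: "\<sigma> \<in> {\<sigma>. \<sigma> \<subseteq># add_mset x \<pi>}"
    show "\<sigma> \<in> {\<sigma>. \<sigma> \<subseteq># \<pi>} \<union> add_mset x ` {\<sigma>. \<sigma> \<subseteq># \<pi>}"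
    proof (cases "x \<in># \<sigma>")
      case True
      then obtain \<tau> where "\<sigma> = add_mset x \<tau>" by (metis insert_DiffM)
      then show ?thesis using \<sigma> by auto
    next
      case False
      then have "\<sigma> \<subseteq># \<pi>" using \<sigma>
        by (metis diff_single_trivial mem_Collect_eq mset_subset_eq_exists_conv
            subset_eq_diff_conv add_mset_add_single)
      then show ?thesis by blast
    qed
  qed
  then show ?case using add by (meson finite_UnI finite_imageI finite_subset)
qed auto

lemma z_part_empty [simp]: "z_part {#} = 1"
  by (simp add: z_part_def)

lemma z_part_superset:
  assumes "finite S" "set_mset \<pi> \<subseteq> S"
  shows "z_part \<pi> = (\<Prod>i\<in>S. i ^ count \<pi> i * fact (count \<pi> i))"
  unfolding z_part_def
  by (rule prod.mono_neutral_left[OF assms]) (auto simp: not_in_iff)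

text \<open>The factor k (m_k + 1) is the one built into \<open>p_skew\<close>. This makes
  \<open>p_skew k\<close> adjoint to \<open>p_mult k\<close>, and lets it remove a part k from a
  coefficient 1 / z.\<close>

lemma z_part_add: "z_part (add_mset k \<pi>) = k * (count \<pi> k + 1) * z_part \<pi>"
proof -
  let ?S = "insert k (set_mset \<pi>)"
  let ?f = "\<lambda>\<pi> i. i ^ count \<pi> i * fact (count \<pi> i) :: nat"
  have "z_part (add_mset k \<pi>) = (\<Prod>i\<in>?S. ?f (add_mset k \<pi>) i)"
    by (rule z_part_superset) auto
  also have "\<dots> = ?f (add_mset k \<pi>) k * (\<Prod>i\<in>?S-{k}. ?f (add_mset k \<pi>) i)"
    by (rule prod.remove) auto
  also have "(\<Prod>i\<in>?S-{k}. ?f (add_mset k \<pi>) i) = (\<Prod>i\<in>?S-{k}. ?f \<pi> i)"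
    by (rule prod.cong) auto
  also have "?f (add_mset k \<pi>) k = k * (count \<pi> k + 1) * ?f \<pi> k"
    by (simp add: algebra_simps del: mult_cancel1 mult_cancel2)
  also have "\<dots> * (\<Prod>i\<in>?S-{k}. ?f \<pi> i) = k * (count \<pi> k + 1) * (?f \<pi> k * (\<Prod>i\<in>?S-{k}. ?f \<pi> i))"
    by (simp only: mult.assoc)
  also have "?f \<pi> k * (\<Prod>i\<in>?S-{k}. ?f \<pi> i) = (\<Prod>i\<in>?S. ?f \<pi> i)"
    by (rule prod.remove[symmetric]) auto
  also have "\<dots> = z_part \<pi>" by (rule z_part_superset[symmetric]) auto
  finally show ?thesis .
qed

lemma z_part_eq_0_iff: "z_part \<pi> = 0 \<longleftrightarrow> 0 \<in># \<pi>"
  by (induction \<pi>) (auto simp: z_part_add)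

section \<open>Convolution, multiplication by p_k and the derivations k d/dp_k\<close>

lemma conv_commute: "conv F G = conv G F"
proof
  fix \<pi>
  show "conv F G \<pi> = conv G F \<pi>"
    unfolding conv_def
    by (rule sum.reindex_bij_witness[of _ "\<lambda>\<sigma>. \<pi> - \<sigma>" "\<lambda>\<sigma>. \<pi> - \<sigma>"])
       (auto simp: subset_mset.diff_diff_right mult.commute)
qed

lemma conv_add_right: "conv F (G + G') = conv F G + conv F G'"
  by (rule ext) (simp add: conv_def algebra_simps sum.distrib)

lemma conv_zero_right [simp]: "conv F 0 = 0"
  by (rule ext) (simp add: conv_def)

lemma conv_zero_left [simp]: "conv 0 F = 0"
  by (rule ext) (simp add: conv_def)

lemma conv_sum_right: "conv F (\<Sum>i\<in>A. G i) = (\<Sum>i\<in>A. conv F (G i))"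
proof (induction A rule: infinite_finite_induct)
  case (insert x A)
  then show ?case by (simp only: sum.insert conv_add_right not_False_eq_True)
qed (simp_all only: sum.infinite sum.empty conv_zero_right not_False_eq_True)

lemma conv_sum_left: "conv (\<Sum>i\<in>A. G i) F = (\<Sum>i\<in>A. conv (G i) F)"
  by (simp only: conv_commute[of _ F] conv_sum_right)

lemma conv_scale_right: "conv F (\<lambda>\<pi>. c * G \<pi>) = (\<lambda>\<pi>. c * conv F G \<pi>)"
  by (rule ext) (simp add: conv_def sum_distrib_left algebra_simps)

lemma conv_scale_left: "conv (\<lambda>\<pi>. c * F \<pi>) G = (\<lambda>\<pi>. c * conv F G \<pi>)"
  by (rule ext) (simp add: conv_def sum_distrib_left algebra_simps)

lemma p_skew_add: "p_skew k (F + G) = p_skew k F + p_skew k G"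
  by (rule ext) (simp add: p_skew_def algebra_simps)

lemma p_skew_zero [simp]: "p_skew k 0 = 0"
  by (rule ext) (simp add: p_skew_def)

lemma p_skew_sum: "p_skew k (\<Sum>i\<in>A. G i) = (\<Sum>i\<in>A. p_skew k (G i))"
  by (rule ext) (simp add: p_skew_def sum_fun_apply sum_distrib_left)

lemma p_skew_commute: "p_skew j (p_skew k F) = p_skew k (p_skew j F)"
  by (rule ext) (auto simp: p_skew_def add_mset_commute)

lemma sum_submultisets_add:
  fixes f :: "series"
  shows "(\<Sum>\<sigma> | \<sigma> \<subseteq># add_mset k \<pi> \<and> k \<in># \<sigma>. f \<sigma>) = (\<Sum>\<sigma> | \<sigma> \<subseteq># \<pi>. f (add_mset k \<sigma>))"
  by (rule sum.reindex_bij_witness[of _ "add_mset k" "\<lambda>\<sigma>. \<sigma> - {#k#}"])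
     (auto simp: subset_eq_diff_conv)

lemma conv_p_skew_aux:
  "(\<Sum>\<sigma> | \<sigma> \<subseteq># add_mset k \<pi>. real (count \<sigma> k) * (F \<sigma> * G (add_mset k \<pi> - \<sigma>))) * real k
     = conv (p_skew k F) G \<pi>"
proof -
  have "(\<Sum>\<sigma> | \<sigma> \<subseteq># add_mset k \<pi>. real (count \<sigma> k) * (F \<sigma> * G (add_mset k \<pi> - \<sigma>)))
    = (\<Sum>\<sigma> | \<sigma> \<subseteq># add_mset k \<pi> \<and> k \<in># \<sigma>. real (count \<sigma> k) * (F \<sigma> * G (add_mset k \<pi> - \<sigma>)))"
    by (rule sum.mono_neutral_right) (auto simp: finite_submultisets not_in_iff)
  also have "\<dots> = (\<Sum>\<sigma> | \<sigma> \<subseteq># \<pi>. (real (count \<sigma> k) + 1) * (F (add_mset k \<sigma>) * G (\<pi> - \<sigma>)))"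
    by (subst sum_submultisets_add) (simp add: algebra_simps)
  finally show ?thesis
    by (simp add: conv_def p_skew_def sum_distrib_left sum_distrib_right mult_ac)
qed

text \<open>The Leibniz rule for k d/dp_k. The multiplicity of k in the whole multiset is the sum of
  its multiplicities in the two pieces; each of the two resulting sums is an instance of
  \<open>conv_p_skew_aux\<close>, the second after exchanging the pieces.\<close>

lemma p_skew_conv: "p_skew k (conv F G) = conv (p_skew k F) G + conv F (p_skew k G)"
proof
  fix \<pi>
  let ?M = "add_mset k \<pi>"
  have "p_skew k (conv F G) \<pi> = (\<Sum>\<sigma> | \<sigma> \<subseteq># ?M. real (count ?M k) * (F \<sigma> * G (?M - \<sigma>))) * real k"
    by (simp add: p_skew_def conv_def sum_distrib_left sum_distrib_right algebra_simps)
  also have "\<dots> = (\<Sum>\<sigma> | \<sigma> \<subseteq># ?M. real (count \<sigma> k) * (F \<sigma> * G (?M - \<sigma>))) * real k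
       + (\<Sum>\<sigma> | \<sigma> \<subseteq># ?M. real (count (?M - \<sigma>) k) * (F \<sigma> * G (?M - \<sigma>))) * real k"
  proof -
    have "real (count ?M k) = real (count \<sigma> k) + real (count (?M - \<sigma>) k)" if "\<sigma> \<subseteq># ?M" for \<sigma>
    proof -
      have "count ?M k = count \<sigma> k + count (?M - \<sigma>) k"
        using that by (metis count_union subset_mset.add_diff_inverse)
      then show ?thesis by (metis of_nat_add)
    qed
    then have "(\<Sum>\<sigma> | \<sigma> \<subseteq># ?M. real (count ?M k) * (F \<sigma> * G (?M - \<sigma>)))
       = (\<Sum>\<sigma> | \<sigma> \<subseteq># ?M. (real (count \<sigma> k) + real (count (?M - \<sigma>) k)) * (F \<sigma> * G (?M - \<sigma>)))"
      by (intro sum.cong) auto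
    also have "\<dots> = (\<Sum>\<sigma> | \<sigma> \<subseteq># ?M. real (count \<sigma> k) * (F \<sigma> * G (?M - \<sigma>)))
       + (\<Sum>\<sigma> | \<sigma> \<subseteq># ?M. real (count (?M - \<sigma>) k) * (F \<sigma> * G (?M - \<sigma>)))"
      by (simp only: distrib_right sum.distrib)
    finally show ?thesis by (simp only: distrib_right)
  qed
  also have "(\<Sum>\<sigma> | \<sigma> \<subseteq># ?M. real (count (?M - \<sigma>) k) * (F \<sigma> * G (?M - \<sigma>)))
     = (\<Sum>\<sigma> | \<sigma> \<subseteq># ?M. real (count \<sigma> k) * (G \<sigma> * F (?M - \<sigma>)))"
    by (rule sum.reindex_bij_witness[of _ "\<lambda>\<sigma>. ?M - \<sigma>" "\<lambda>\<sigma>. ?M - \<sigma>"])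
       (auto simp: subset_mset.diff_diff_right mult.commute)
  also have "\<dots> * real k = conv (p_skew k G) F \<pi>" by (rule conv_p_skew_aux)
  finally show "p_skew k (conv F G) \<pi> = (conv (p_skew k F) G + conv F (p_skew k G)) \<pi>"
    by (simp add: conv_p_skew_aux conv_commute[of F])
qed

lemma p_mult_conv: "p_mult k (conv F G) = conv (p_mult k F) G"
proof
  fix \<pi>
  have *: "conv (p_mult k F) G \<pi> = (\<Sum>\<sigma> | \<sigma> \<subseteq># \<pi> \<and> k \<in># \<sigma>. F (\<sigma> - {#k#}) * G (\<pi> - \<sigma>))"
    unfolding conv_def p_mult_def
    by (rule sum.mono_neutral_cong_right) (auto simp: finite_submultisets)
  show "p_mult k (conv F G) \<pi> = conv (p_mult k F) G \<pi>"
  proof (cases "k \<in># \<pi>")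
    case True
    then obtain \<pi>' where \<pi>: "\<pi> = add_mset k \<pi>'" by (metis insert_DiffM)
    show ?thesis unfolding * unfolding \<pi> sum_submultisets_add by (simp add: p_mult_def conv_def)
  next
    case False
    have "{\<sigma>. \<sigma> \<subseteq># \<pi> \<and> k \<in># \<sigma>} = {}" using False by (auto dest: mset_subset_eqD)
    then have "conv (p_mult k F) G \<pi> = 0" unfolding * by (metis sum.empty)
    then show ?thesis using False by (simp add: p_mult_def)
  qed
qed

lemma p_mult_conv_right: "p_mult k (conv F G) = conv F (p_mult k G)"
  by (metis conv_commute p_mult_conv)

section \<open>Complete symmetric functions and Newton's identity\<close>

lemma h_coeff_0: "h_coeff 0 \<pi> = (if \<pi> = {#} then 1 else 0)"
  by (auto simp: h_coeff_def z_part_eq_0_iff multiset_nonemptyE)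

lemma h_mult_0 [simp]: "h_mult 0 F = F"
proof
  fix \<pi>
  have "h_mult 0 F \<pi> = (\<Sum>\<sigma>\<in>{{#}}. h_coeff 0 \<sigma> * F (\<pi> - \<sigma>))"
    unfolding conv_def
    by (rule sum.mono_neutral_right) (auto simp: finite_submultisets h_coeff_0)
  then show "h_mult 0 F \<pi> = F \<pi>" by (simp add: h_coeff_0)
qed

lemma inverse_z_part_add:
  "k \<ge> 1 \<Longrightarrow> real k * (real (count \<pi> k) + 1) / real (z_part (add_mset k \<pi>)) = 1 / real (z_part \<pi>)"
proof -
  assume "k \<ge> 1"
  then have "real k * (real (count \<pi> k) + 1) \<noteq> 0" by (simp add: add_nonneg_eq_0_iff)
  moreover have "real (z_part (add_mset k \<pi>)) = real k * (real (count \<pi> k) + 1) * real (z_part \<pi>)"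
    unfolding z_part_add of_nat_mult by simp
  ultimately show ?thesis by (metis mult.right_neutral mult_divide_mult_cancel_left)
qed

text \<open>With H(t) = exp(sum p_j t^j / j), the derivation k d/dp_k multiplies H(t) by t^k; this
  is the coefficient of t^m.\<close>

lemma p_skew_h_coeff: "k \<ge> 1 \<Longrightarrow> p_skew k (h_coeff m) = (if k \<le> m then h_coeff (m - k) else 0)"
proof
  fix \<pi> assume k: "k \<ge> 1"
  show "p_skew k (h_coeff m) \<pi> = (if k \<le> m then h_coeff (m - k) else 0) \<pi>"
  proof (cases "k + sum_mset \<pi> = m")
    case True
    then show ?thesis using inverse_z_part_add[OF k, of \<pi>] by (auto simp: p_skew_def h_coeff_def)
  next
    case False
    then show ?thesis by (auto simp: p_skew_def h_coeff_def)
  qed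
qed

lemma sum_mset_image_eq_sum_count:
  "(\<Sum>k\<in>#\<pi>. f k :: 'a :: comm_semiring_1) = (\<Sum>k\<in>set_mset \<pi>. of_nat (count \<pi> k) * f k)"
proof (induction \<pi>)
  case (add x \<pi>)
  have "(\<Sum>k\<in>set_mset (add_mset x \<pi>). of_nat (count (add_mset x \<pi>) k) * f k)
    = (\<Sum>k\<in>insert x (set_mset \<pi>). of_nat (count \<pi> k) * f k + (if k = x then f k else 0))"
    by (rule sum.cong) (auto simp: algebra_simps)
  also have "\<dots> = (\<Sum>k\<in>insert x (set_mset \<pi>). of_nat (count \<pi> k) * f k) + f x"
    unfolding sum.distrib by simp
  also have "(\<Sum>k\<in>insert x (set_mset \<pi>). of_nat (count \<pi> k) * f k) = (\<Sum>k\<in>set_mset \<pi>. of_nat (count \<pi> k) * f k)"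
    by (rule sum.mono_neutral_right) (auto simp: not_in_iff)
  finally show ?case using add by (simp add: add.commute)
qed simp

lemma sum_mset_eq_sum_count: "sum_mset \<pi> = (\<Sum>k\<in>set_mset \<pi>. count \<pi> k * (k::nat))"
  using sum_mset_image_eq_sum_count[of "\<lambda>k. k" \<pi>] by simp

text \<open>Removing a part k from \<pi> changes 1 / z by the factor k m_k, and these factors add up
  to the size of \<pi>.\<close>

lemma newton_h_coeff: "real m * h_coeff m \<pi> = (\<Sum>k=1..m. p_mult k (h_coeff (m - k)) \<pi>)"
proof (cases "sum_mset \<pi> = m")
  case True
  have le: "k \<le> m" if "k \<in># \<pi>" for k
    using that True by (auto dest!: multi_member_split)
  \<comment> \<open>The multiset may contain 0. That element is cut out because the index k starts
    at 1; it is put back afterwards with weight 0.\<close>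
  have "(\<Sum>k=1..m. p_mult k (h_coeff (m - k)) \<pi>)
      = (\<Sum>k\<in>set_mset \<pi> - {0}. real (count \<pi> k * k) * (1 / real (z_part \<pi>)))"
  proof (rule sum.mono_neutral_cong_right)
    show "set_mset \<pi> - {0} \<subseteq> {1..m}" using le by auto
    show "\<forall>i\<in>{1..m} - (set_mset \<pi> - {0}). p_mult i (h_coeff (m - i)) \<pi> = 0"
      by (auto simp: p_mult_def)
    fix k assume k: "k \<in> set_mset \<pi> - {0}"
    then obtain \<pi>' where \<pi>: "\<pi> = add_mset k \<pi>'" by (metis DiffD1 insert_DiffM)
    have "k \<ge> 1" using k by auto
    from inverse_z_part_add[OF this, of \<pi>']
    have "1 / real (z_part \<pi>') = real (count \<pi> k * k) * (1 / real (z_part \<pi>))"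
      unfolding \<pi> by (simp add: algebra_simps add_divide_distrib)
    moreover have "p_mult k (h_coeff (m - k)) \<pi> = 1 / real (z_part \<pi>')"
      using True unfolding \<pi> by (auto simp: p_mult_def h_coeff_def)
    ultimately show "p_mult k (h_coeff (m - k)) \<pi> = real (count \<pi> k * k) * (1 / real (z_part \<pi>))"
      by simp
  qed simp
  also have "\<dots> = (\<Sum>k\<in>set_mset \<pi>. real (count \<pi> k * k) * (1 / real (z_part \<pi>)))"
    by (rule sum.mono_neutral_left) auto
  also have "\<dots> = real (\<Sum>k\<in>set_mset \<pi>. count \<pi> k * k) * (1 / real (z_part \<pi>))"
    unfolding of_nat_sum sum_distrib_right ..
  also have "\<dots> = real m * h_coeff m \<pi>"
    unfolding sum_mset_eq_sum_count[symmetric] using True by (simp add: h_coeff_def)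
  finally show ?thesis by simp
next
  case False
  have "p_mult k (h_coeff (m - k)) \<pi> = 0" if "k \<in> {1..m}" for k
  proof (cases "k \<in># \<pi>")
    case True
    then obtain \<pi>' where "\<pi> = add_mset k \<pi>'" by (metis insert_DiffM)
    then show ?thesis using False that by (auto simp: p_mult_def h_coeff_def)
  qed (simp add: p_mult_def)
  then show ?thesis using False by (simp add: h_coeff_def)
qed

lemma newton_h_mult: "(\<lambda>\<pi>. real m * h_mult m F \<pi>) = (\<Sum>k=1..m. p_mult k (h_mult (m - k) F))"
proof -
  have "(\<lambda>\<pi>. real m * h_coeff m \<pi>) = (\<Sum>k=1..m. p_mult k (h_coeff (m - k)))"
    by (rule ext) (simp only: newton_h_coeff sum_fun_apply)
  then have "conv (\<lambda>\<pi>. real m * h_coeff m \<pi>) F = conv (\<Sum>k=1..m. p_mult k (h_coeff (m - k))) F" by simp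
  then show ?thesis by (simp only: conv_scale_left conv_sum_left p_mult_conv)
qed

lemma p_skew_h_mult:
  "k \<ge> 1 \<Longrightarrow> p_skew k (h_mult m F) = (if k \<le> m then h_mult (m - k) F else 0) + h_mult m (p_skew k F)"
  unfolding p_skew_conv by (cases "k \<le> m") (simp_all only: p_skew_h_coeff if_True if_False conv_zero_left)

text \<open>The adjoint of \<open>h_mult n\<close>, defined by Newton's identity n h_n = sum p_k h_(n-k).\<close>

fun h_skew :: "nat \<Rightarrow> series \<Rightarrow> series" where
  "h_skew 0 F = F"
| "h_skew (Suc n) F = (\<lambda>\<pi>. (\<Sum>j\<le>n. p_skew (Suc n - j) (h_skew j F) \<pi>) / real (Suc n))"

lemma newton_h_skew: "(\<lambda>\<pi>. real n * h_skew n F \<pi>) = (\<Sum>k=1..n. p_skew k (h_skew (n - k) F))"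
proof (cases n)
  case (Suc m)
  have "(\<Sum>j\<le>m. p_skew (Suc m - j) (h_skew j F)) = (\<Sum>k=1..n. p_skew k (h_skew (n - k) F))"
    by (rule sum.reindex_bij_witness[of _ "\<lambda>k. n - k" "\<lambda>j. n - j"]) (auto simp: Suc)
  moreover have "(\<lambda>\<pi>. real n * h_skew n F \<pi>) = (\<Sum>j\<le>m. p_skew (Suc m - j) (h_skew j F))"
    by (rule ext) (simp add: Suc sum_fun_apply del: of_nat_Suc)
  ultimately show ?thesis by simp
qed (auto simp: fun_eq_iff)

lemma p_skew_h_skew_commute: "p_skew k (h_skew n F) = h_skew n (p_skew k F)"
proof (induction n rule: less_induct)
  case (less n)
  show ?case
  proof (cases n)
    case (Suc m)
    have *: "p_skew k (p_skew i (h_skew j F)) = p_skew i (h_skew j (p_skew k F))" if "j \<le> m" for i j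
      using less[of j] that Suc by (simp add: p_skew_commute[of k i])
    have "p_skew k (h_skew n F) \<pi> = h_skew n (p_skew k F) \<pi>" for \<pi>
    proof -
      have "p_skew k (h_skew n F) \<pi> = (\<Sum>j\<le>m. p_skew k (p_skew (Suc m - j) (h_skew j F)) \<pi>) / real (Suc m)"
        unfolding Suc h_skew.simps
        by (simp add: p_skew_def sum_distrib_left del: of_nat_Suc)
      also have "\<dots> = h_skew n (p_skew k F) \<pi>"
        unfolding Suc h_skew.simps using * by simp
      finally show ?thesis .
    qed
    then show ?thesis by blast
  qed simp
qed

lemma h_skew_add: "h_skew n (F + G) = h_skew n F + h_skew n G"
proof (induction n rule: less_induct)
  case (less n)
  show ?case
  proof (cases n)
    case (Suc m)
    have *: "p_skew i (h_skew j (F + G)) \<pi> = p_skew i (h_skew j F) \<pi> + p_skew i (h_skew j G) \<pi>" if "j \<le> m" for i j \<pi>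
    proof -
      have "h_skew j (F + G) = h_skew j F + h_skew j G" using less[of j] that Suc by (simp only: le_imp_less_Suc)
      then show ?thesis by (simp only: p_skew_add plus_fun_apply)
    qed
    have **: "(\<Sum>j\<le>m. p_skew (Suc m - j) (h_skew j (F + G)) \<pi>) =
      (\<Sum>j\<le>m. p_skew (Suc m - j) (h_skew j F) \<pi>) + (\<Sum>j\<le>m. p_skew (Suc m - j) (h_skew j G) \<pi>)" for \<pi>
      unfolding sum.distrib[symmetric] by (rule sum.cong) (use * in auto)
    show ?thesis unfolding Suc
    proof (rule ext)
      fix \<pi>
      show "h_skew (Suc m) (F + G) \<pi> = (h_skew (Suc m) F + h_skew (Suc m) G) \<pi>"
        by (subst plus_fun_apply) (simp only: fun_cong[OF h_skew.simps(2)] ** add_divide_distrib)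
    qed
  qed simp
qed

lemma h_skew_zero [simp]: "h_skew n 0 = 0"
  using h_skew_add[of n 0 0] by simp

section \<open>Commuting the adjoint of h_n past multiplication by h_m\<close>

lemma sum_triangle_shift:
  fixes g :: "nat \<Rightarrow> nat \<Rightarrow> 'a::comm_monoid_add"
  shows "(\<Sum>k=1..n. \<Sum>i\<le>n-k. g k i) = (\<Sum>j\<le>n. \<Sum>k=1..j. g k (j - k))"
  unfolding sum.Sigma[OF finite_atLeastAtMost ballI[OF finite_atMost]] sum.Sigma[OF finite_atMost ballI[OF finite_atLeastAtMost]]
  by (rule sum.reindex_bij_witness[of _ "\<lambda>(j,k). (k, j - k)" "\<lambda>(k,i). (i + k, k)"]) auto

lemma sum_triangle_swap:
  fixes g :: "nat \<Rightarrow> nat \<Rightarrow> 'a::comm_monoid_add"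
  shows "(\<Sum>k=1..n. \<Sum>i\<le>n-k. g k i) = (\<Sum>i\<le>n. \<Sum>k=1..n-i. g k i)"
  unfolding sum.Sigma[OF finite_atLeastAtMost ballI[OF finite_atMost]] sum.Sigma[OF finite_atMost ballI[OF finite_atLeastAtMost]]
  by (rule sum.reindex_bij_witness[of _ "\<lambda>(i,k). (k, i)" "\<lambda>(k,i). (i, k)"]) auto

text \<open>Multiplication by h_(m-i) with the convention that h vanishes at negative indices;
  truncated subtraction alone would yield h_0 = 1.\<close>

definition h_mult_minus :: "nat \<Rightarrow> nat \<Rightarrow> series \<Rightarrow> series" where
  "h_mult_minus m i F = (if i \<le> m then h_mult (m - i) F else 0)"

lemma h_mult_minus_0 [simp]: "h_mult_minus m 0 F = h_mult m F"
  by (simp add: h_mult_minus_def)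

lemma h_mult_minus_sum: "h_mult_minus m i (\<Sum>x\<in>A. G x) = (\<Sum>x\<in>A. h_mult_minus m i (G x))"
  by (simp add: h_mult_minus_def conv_sum_right)

lemma h_mult_minus_scale: "h_mult_minus m i (\<lambda>\<pi>. c * F \<pi>) = (\<lambda>\<pi>. c * h_mult_minus m i F \<pi>)"
  by (auto simp: h_mult_minus_def conv_scale_right fun_eq_iff)

lemma p_skew_h_mult_minus:
  "k \<ge> 1 \<Longrightarrow> p_skew k (h_mult_minus m i F) = h_mult_minus m (k + i) F + h_mult_minus m i (p_skew k F)"
  by (auto simp: h_mult_minus_def p_skew_h_mult diff_diff_left add.commute)

lemma fun_cancel_Suc: "(\<lambda>\<pi>. real (Suc n) * F \<pi>) = (\<lambda>\<pi>. real (Suc n) * G \<pi>) \<Longrightarrow> F = G"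
  by (auto simp: fun_eq_iff simp del: of_nat_Suc)

lemma sum_triangle_weights:
  fixes g :: "nat \<Rightarrow> series"
  shows "(\<Sum>j\<le>n. \<Sum>k=1..j. g j) = (\<lambda>\<pi>. \<Sum>j\<le>n. real j * g j \<pi>)"
  by (rule ext) (simp add: sum_fun_apply)

text \<open>Multiply by n and expand by Newton's identity. Each \<open>p_skew k\<close> either
  lowers the factor h or joins the remaining adjoint. The first kind of terms collects the summand
  with index j exactly j times, the second kind n - j times, again by Newton's identity; together n
  times.\<close>

lemma h_skew_h_mult: "h_skew n (h_mult m F) = (\<Sum>i\<le>n. h_mult_minus m i (h_skew (n - i) F))"
proof (induction n rule: less_induct)
  case (less n)
  show ?case
  proof (cases n)
    case 0
    then show ?thesis by simp
  next
    case (Suc n')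
    have "(\<lambda>\<pi>. real n * h_skew n (h_mult m F) \<pi>) = (\<Sum>k=1..n. p_skew k (h_skew (n - k) (h_mult m F)))"
      by (rule newton_h_skew)
    also have "\<dots> = (\<Sum>k=1..n. \<Sum>i\<le>n-k. p_skew k (h_mult_minus m i (h_skew (n - k - i) F)))"
      by (rule sum.cong) (use less Suc in \<open>auto simp: p_skew_sum\<close>)
    also have "\<dots> = (\<Sum>k=1..n. \<Sum>i\<le>n-k. h_mult_minus m (k + i) (h_skew (n - k - i) F))
        + (\<Sum>k=1..n. \<Sum>i\<le>n-k. h_mult_minus m i (p_skew k (h_skew (n - k - i) F)))"
      unfolding sum.distrib[symmetric] by (intro sum.cong) (auto simp: p_skew_h_mult_minus)
    also have "(\<Sum>k=1..n. \<Sum>i\<le>n-k. h_mult_minus m (k + i) (h_skew (n - k - i) F))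
        = (\<Sum>j\<le>n. \<Sum>k=1..j. h_mult_minus m j (h_skew (n - j) F))"
      unfolding sum_triangle_shift by (intro sum.cong) auto
    also have "\<dots> = (\<lambda>\<pi>. \<Sum>j\<le>n. real j * h_mult_minus m j (h_skew (n - j) F) \<pi>)"
      by (rule sum_triangle_weights)
    also have "(\<Sum>k=1..n. \<Sum>i\<le>n-k. h_mult_minus m i (p_skew k (h_skew (n - k - i) F)))
        = (\<Sum>i\<le>n. h_mult_minus m i (\<Sum>k=1..n-i. p_skew k (h_skew (n - i - k) F)))"
      unfolding sum_triangle_swap h_mult_minus_sum by (intro sum.cong) (auto simp: add.commute)
    also have "\<dots> = (\<lambda>\<pi>. \<Sum>i\<le>n. real (n - i) * h_mult_minus m i (h_skew (n - i) F) \<pi>)"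
      unfolding newton_h_skew[symmetric] h_mult_minus_scale by (rule ext) (simp add: sum_fun_apply)
    also have "(\<lambda>\<pi>. \<Sum>j\<le>n. real j * h_mult_minus m j (h_skew (n - j) F) \<pi>) + \<dots>
       = (\<lambda>\<pi>. real n * (\<Sum>i\<le>n. h_mult_minus m i (h_skew (n - i) F)) \<pi>)"
    proof (rule ext)
      fix \<pi>
      have "(\<Sum>j\<le>n. real j * h_mult_minus m j (h_skew (n - j) F) \<pi>) + (\<Sum>j\<le>n. real (n - j) * h_mult_minus m j (h_skew (n - j) F) \<pi>)
        = (\<Sum>j\<le>n. real n * h_mult_minus m j (h_skew (n - j) F) \<pi>)"
        unfolding sum.distrib[symmetric] by (intro sum.cong) (auto simp: of_nat_diff algebra_simps)
      then show "((\<lambda>\<pi>. \<Sum>j\<le>n. real j * h_mult_minus m j (h_skew (n - j) F) \<pi>) +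
         (\<lambda>\<pi>. \<Sum>i\<le>n. real (n - i) * h_mult_minus m i (h_skew (n - i) F) \<pi>)) \<pi> =
         real n * (\<Sum>i\<le>n. h_mult_minus m i (h_skew (n - i) F)) \<pi>"
        by (simp add: sum_fun_apply sum_distrib_left)
    qed
    finally show ?thesis unfolding Suc by (rule fun_cancel_Suc)
  qed
qed

section \<open>Skewing the constant series and the sum of all Schur functions\<close>

lemma odd_even_count: "(\<Sum>k=1..N. (if 2 * k \<le> N then 1 else 0) + (if odd k then 1 else 0)) = (N::nat)"
proof -
  have 1: "(\<Sum>k=1..N. if odd k then 1 else 0) = (N + 1) div 2"
    by (induction N) auto
  have 2: "(\<Sum>k=1..N. if 2 * k \<le> N then 1 else 0) = N div 2"
  proof -
    have "(\<Sum>k=1..N. if 2 * k \<le> N then 1 else 0) = (\<Sum>k=1..N div 2. (1::nat))"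
      by (rule sum.mono_neutral_cong_right) auto
    then show ?thesis by simp
  qed
  show ?thesis unfolding sum.distrib 1 2 by arith
qed

definition unit_coeff :: "series" where
  "unit_coeff \<pi> = (if \<pi> = {#} then 1 else 0)"

lemma p_skew_unit_coeff [simp]: "p_skew k unit_coeff = 0"
  by (rule ext) (simp add: p_skew_def unit_coeff_def)

lemma h_skew_unit_coeff: "h_skew n unit_coeff = (if n = 0 then unit_coeff else 0)"
proof (cases n)
  case (Suc m)
  have "h_skew n unit_coeff \<pi> = 0" for \<pi>
  proof -
    have "(\<lambda>\<pi>. real n * h_skew n unit_coeff \<pi>) = (\<Sum>k=1..n. h_skew (n - k) (p_skew k unit_coeff))"
      by (simp only: newton_h_skew p_skew_h_skew_commute)
    also have "\<dots> = 0"
    proof (rule sum.neutral, rule ballI)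
      fix k show "h_skew (n - k) (p_skew k unit_coeff) = 0" by (simp only: p_skew_unit_coeff h_skew_zero)
    qed
    finally have "real n * h_skew n unit_coeff \<pi> = 0" by (metis zero_fun_apply)
    then show ?thesis unfolding Suc by (simp del: h_skew.simps of_nat_Suc)
  qed
  then show ?thesis using Suc by (auto simp: fun_eq_iff)
qed simp

text \<open>The assumption is the differential equation satisfied by \<open>schur_series\<close>. In
  n times the left side, h_j T arises in three ways: by lowering some h_(j+k), through the odd k,
  and through multiplication by p_k. The first two have multiplicities floor((n-j)/2) and
  ceil((n-j)/2), adding to n - j by \<open>odd_even_count\<close>; the third has j by Newton's
  identity.\<close>

lemma h_skew_T:
  assumes T: "\<And>k. k \<ge> 1 \<Longrightarrow> p_skew k T = (if odd k then T else 0) + p_mult k T"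
  shows "h_skew n T = (\<Sum>i\<le>n. h_mult i T)"
proof (induction n rule: less_induct)
  case (less n)
  show ?case
  proof (cases n)
    case (Suc n')
    let ?o = "\<lambda>k. if odd k then 1 else 0 :: real"
    have "(\<lambda>\<pi>. real n * h_skew n T \<pi>) = (\<Sum>k=1..n. p_skew k (h_skew (n - k) T))"
      by (rule newton_h_skew)
    also have "\<dots> = (\<Sum>k=1..n. \<Sum>i\<le>n-k. p_skew k (h_mult i T))"
      by (rule sum.cong) (use less Suc in \<open>auto simp: p_skew_sum\<close>)
    also have "\<dots> = (\<lambda>\<pi>. \<Sum>k=1..n. \<Sum>i\<le>n-k. h_mult_minus i k T \<pi> + ?o k * h_mult i T \<pi> + p_mult k (h_mult i T) \<pi>)"
    proof (rule ext)
      fix \<pi>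
      show "(\<Sum>k=1..n. \<Sum>i\<le>n-k. p_skew k (h_mult i T)) \<pi>
        = (\<Sum>k=1..n. \<Sum>i\<le>n-k. h_mult_minus i k T \<pi> + ?o k * h_mult i T \<pi> + p_mult k (h_mult i T) \<pi>)"
        unfolding sum_fun_apply
        by (intro sum.cong refl)
           (auto simp: p_skew_h_mult T h_mult_minus_def conv_add_right p_mult_conv_right)
    qed
    also have "\<dots> = (\<lambda>\<pi>. real n * (\<Sum>i\<le>n. h_mult i T) \<pi>)"
    proof (rule ext)
      fix \<pi>
      have "(\<Sum>k=1..n. \<Sum>i\<le>n-k. h_mult_minus i k T \<pi> + ?o k * h_mult i T \<pi> + p_mult k (h_mult i T) \<pi>)
        = (\<Sum>k=1..n. \<Sum>i\<le>n-k. h_mult_minus i k T \<pi>) + (\<Sum>k=1..n. \<Sum>i\<le>n-k. ?o k * h_mult i T \<pi>)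
          + (\<Sum>k=1..n. \<Sum>i\<le>n-k. p_mult k (h_mult i T) \<pi>)"
        by (simp only: sum.distrib)
      also have "(\<Sum>k=1..n. \<Sum>i\<le>n-k. p_mult k (h_mult i T) \<pi>) = (\<Sum>j\<le>n. real j * h_mult j T \<pi>)"
        unfolding sum_triangle_shift
        using newton_h_mult[of _ T] by (simp add: fun_eq_iff sum_fun_apply)
      also have "(\<Sum>k=1..n. \<Sum>i\<le>n-k. ?o k * h_mult i T \<pi>) = (\<Sum>j\<le>n. \<Sum>k=1..n-j. ?o k * h_mult j T \<pi>)"
        by (rule sum_triangle_swap)
      also have "(\<Sum>k=1..n. \<Sum>i\<le>n-k. h_mult_minus i k T \<pi>) = (\<Sum>k=1..n. \<Sum>j\<le>n-k. if j + 2 * k \<le> n then h_mult j T \<pi> else 0)"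
      proof (rule sum.cong[OF refl])
        fix k assume "k \<in> {1..n}"
        have "(\<Sum>i\<le>n-k. h_mult_minus i k T \<pi>) = (\<Sum>i\<in>{k..n-k}. h_mult (i - k) T \<pi>)"
          by (rule sum.mono_neutral_cong_right) (auto simp: h_mult_minus_def)
        \<comment> \<open>With i = j + k the bound i \<le> n - k becomes j + 2k \<le> n. This factor
          2 is the source of floor((n-j)/2).\<close>
        also have "\<dots> = (\<Sum>j\<in>{j. j + 2 * k \<le> n}. h_mult j T \<pi>)"
          by (rule sum.reindex_bij_witness[of _ "\<lambda>j. j + k" "\<lambda>i. i - k"]) auto
        also have "\<dots> = (\<Sum>j\<le>n-k. if j + 2 * k \<le> n then h_mult j T \<pi> else 0)"
          by (rule sum.mono_neutral_cong_left) auto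
        finally show "(\<Sum>i\<le>n-k. h_mult_minus i k T \<pi>) = (\<Sum>j\<le>n-k. if j + 2 * k \<le> n then h_mult j T \<pi> else 0)" .
      qed
      also have "\<dots> = (\<Sum>j\<le>n. \<Sum>k=1..n-j. if j + 2 * k \<le> n then h_mult j T \<pi> else 0)"
        by (rule sum_triangle_swap)
      also have "\<dots> + (\<Sum>j\<le>n. \<Sum>k=1..n-j. ?o k * h_mult j T \<pi>) = (\<Sum>j\<le>n. real (n - j) * h_mult j T \<pi>)"
        unfolding sum.distrib[symmetric]
      proof (rule sum.cong[OF refl])
        fix j assume j: "j \<in> {..n}"
        have "real (n - j) = (\<Sum>k=1..n-j. (if 2 * k \<le> n - j then 1 else 0) + ?o k)"
          by (subst odd_even_count[of "n - j", symmetric], unfold of_nat_sum, rule sum.cong) auto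
        then show "(\<Sum>k=1..n-j. (if j + 2 * k \<le> n then h_mult j T \<pi> else 0) + ?o k * h_mult j T \<pi>) = real (n - j) * h_mult j T \<pi>"
          using j by (simp add: sum_distrib_right) (intro sum.cong, auto)
      qed
      also have "\<dots> + (\<Sum>j\<le>n. real j * h_mult j T \<pi>) = (\<Sum>j\<le>n. real n * h_mult j T \<pi>)"
        unfolding sum.distrib[symmetric] by (intro sum.cong) (auto simp: of_nat_diff algebra_simps)
      finally show "(\<Sum>k=1..n. \<Sum>i\<le>n-k. h_mult_minus i k T \<pi> + ?o k * h_mult i T \<pi> + p_mult k (h_mult i T) \<pi>)
         = real n * (\<Sum>i\<le>n. h_mult i T) \<pi>"
        by (simp add: sum_fun_apply sum_distrib_left)
    qed
    finally show ?thesis unfolding Suc by (rule fun_cancel_Suc)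
  qed simp
qed

section \<open>The scalar product and adjointness\<close>

lemma partitions_of_add_mset:
  "k \<ge> 1 \<Longrightarrow> add_mset k \<pi> \<in> partitions_of (n + k) \<longleftrightarrow> \<pi> \<in> partitions_of n"
  by (auto simp: partitions_of_def is_partition_def)

lemma finite_partitions_of [simp]: "finite (partitions_of n)"
proof (induction n rule: less_induct)
  case (less n)
  have "partitions_of n \<subseteq> insert {#} (\<Union>k\<in>{1..n}. add_mset k ` partitions_of (n - k))"
  proof
    fix \<pi> assume \<pi>: "\<pi> \<in> partitions_of n"
    show "\<pi> \<in> insert {#} (\<Union>k\<in>{1..n}. add_mset k ` partitions_of (n - k))"
    proof (cases "\<pi> = {#}")
      case False
      then obtain k \<pi>' where \<pi>': "\<pi> = add_mset k \<pi>'" by (metis multiset_cases)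
      then have "k \<in> {1..n}" "\<pi>' \<in> partitions_of (n - k)"
        using \<pi> by (auto simp: partitions_of_def is_partition_def)
      then show ?thesis using \<pi>' by blast
    qed simp
  qed
  moreover have "finite (\<Union>k\<in>{1..n}. add_mset k ` partitions_of (n - k))"
    using less by auto
  ultimately show ?case by (meson finite_insert finite_subset)
qed

lemma z_part_partition: "\<pi> \<in> partitions_of n \<Longrightarrow> z_part \<pi> > 0"
  using z_part_eq_0_iff[of \<pi>] by (auto simp: partitions_of_def is_partition_def)

text \<open>The Hall scalar product in degree n: the power sum products are orthogonal and p_\<pi>
  has squared norm z_\<pi>.\<close>

definition p_inner :: "nat \<Rightarrow> series \<Rightarrow> series \<Rightarrow> real" where
  "p_inner n F G = (\<Sum>\<pi>\<in>partitions_of n. real (z_part \<pi>) * F \<pi> * G \<pi>)"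

lemma p_inner_p_mult:
  assumes "k \<ge> 1"
  shows "p_inner (n + k) (p_mult k F) G = p_inner n F (p_skew k G)"
proof -
  have "p_inner (n + k) (p_mult k F) G
      = (\<Sum>\<pi>\<in>{\<pi>\<in>partitions_of (n + k). k \<in># \<pi>}. real (z_part \<pi>) * F (\<pi> - {#k#}) * G \<pi>)"
    unfolding p_inner_def by (rule sum.mono_neutral_cong_right) (auto simp: p_mult_def)
  also have "\<dots> = (\<Sum>\<pi>\<in>partitions_of n. real (z_part (add_mset k \<pi>)) * F \<pi> * G (add_mset k \<pi>))"
    by (rule sum.reindex_bij_witness[of _ "add_mset k" "\<lambda>\<pi>. \<pi> - {#k#}"])
       (use assms in \<open>auto simp: partitions_of_add_mset dest!: multi_member_split\<close>)
  also have "\<dots> = p_inner n F (p_skew k G)"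
    unfolding p_inner_def p_skew_def z_part_add by (rule sum.cong) (auto simp: algebra_simps)
  finally show ?thesis .
qed

lemma p_inner_sum_left: "p_inner n (\<Sum>i\<in>A. F i) G = (\<Sum>i\<in>A. p_inner n (F i) G)"
  unfolding p_inner_def sum_fun_apply sum_distrib_left sum_distrib_right by (rule sum.swap)

lemma p_inner_sum_right: "p_inner n G (\<Sum>i\<in>A. F i) = (\<Sum>i\<in>A. p_inner n G (F i))"
  unfolding p_inner_def sum_fun_apply sum_distrib_left sum_distrib_right by (rule sum.swap)

lemma p_inner_scale_left: "p_inner n (\<lambda>\<pi>. c * F \<pi>) G = c * p_inner n F G"
  by (simp add: p_inner_def sum_distrib_left mult_ac)

lemma p_inner_scale_right: "p_inner n F (\<lambda>\<pi>. c * G \<pi>) = c * p_inner n F G"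
  by (simp add: p_inner_def sum_distrib_left mult_ac)

lemma p_inner_commute: "p_inner n F G = p_inner n G F"
  by (simp add: p_inner_def mult_ac)

text \<open>Both operators obey Newton's identity, one with \<open>p_mult\<close> and the other with
  its adjoint \<open>p_skew\<close>, so adjointness passes up by induction on m.\<close>

lemma p_inner_h_mult: "p_inner (n + m) (h_mult m F) G = p_inner n F (h_skew m G)"
proof (induction m arbitrary: F G rule: less_induct)
  case (less m)
  show ?case
  proof (cases m)
    case (Suc m')
    have "real m * p_inner (n + m) (h_mult m F) G = p_inner (n + m) (\<Sum>k=1..m. p_mult k (h_mult (m - k) F)) G"
      unfolding newton_h_mult[symmetric] p_inner_scale_left ..
    also have "\<dots> = (\<Sum>k=1..m. p_inner n F (h_skew (m - k) (p_skew k G)))"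
      unfolding p_inner_sum_left
    proof (rule sum.cong[OF refl])
      fix k assume k: "k \<in> {1..m}"
      have "p_inner (n + m) (p_mult k (h_mult (m - k) F)) G = p_inner (n + (m - k) + k) (p_mult k (h_mult (m - k) F)) G"
        using k by simp
      also have "\<dots> = p_inner (n + (m - k)) (h_mult (m - k) F) (p_skew k G)"
        using k by (intro p_inner_p_mult) auto
      also have "\<dots> = p_inner n F (h_skew (m - k) (p_skew k G))"
        using k by (intro less) auto
      finally show "p_inner (n + m) (p_mult k (h_mult (m - k) F)) G = p_inner n F (h_skew (m - k) (p_skew k G))" .
    qed
    also have "\<dots> = real m * p_inner n F (h_skew m G)"
      unfolding p_inner_scale_right[symmetric] newton_h_skew p_inner_sum_right p_skew_h_skew_commute ..
    finally show ?thesis using Suc by simp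
  qed simp
qed

text \<open>H(e) = sum e^m h_m, exp(- sum p_2k / 2k) and exp(sum p_k^2 / 2k); \<open>schur_series\<close> turns out to be the
  sum of all Schur functions.\<close>

definition h_series :: "real \<Rightarrow> series" where
  "h_series e \<pi> = e ^ sum_mset \<pi> / real (z_part \<pi>)"

definition double_series :: "series" where
  "double_series \<pi> = (if \<forall>i\<in>#\<pi>. even i then (-1) ^ size \<pi> / real (z_part \<pi>) else 0)"

definition square_series :: "series" where
  "square_series \<pi> = (\<Sum>\<tau> | \<tau> + \<tau> = \<pi>. 1 / real (z_part (double_parts \<tau>)))"

definition schur_series :: "series" where
  "schur_series = conv (h_series 1) (conv double_series square_series)"

section \<open>Logarithmic derivatives of the explicit series\<close>

lemma scaled_inverse_z_part_add:
  "k \<ge> 1 \<Longrightarrow> real k * (real (count \<pi> k) + 1) * (c / real (z_part (add_mset k \<pi>))) = c / real (z_part \<pi>)"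
  using arg_cong[OF inverse_z_part_add[of k \<pi>], of "\<lambda>x. c * x"] by (simp add: mult_ac)

lemma p_skew_h_series: "k \<ge> 1 \<Longrightarrow> p_skew k (h_series e) = (\<lambda>\<pi>. e ^ k * h_series e \<pi>)"
proof
  fix \<pi> assume "k \<ge> 1"
  from scaled_inverse_z_part_add[OF this, of \<pi> "e ^ k * e ^ sum_mset \<pi>"]
  show "p_skew k (h_series e) \<pi> = e ^ k * h_series e \<pi>"
    by (simp add: p_skew_def h_series_def power_add)
qed

lemma p_skew_double_series: "k \<ge> 1 \<Longrightarrow> p_skew k double_series = (\<lambda>\<pi>. (if even k then - 1 else 0) * double_series \<pi>)"
proof
  fix \<pi> assume "k \<ge> 1"
  from scaled_inverse_z_part_add[OF this, of \<pi> "- ((-1) ^ size \<pi>)"]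
  show "p_skew k double_series \<pi> = (if even k then - 1 else 0) * double_series \<pi>"
    by (auto simp: p_skew_def double_series_def)
qed

lemma count_double_parts: "count (double_parts \<tau>) (2 * k) = count \<tau> k"
  by (induction \<tau>) (auto simp: double_parts_def)

lemma p_skew_square_series: 
  assumes k: "k \<ge> 1"
  shows "p_skew k square_series = p_mult k square_series"
proof
  fix \<pi>
  show "p_skew k square_series \<pi> = p_mult k square_series \<pi>"
  proof (cases "k \<in># \<pi>")
    case False
    have "\<tau> + \<tau> \<noteq> add_mset k \<pi>" for \<tau>
    proof
      assume "\<tau> + \<tau> = add_mset k \<pi>"
      then have "count \<tau> k + count \<tau> k = count \<pi> k + 1" by (metis count_add_mset count_union Suc_eq_plus1)
      then have "count \<tau> k + count \<tau> k = 1" using False by (simp only: not_in_iff)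
      then show False by presburger
    qed
    then show ?thesis using False by (simp add: p_skew_def p_mult_def square_series_def)
  next
    case True
    then obtain \<pi>' where \<pi>: "\<pi> = add_mset k \<pi>'" by (metis multi_member_split)
    have "square_series (add_mset k \<pi>) = (\<Sum>\<tau> | \<tau> + \<tau> = \<pi>'. 1 / real (z_part (double_parts (add_mset k \<tau>))))"
      unfolding square_series_def
    proof (rule sum.reindex_bij_witness[of _ "add_mset k" "\<lambda>\<tau>. \<tau> - {#k#}"])
      fix \<tau> assume "\<tau> \<in> {\<tau>. \<tau> + \<tau> = add_mset k \<pi>}"
      then have *: "\<tau> + \<tau> = add_mset k \<pi>" by simp
      then have "k \<in># \<tau>" by (metis union_iff union_single_eq_member)
      then obtain \<tau>' where \<tau>': "\<tau> = add_mset k \<tau>'" by (metis multi_member_split)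
      then show "add_mset k (\<tau> - {#k#}) = \<tau>" by simp
      show "\<tau> - {#k#} \<in> {\<tau>. \<tau> + \<tau> = \<pi>'}" using * unfolding \<tau>' \<pi> by simp
      show "1 / real (z_part (double_parts (add_mset k (\<tau> - {#k#})))) = 1 / real (z_part (double_parts \<tau>))"
        using \<tau>' by simp
    qed (auto simp: \<pi>)
    also have "real k * (real (count \<pi> k) + 1) * \<dots> = (\<Sum>\<tau> | \<tau> + \<tau> = \<pi>'. 1 / real (z_part (double_parts \<tau>)))"
      unfolding sum_distrib_left
    proof (rule sum.cong[OF refl])
      fix \<tau> assume "\<tau> \<in> {\<tau>. \<tau> + \<tau> = \<pi>'}"
      \<comment> \<open>As \<pi> is \<tau> + \<tau> with one more k, its factor k (count + 1) equals
        2k (count \<tau> k + 1). This is precisely what z loses when a part 2k is removed from the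
        doubled multiset.\<close>
      then have "count \<pi>' k = count \<tau> k + count \<tau> k" by auto
      then have c: "real k * (real (count \<pi> k) + 1) = real (2 * k) * (real (count (double_parts \<tau>) (2 * k)) + 1)"
        unfolding \<pi> count_double_parts by simp
      have "double_parts (add_mset k \<tau>) = add_mset (2 * k) (double_parts \<tau>)" by (simp add: double_parts_def)
      then show "real k * (real (count \<pi> k) + 1) * (1 / real (z_part (double_parts (add_mset k \<tau>)))) = 1 / real (z_part (double_parts \<tau>))"
        unfolding c using k by (simp only: scaled_inverse_z_part_add)
    qed
    finally show ?thesis using True by (simp add: p_skew_def p_mult_def square_series_def \<pi>)
  qed
qed

text \<open>The three factors have logarithmic derivatives 1, -[k even] and p_k under k d/dp_k;
  their sum is [k odd] + p_k.\<close>

lemma p_skew_schur_series: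
  assumes "k \<ge> 1"
  shows "p_skew k schur_series = (if odd k then schur_series else 0) + p_mult k schur_series"
proof -
  have "p_skew k schur_series = schur_series + ((\<lambda>\<pi>. (if even k then - 1 else 0) * schur_series \<pi>) + p_mult k schur_series)"
    unfolding schur_series_def p_skew_conv p_skew_h_series[OF assms] p_skew_double_series[OF assms] p_skew_square_series[OF assms]
      conv_scale_left conv_add_right conv_scale_right p_mult_conv_right by (simp add: fun_eq_iff)
  then show ?thesis by (auto simp: fun_eq_iff)
qed

lemma conv_empty: "conv F G {#} = F {#} * G {#}"
  by (simp add: conv_def)

lemma schur_series_empty: "schur_series {#} = 1"
proof -
  have "{\<tau>. \<tau> + \<tau> = ({#} :: nat multiset)} = {{#}}" by auto
  then have "square_series {#} = 1" unfolding square_series_def double_parts_def by simp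
  then show ?thesis by (simp add: schur_series_def conv_empty h_series_def double_series_def)
qed

lemma conv_h_series:
  assumes "sum_mset \<pi> = n"
  shows "conv (h_series e) F \<pi> = (\<Sum>m\<le>n. e ^ m * h_mult m F \<pi>)"
proof -
  have "h_series e \<sigma> = (\<Sum>m\<le>n. e ^ m * h_coeff m \<sigma>)" if "\<sigma> \<subseteq># \<pi>" for \<sigma>
  proof -
    have le: "sum_mset \<sigma> \<le> n" using that assms
      by (metis le_add1 subset_mset.add_diff_inverse sum_mset.union)
    have "(\<Sum>m\<le>n. e ^ m * h_coeff m \<sigma>) = (\<Sum>m\<in>{sum_mset \<sigma>}. e ^ m * h_coeff m \<sigma>)"
      by (rule sum.mono_neutral_right) (use le in \<open>auto simp: h_coeff_def\<close>)
    then show ?thesis by (simp add: h_series_def h_coeff_def)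
  qed
  then have "conv (h_series e) F \<pi> = (\<Sum>\<sigma> | \<sigma> \<subseteq># \<pi>. \<Sum>m\<le>n. e ^ m * (h_coeff m \<sigma> * F (\<pi> - \<sigma>)))"
    unfolding conv_def by (intro sum.cong) (auto simp: sum_distrib_right mult.assoc)
  also have "\<dots> = (\<Sum>m\<le>n. e ^ m * h_mult m F \<pi>)"
    unfolding conv_def sum_distrib_left by (rule sum.swap)
  finally show ?thesis .
qed

section \<open>The coefficients C and D as a fourfold convolution\<close>

lemma conv_pairs: "conv F G \<pi> = (\<Sum>(\<sigma>, \<tau>) | \<sigma> + \<tau> = \<pi>. F \<sigma> * G \<tau>)"
  unfolding conv_def
  by (rule sum.reindex_bij_witness[of _ fst "\<lambda>\<sigma>. (\<sigma>, \<pi> - \<sigma>)"]) auto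

lemma finite_pairs: "finite {(\<sigma>, \<tau>). \<sigma> + \<tau> = (\<pi> :: nat multiset)}"
proof (rule finite_subset)
  show "{(\<sigma>, \<tau>). \<sigma> + \<tau> = \<pi>} \<subseteq> (\<lambda>\<sigma>. (\<sigma>, \<pi> - \<sigma>)) ` {\<sigma>. \<sigma> \<subseteq># \<pi>}" by auto
qed (simp add: finite_submultisets)

lemma conv4:
  "conv F (conv G (conv A B)) \<pi> = (\<Sum>(a, b, c, d) | a + (b + (c + d)) = \<pi>. F a * (G b * (A c * B d)))"
proof -
  have 3: "conv G (conv A B) \<pi> = (\<Sum>(b, c, d) | b + (c + d) = \<pi>. G b * (A c * B d))" for \<pi>
  proof -
    have "conv G (conv A B) \<pi> = (\<Sum>x\<in>{(\<sigma>, \<tau>). \<sigma> + \<tau> = \<pi>}. \<Sum>y\<in>{(c, d). c + d = snd x}. G (fst x) * (A (fst y) * B (snd y)))"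
      unfolding conv_pairs[of G] by (intro sum.cong) (auto simp: conv_pairs sum_distrib_left split_beta)
    also have "\<dots> = (\<Sum>(b, c, d) | b + (c + d) = \<pi>. G b * (A c * B d))"
      by (subst sum.Sigma, simp add: finite_pairs, simp add: finite_pairs,
          rule sum.reindex_bij_witness[of _ "\<lambda>(b,c,d). ((b, c + d), (c, d))" "\<lambda>(x, y). (fst x, y)"]) auto
    finally show ?thesis .
  qed
  have fin: "finite {(b, c, d). b + (c + d) = (\<pi> :: nat multiset)}" for \<pi>
  proof (rule finite_subset)
    show "{(b, c, d). b + (c + d) = \<pi>} \<subseteq> {\<sigma>. \<sigma> \<subseteq># \<pi>} \<times> {\<sigma>. \<sigma> \<subseteq># \<pi>} \<times> {\<sigma>. \<sigma> \<subseteq># \<pi>}"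
      by (auto simp: subset_mset.add_increasing)
  qed (simp add: finite_submultisets)
  have "conv F (conv G (conv A B)) \<pi> = (\<Sum>x\<in>{(\<sigma>, \<tau>). \<sigma> + \<tau> = \<pi>}. \<Sum>y\<in>{(b, c, d). b + (c + d) = snd x}. F (fst x) * (case y of (b, c, d) \<Rightarrow> G b * (A c * B d)))"
    unfolding conv_pairs[of F] by (intro sum.cong) (auto simp: 3 sum_distrib_left split_beta)
  also have "\<dots> = (\<Sum>(a, b, c, d) | a + (b + (c + d)) = \<pi>. F a * (G b * (A c * B d)))"
    by (subst sum.Sigma, simp add: finite_pairs, simp add: fin,
        rule sum.reindex_bij_witness[of _ "\<lambda>(a,b,c,d). ((a, b + (c + d)), (b, c, d))" "\<lambda>(x, y). (fst x, y)"]) auto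
  finally show ?thesis .
qed

lemma finite_quads: "finite {(a, b, c, d). a + (b + (c + d)) = (\<pi> :: nat multiset)}"
proof (rule finite_subset)
  show "{(a, b, c, d). a + (b + (c + d)) = \<pi>} \<subseteq> {\<sigma>. \<sigma> \<subseteq># \<pi>} \<times> {\<sigma>. \<sigma> \<subseteq># \<pi>} \<times> {\<sigma>. \<sigma> \<subseteq># \<pi>} \<times> {\<sigma>. \<sigma> \<subseteq># \<pi>}"
    by (auto simp: subset_mset.add_increasing)
qed (simp add: finite_submultisets)

lemma inj_double_parts: "double_parts \<sigma> = double_parts \<tau> \<Longrightarrow> \<sigma> = \<tau>"
  by (metis count_double_parts multiset_eqI)

lemma inj_union_self: "\<sigma> + \<sigma> = \<tau> + \<tau> \<Longrightarrow> \<sigma> = (\<tau> :: nat multiset)"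
proof (rule multiset_eqI)
  fix x assume "\<sigma> + \<sigma> = \<tau> + \<tau>"
  then have "count (\<sigma> + \<sigma>) x = count (\<tau> + \<tau>) x" by simp
  then show "count \<sigma> x = count \<tau> x" by simp
qed

lemma square_series_double: "square_series (\<tau> + \<tau>) = 1 / real (z_part (double_parts \<tau>))"
proof -
  have "{\<sigma>. \<sigma> + \<sigma> = \<tau> + \<tau>} = {\<tau>}" by (auto dest: inj_union_self)
  then show ?thesis by (simp add: square_series_def)
qed

lemma double_series_double: "double_series (double_parts \<tau>) = (-1) ^ size \<tau> / real (z_part (double_parts \<tau>))"
  by (simp add: double_series_def) (simp add: double_parts_def)

lemma double_parts_half: "\<forall>i\<in>#\<sigma>. even i \<Longrightarrow> \<exists>\<tau>. \<sigma> = double_parts \<tau>"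
proof (induction \<sigma>)
  case empty
  have "{#} = double_parts {#}" by (simp add: double_parts_def)
  then show ?case by blast
next
  case (add x \<sigma>)
  then obtain \<tau> where "\<sigma> = double_parts \<tau>" by auto
  moreover obtain k where "x = 2 * k" using add.prems by auto
  ultimately have "add_mset x \<sigma> = double_parts (add_mset k \<tau>)" by (simp add: double_parts_def)
  then show ?case by blast
qed

text \<open>The map \<open>h\<close> puts \<rho>_- first, since that is the factor marked by e.
  Splittings outside its image contribute nothing: an element 0 makes the relevant 1 / z vanish, an
  odd element makes \<open>double_series\<close> vanish, and a last component not of the form \<tau>
  + \<tau> makes \<open>square_series\<close> an empty sum.\<close>

lemma quadruple_sum:
  "(\<Sum>q\<in>quadruples \<pi>. e ^ sum_mset (fst (snd q)) * real_of_rat (quad_weight q)) = conv (h_series e) schur_series \<pi>"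
proof -
  define h :: "nat multiset \<times> nat multiset \<times> nat multiset \<times> nat multiset \<Rightarrow> _"
    where "h = (\<lambda>(r, m, s, t). (m, r, double_parts s, t + t))"
  let ?f = "\<lambda>(a, b, c, d). h_series e a * (h_series 1 b * (double_series c * square_series d))"
  have inj: "inj_on h (quadruples \<pi>)"
    by (auto simp: inj_on_def h_def dest: inj_double_parts inj_union_self)
  have "(\<Sum>q\<in>quadruples \<pi>. e ^ sum_mset (fst (snd q)) * real_of_rat (quad_weight q)) = (\<Sum>q\<in>quadruples \<pi>. ?f (h q))"
    by (rule sum.cong)
       (auto simp: h_def h_series_def double_series_double square_series_double quad_weight_def of_rat_divide of_rat_mult of_rat_power)
  also have "\<dots> = (\<Sum>q\<in>h ` quadruples \<pi>. ?f q)"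
    by (rule sum.reindex_cong[OF inj refl, symmetric]) simp
  also have "\<dots> = (\<Sum>(a, b, c, d) | a + (b + (c + d)) = \<pi>. h_series e a * (h_series 1 b * (double_series c * square_series d)))"
  proof (rule sum.mono_neutral_left)
    show "h ` quadruples \<pi> \<subseteq> {(a, b, c, d). a + (b + (c + d)) = \<pi>}"
      by (auto simp: h_def quadruples_def union_ac)
    show "\<forall>q\<in>{(a, b, c, d). a + (b + (c + d)) = \<pi>} - h ` quadruples \<pi>. ?f q = 0"
    proof safe
      fix a b c d assume nin: "(a, b, c, d) \<notin> h ` quadruples (a + (b + (c + d)))"
      show "h_series e a * (h_series 1 b * (double_series c * square_series d)) = 0"
      proof (rule ccontr)
        assume "\<not> ?thesis"
        then have nz: "h_series e a \<noteq> 0" "h_series 1 b \<noteq> 0" "double_series c \<noteq> 0" "square_series d \<noteq> 0" by auto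
        from nz(1,2) have ab: "is_partition a" "is_partition b"
          by (auto simp: h_series_def is_partition_def z_part_eq_0_iff)
        from nz(3) obtain s where s: "c = double_parts s" 
          by (meson double_series_def double_parts_half)
        from nz(3) have s': "is_partition s" unfolding s double_series_double
          by (auto simp: is_partition_def z_part_eq_0_iff double_parts_def)
        have "{\<tau>. \<tau> + \<tau> = d} \<noteq> {}"
          using nz(4) unfolding square_series_def by (metis sum.empty)
        then obtain t where t: "d = t + t" by auto
        from nz(4) have t': "is_partition t" unfolding t square_series_double
          by (auto simp: is_partition_def z_part_eq_0_iff double_parts_def)
        have "(a, b, c, d) = h (b, a, s, t)" by (simp add: h_def s t)
        moreover have "(b, a, s, t) \<in> quadruples (a + (b + (c + d)))"
          using ab s' t' by (simp add: quadruples_def s t union_ac)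
        ultimately show False using nin by blast
      qed
    qed
  qed (rule finite_quads)
  also have "\<dots> = conv (h_series e) schur_series \<pi>" unfolding schur_series_def conv4 ..
  finally show ?thesis .
qed

lemma finite_quadruples: "finite (quadruples \<pi>)"
proof (rule finite_subset)
  show "quadruples \<pi> \<subseteq> {\<sigma>. \<sigma> \<subseteq># \<pi>} \<times> {\<sigma>. \<sigma> \<subseteq># \<pi>} \<times> (\<lambda>\<sigma>. image_mset (\<lambda>i. i div 2) \<sigma>) ` {\<sigma>. \<sigma> \<subseteq># \<pi>} \<times> {\<sigma>. \<sigma> \<subseteq># \<pi>}"
  proof (rule subsetI, clarsimp simp only: split_paired_all mem_Times_iff fst_conv snd_conv)
    fix a b c d assume q: "(a, b, c, d) \<in> quadruples \<pi>"
    have "image_mset (\<lambda>i. i div 2) (double_parts c) = c" by (simp add: double_parts_def multiset.map_comp o_def)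
    moreover have "double_parts c \<subseteq># \<pi>" "a \<subseteq># \<pi>" "b \<subseteq># \<pi>" "d \<subseteq># \<pi>"
      using q by (auto simp: quadruples_def subset_mset.add_increasing subset_mset.add_increasing2)
    ultimately show "a \<in> {\<sigma>. \<sigma> \<subseteq># \<pi>} \<and> b \<in> {\<sigma>. \<sigma> \<subseteq># \<pi>} \<and> c \<in> image_mset (\<lambda>i. i div 2) ` {\<sigma>. \<sigma> \<subseteq># \<pi>} \<and> d \<in> {\<sigma>. \<sigma> \<subseteq># \<pi>}"
      by (auto intro!: image_eqI[of c _ "double_parts c"])
  qed
qed (simp add: finite_submultisets)

text \<open>The right side is the generating form of C for e = 1 and of D for e = -1, because e to
  the power |\<rho>_-| is then the sign attached to the parity class.\<close>

lemma even_odd_split: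
  assumes "e = 1 \<or> e = - 1"
  shows "real_of_rat (C_even \<pi>) + e * real_of_rat (C_odd \<pi>) = conv (h_series e) schur_series \<pi>"
proof -
  let ?E = "{q \<in> quadruples \<pi>. even (sum_mset (fst (snd q)))}"
  let ?O = "{q \<in> quadruples \<pi>. odd (sum_mset (fst (snd q)))}"
  have E: "{(\<rho>p, \<rho>m, \<tau>s, \<tau>p) \<in> quadruples \<pi>. even (sum_mset \<rho>m)} = ?E"
    and O: "{(\<rho>p, \<rho>m, \<tau>s, \<tau>p) \<in> quadruples \<pi>. odd (sum_mset \<rho>m)} = ?O" by auto
  have "conv (h_series e) schur_series \<pi> = (\<Sum>q\<in>?E \<union> ?O. e ^ sum_mset (fst (snd q)) * real_of_rat (quad_weight q))"
    unfolding quadruple_sum[symmetric] by (rule sum.cong) auto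
  also have "\<dots> = (\<Sum>q\<in>?E. e ^ sum_mset (fst (snd q)) * real_of_rat (quad_weight q))
     + (\<Sum>q\<in>?O. e ^ sum_mset (fst (snd q)) * real_of_rat (quad_weight q))"
    by (rule sum.union_disjoint) (auto simp: finite_quadruples)
  also have "(\<Sum>q\<in>?E. e ^ sum_mset (fst (snd q)) * real_of_rat (quad_weight q)) = (\<Sum>q\<in>?E. real_of_rat (quad_weight q))"
    by (rule sum.cong) (use assms in auto)
  also have "(\<Sum>q\<in>?O. e ^ sum_mset (fst (snd q)) * real_of_rat (quad_weight q)) = (\<Sum>q\<in>?O. e * real_of_rat (quad_weight q))"
    by (rule sum.cong) (use assms in auto)
  finally show ?thesis
    unfolding C_even_def C_odd_def E O by (simp add: of_rat_sum sum_distrib_left)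
qed

section \<open>Young diagrams and horizontal strips\<close>

definition diagrams :: "(nat \<Rightarrow> nat) set" where
  "diagrams = {l. antimono l \<and> finite {i. l i \<noteq> 0}}"

definition area :: "(nat \<Rightarrow> nat) \<Rightarrow> nat" where
  "area l = (\<Sum>i | l i \<noteq> 0. l i)"

text \<open>Interlacing of the rows, equivalent to the skew diagram \<xi>/\<mu> having at most one
  box in each column.\<close>

definition hstrip :: "(nat \<Rightarrow> nat) \<Rightarrow> (nat \<Rightarrow> nat) \<Rightarrow> bool" where
  "hstrip \<mu> \<xi> \<longleftrightarrow> (\<forall>i. \<mu> i \<le> \<xi> i \<and> \<xi> (Suc i) \<le> \<mu> i)"

definition strip :: "nat \<Rightarrow> (nat \<Rightarrow> nat) \<Rightarrow> (nat \<Rightarrow> nat) \<Rightarrow> bool" where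
  "strip k \<mu> \<xi> \<longleftrightarrow> \<mu> \<in> diagrams \<and> \<xi> \<in> diagrams \<and> hstrip \<mu> \<xi> \<and> area \<xi> = area \<mu> + k"

lemma area_eq: "(\<And>i. i \<ge> N \<Longrightarrow> l i = 0) \<Longrightarrow> area l = (\<Sum>i<N. l i)"
  unfolding area_def
  by (rule sum.mono_neutral_left) (auto intro: ccontr)

lemma diagrams_support: "l \<in> diagrams \<Longrightarrow> \<exists>N. \<forall>i\<ge>N. l i = 0"
proof -
  assume "l \<in> diagrams"
  then obtain m where "\<And>i. l i \<noteq> 0 \<Longrightarrow> i < m"
    unfolding diagrams_def finite_nat_set_iff_bounded by auto
  then show ?thesis by (meson not_le)
qed

lemma diagramsI: "antimono l \<Longrightarrow> (\<And>i. i \<ge> N \<Longrightarrow> l i = 0) \<Longrightarrow> l \<in> diagrams"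
proof -
  assume "antimono l" and N: "\<And>i. i \<ge> N \<Longrightarrow> l i = 0"
  moreover have "i < N" if "l i \<noteq> 0" for i using N[of i] that by (cases "i < N") auto
  ultimately show ?thesis unfolding diagrams_def finite_nat_set_iff_bounded by auto
qed

lemma hstrip_antimono: "hstrip \<mu> \<xi> \<Longrightarrow> antimono \<xi> \<and> antimono \<mu>"
  unfolding hstrip_def decseq_Suc_iff by (meson order_trans)

lemma hstrip_diagrams_upper:
  assumes "\<mu> \<in> diagrams" "hstrip \<mu> \<xi>" shows "\<xi> \<in> diagrams"
proof -
  obtain N where N: "\<And>i. i \<ge> N \<Longrightarrow> \<mu> i = 0" using diagrams_support[OF assms(1)] by auto
  show ?thesis
  proof (rule diagramsI[of _ "Suc N"])
    fix i assume "Suc N \<le> i"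
    then obtain j where "i = Suc j" "j \<ge> N" by (cases i) auto
    moreover have "\<xi> (Suc j) \<le> \<mu> j" using assms(2) by (simp add: hstrip_def)
    ultimately show "\<xi> i = 0" using N[of j] by simp
  qed (use hstrip_antimono assms in auto)
qed

lemma hstrip_diagrams_lower:
  assumes "\<xi> \<in> diagrams" "hstrip \<mu> \<xi>" shows "\<mu> \<in> diagrams"
proof -
  obtain N where N: "\<And>i. i \<ge> N \<Longrightarrow> \<xi> i = 0" using diagrams_support[OF assms(1)] by auto
  show ?thesis
  proof (rule diagramsI[of _ N])
    fix i assume "N \<le> i"
    moreover have "\<mu> i \<le> \<xi> i" using assms(2) by (simp add: hstrip_def)
    ultimately show "\<mu> i = 0" using N[of i] by simp
  qed (use hstrip_antimono assms in auto)
qed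

lemma area_mono:
  assumes "hstrip \<mu> \<xi>" "\<xi> \<in> diagrams" shows "area \<mu> \<le> area \<xi>"
proof -
  obtain N where N: "\<And>i. i \<ge> N \<Longrightarrow> \<xi> i = 0" using diagrams_support[OF assms(2)] by auto
  have le: "\<mu> i \<le> \<xi> i" for i using assms(1) by (auto simp: hstrip_def)
  have "\<mu> i = 0" if "i \<ge> N" for i using le[of i] N[OF that] by simp
  then have "area \<mu> = (\<Sum>i<N. \<mu> i)" by (rule area_eq)
  also have "\<dots> \<le> (\<Sum>i<N. \<xi> i)" by (rule sum_mono) (rule le)
  also have "\<dots> = area \<xi>" using area_eq[OF N] by simp
  finally show ?thesis .
qed

definition diagrams_of :: "nat \<Rightarrow> (nat \<Rightarrow> nat) set" where
  "diagrams_of n = {l \<in> diagrams. area l = n}"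

lemma diagrams_of_bounds:
  assumes "l \<in> diagrams_of n"
  shows "l i \<le> n" "i \<ge> n \<Longrightarrow> l i = 0"
proof -
  have l: "l \<in> diagrams" "area l = n" "antimono l" using assms by (auto simp: diagrams_of_def diagrams_def)
  obtain N where N: "\<And>i. i \<ge> N \<Longrightarrow> l i = 0" using diagrams_support[OF l(1)] by auto
  have n: "n = (\<Sum>i<N. l i)" using area_eq[OF N] l(2) by simp
  show "l i \<le> n"
  proof (cases "i < N")
    case True
    then show ?thesis unfolding n by (intro member_le_sum) auto
  qed (use N in auto)
  show "l i = 0" if "i \<ge> n"
  proof (rule ccontr)
    assume nz: "l i \<noteq> 0"
    then have "i < N" using N by (meson not_le)
    have "1 \<le> l j" if "j \<le> i" for j
      using nz antimonoD[OF l(3) that] by simp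
    then have "(\<Sum>j\<le>i. 1) \<le> (\<Sum>j\<le>i. l j)" by (intro sum_mono) auto
    also have "\<dots> \<le> (\<Sum>j<N. l j)" using \<open>i < N\<close> by (intro sum_mono2) auto
    finally show False using n that by simp
  qed
qed

lemma finite_diagrams_of [simp]: "finite (diagrams_of n)"
proof (rule finite_subset)
  show "diagrams_of n \<subseteq> {f. \<forall>i. (i \<in> {..<n} \<longrightarrow> f i \<in> {..n}) \<and> (i \<notin> {..<n} \<longrightarrow> f i = 0)}"
    using diagrams_of_bounds by auto
qed (rule finite_set_of_finite_funs; simp)

lemma finite_strip_upper [simp]: "finite {\<xi>. strip k \<mu> \<xi>}"
  by (rule finite_subset[of _ "diagrams_of (area \<mu> + k)", OF _ finite_diagrams_of]) (auto simp: strip_def diagrams_of_def)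

lemma finite_strip_lower [simp]: "finite {\<mu>. strip k \<mu> \<xi>}"
  by (rule finite_subset[of _ "diagrams_of (area \<xi> - k)", OF _ finite_diagrams_of]) (auto simp: strip_def diagrams_of_def)

text \<open>On coefficients of Schur functions, Pieri's rule makes \<open>strip_up k\<close>
  multiplication by h_k and \<open>strip_down k\<close> its adjoint. The names describe how the
  diagrams move, so the value of \<open>strip_down\<close> at \<mu> gathers larger diagrams
  \<xi>.\<close>

definition strip_down :: "nat \<Rightarrow> weight \<Rightarrow> weight" where
  "strip_down k a \<mu> = (\<Sum>\<xi> | strip k \<mu> \<xi>. a \<xi>)"

definition strip_up :: "nat \<Rightarrow> weight \<Rightarrow> weight" where
  "strip_up k a \<xi> = (\<Sum>\<mu> | strip k \<mu> \<xi>. a \<mu>)"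

text \<open>The local rule behind Pieri's commutation relation: the diagrams above both mu and kappa are
  matched with the diagrams below both, by reflecting row i + 1 in the interval
  [max(mu(i+1), kappa(i+1)), min(mu(i), kappa(i))]; the free part of row 0 is recorded separately.\<close>

definition lower_partner :: "(nat \<Rightarrow> nat) \<Rightarrow> (nat \<Rightarrow> nat) \<Rightarrow> (nat \<Rightarrow> nat) \<Rightarrow> nat \<Rightarrow> nat" where
  "lower_partner \<mu> \<kappa> \<xi> = (\<lambda>i. min (\<mu> i) (\<kappa> i) + max (\<mu> (Suc i)) (\<kappa> (Suc i)) - \<xi> (Suc i))"

definition upper_partner :: "(nat \<Rightarrow> nat) \<Rightarrow> (nat \<Rightarrow> nat) \<Rightarrow> nat \<Rightarrow> (nat \<Rightarrow> nat) \<Rightarrow> nat \<Rightarrow> nat" where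
  "upper_partner \<mu> \<kappa> j \<nu> = (\<lambda>i. case i of 0 \<Rightarrow> max (\<mu> 0) (\<kappa> 0) + j
     | Suc i \<Rightarrow> min (\<mu> i) (\<kappa> i) + max (\<mu> (Suc i)) (\<kappa> (Suc i)) - \<nu> i)"

definition excess :: "(nat \<Rightarrow> nat) \<Rightarrow> (nat \<Rightarrow> nat) \<Rightarrow> (nat \<Rightarrow> nat) \<Rightarrow> nat" where
  "excess \<mu> \<kappa> \<xi> = \<xi> 0 - max (\<mu> 0) (\<kappa> 0)"

text \<open>Row i + 1 of a diagram above \<mu> and \<kappa> ranges over the same interval as row i
  of a diagram below both (\<open>hs2_lower\<close>), and the rows are independent. Only row 0 above
  is unbounded.\<close>

lemma hs2_upper: "hstrip \<mu> \<xi> \<and> hstrip \<kappa> \<xi> \<longleftrightarrow>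
   max (\<mu> 0) (\<kappa> 0) \<le> \<xi> 0 \<and>
   (\<forall>i. max (\<mu> (Suc i)) (\<kappa> (Suc i)) \<le> \<xi> (Suc i) \<and> \<xi> (Suc i) \<le> min (\<mu> i) (\<kappa> i))"
proof
  assume a: "max (\<mu> 0) (\<kappa> 0) \<le> \<xi> 0 \<and>
   (\<forall>i. max (\<mu> (Suc i)) (\<kappa> (Suc i)) \<le> \<xi> (Suc i) \<and> \<xi> (Suc i) \<le> min (\<mu> i) (\<kappa> i))"
  have "\<mu> i \<le> \<xi> i \<and> \<kappa> i \<le> \<xi> i" for i using a by (cases i) auto
  then show "hstrip \<mu> \<xi> \<and> hstrip \<kappa> \<xi>" using a by (auto simp: hstrip_def)
qed (auto simp: hstrip_def)

lemma hs2_lower: "hstrip \<nu> \<mu> \<and> hstrip \<nu> \<kappa> \<longleftrightarrow>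
   (\<forall>i. max (\<mu> (Suc i)) (\<kappa> (Suc i)) \<le> \<nu> i \<and> \<nu> i \<le> min (\<mu> i) (\<kappa> i))"
  unfolding hstrip_def by auto

lemma partner_down:
  assumes "hstrip \<mu> \<xi>" "hstrip \<kappa> \<xi>"
  shows "hstrip (lower_partner \<mu> \<kappa> \<xi>) \<mu>" "hstrip (lower_partner \<mu> \<kappa> \<xi>) \<kappa>"
    and "upper_partner \<mu> \<kappa> (excess \<mu> \<kappa> \<xi>) (lower_partner \<mu> \<kappa> \<xi>) = \<xi>"
proof -
  have *: "max (\<mu> 0) (\<kappa> 0) \<le> \<xi> 0"
   "max (\<mu> (Suc i)) (\<kappa> (Suc i)) \<le> \<xi> (Suc i)" "\<xi> (Suc i) \<le> min (\<mu> i) (\<kappa> i)" for i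
    using assms hs2_upper[of \<mu> \<xi> \<kappa>] by blast+
  have "hstrip (lower_partner \<mu> \<kappa> \<xi>) \<mu> \<and> hstrip (lower_partner \<mu> \<kappa> \<xi>) \<kappa>"
    unfolding hs2_lower lower_partner_def
  proof (intro allI conjI)
    fix i
    show "max (\<mu> (Suc i)) (\<kappa> (Suc i)) \<le> min (\<mu> i) (\<kappa> i) + max (\<mu> (Suc i)) (\<kappa> (Suc i)) - \<xi> (Suc i)"
      using *(2)[of i] *(3)[of i] by linarith
    show "min (\<mu> i) (\<kappa> i) + max (\<mu> (Suc i)) (\<kappa> (Suc i)) - \<xi> (Suc i) \<le> min (\<mu> i) (\<kappa> i)"
      using *(2)[of i] *(3)[of i] by linarith
  qed
  then show "hstrip (lower_partner \<mu> \<kappa> \<xi>) \<mu>" "hstrip (lower_partner \<mu> \<kappa> \<xi>) \<kappa>" by auto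
  show "upper_partner \<mu> \<kappa> (excess \<mu> \<kappa> \<xi>) (lower_partner \<mu> \<kappa> \<xi>) = \<xi>"
  proof
    fix i
    show "upper_partner \<mu> \<kappa> (excess \<mu> \<kappa> \<xi>) (lower_partner \<mu> \<kappa> \<xi>) i = \<xi> i"
    proof (cases i)
      case 0
      then show ?thesis using *(1) by (simp add: upper_partner_def excess_def)
    next
      case (Suc j)
      have "\<xi> (Suc j) \<le> min (\<mu> j) (\<kappa> j) + max (\<mu> (Suc j)) (\<kappa> (Suc j))" using *(3)[of j] by linarith
      then show ?thesis unfolding Suc upper_partner_def lower_partner_def nat.case by (rule diff_diff_cancel)
    qed
  qed
qed

lemma partner_up:
  assumes "hstrip \<nu> \<mu>" "hstrip \<nu> \<kappa>"
  shows "hstrip \<mu> (upper_partner \<mu> \<kappa> j \<nu>)" "hstrip \<kappa> (upper_partner \<mu> \<kappa> j \<nu>)"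
    and "excess \<mu> \<kappa> (upper_partner \<mu> \<kappa> j \<nu>) = j" 
    and "lower_partner \<mu> \<kappa> (upper_partner \<mu> \<kappa> j \<nu>) = \<nu>"
proof -
  have *: "max (\<mu> (Suc i)) (\<kappa> (Suc i)) \<le> \<nu> i" "\<nu> i \<le> min (\<mu> i) (\<kappa> i)" for i
    using assms hs2_lower[of \<nu> \<mu> \<kappa>] by blast+
  have "hstrip \<mu> (upper_partner \<mu> \<kappa> j \<nu>) \<and> hstrip \<kappa> (upper_partner \<mu> \<kappa> j \<nu>)"
    unfolding hs2_upper upper_partner_def nat.case
  proof (intro allI conjI)
    fix i
    show "max (\<mu> (Suc i)) (\<kappa> (Suc i)) \<le> min (\<mu> i) (\<kappa> i) + max (\<mu> (Suc i)) (\<kappa> (Suc i)) - \<nu> i"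
      using *[of i] by linarith
    show "min (\<mu> i) (\<kappa> i) + max (\<mu> (Suc i)) (\<kappa> (Suc i)) - \<nu> i \<le> min (\<mu> i) (\<kappa> i)"
      using *[of i] by linarith
  qed simp
  then show "hstrip \<mu> (upper_partner \<mu> \<kappa> j \<nu>)" "hstrip \<kappa> (upper_partner \<mu> \<kappa> j \<nu>)" by auto
  show "excess \<mu> \<kappa> (upper_partner \<mu> \<kappa> j \<nu>) = j"
    by (simp add: excess_def upper_partner_def)
  show "lower_partner \<mu> \<kappa> (upper_partner \<mu> \<kappa> j \<nu>) = \<nu>"
  proof
    fix i
    show "lower_partner \<mu> \<kappa> (upper_partner \<mu> \<kappa> j \<nu>) i = \<nu> i"
    proof -
      have "\<nu> i \<le> min (\<mu> i) (\<kappa> i) + max (\<mu> (Suc i)) (\<kappa> (Suc i))" using *(2)[of i] by linarith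
      then show ?thesis unfolding upper_partner_def lower_partner_def nat.case by (rule diff_diff_cancel)
    qed
  qed
qed

text \<open>Row i + 1 of \<xi> and row i of its partner add up to the minimum at i plus the maximum
  at i + 1. Summed over i this gives both areas except for the maximum at row 0, which is \<xi> 0
  without the excess.\<close>

lemma partner_size:
  assumes "hstrip \<mu> \<xi>" "hstrip \<kappa> \<xi>" "\<mu> \<in> diagrams" "\<kappa> \<in> diagrams"
  shows "area \<xi> + area (lower_partner \<mu> \<kappa> \<xi>) = excess \<mu> \<kappa> \<xi> + area \<mu> + area \<kappa>"
proof -
  let ?\<nu> = "lower_partner \<mu> \<kappa> \<xi>"
  obtain N1 N2 where "\<And>i. i \<ge> N1 \<Longrightarrow> \<mu> i = 0" "\<And>i. i \<ge> N2 \<Longrightarrow> \<kappa> i = 0"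
    using diagrams_support[OF assms(3)] diagrams_support[OF assms(4)] by auto
  define N where "N = max N1 N2"
  have N: "\<And>i. i \<ge> N \<Longrightarrow> \<mu> i = 0" "\<And>i. i \<ge> N \<Longrightarrow> \<kappa> i = 0"
    unfolding N_def using \<open>\<And>i. i \<ge> N1 \<Longrightarrow> \<mu> i = 0\<close> \<open>\<And>i. i \<ge> N2 \<Longrightarrow> \<kappa> i = 0\<close> by auto
  have *: "max (\<mu> 0) (\<kappa> 0) \<le> \<xi> 0"
   "max (\<mu> (Suc i)) (\<kappa> (Suc i)) \<le> \<xi> (Suc i)" "\<xi> (Suc i) \<le> min (\<mu> i) (\<kappa> i)" for i
    using assms hs2_upper[of \<mu> \<xi> \<kappa>] by blast+
  have l: "\<xi> i = 0" if "i \<ge> Suc N" for i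
    using that *(3)[of "i - 1"] N(1)[of "i - 1"] by (cases i) auto
  have n: "?\<nu> i = 0" if "i \<ge> N" for i
    using that N(1)[of i] N(2)[of i] N(1)[of "Suc i"] N(2)[of "Suc i"] by (simp add: lower_partner_def)
  have "area \<xi> = \<xi> 0 + (\<Sum>i<N. \<xi> (Suc i))" using area_eq[OF l] by (simp only: sum.lessThan_Suc_shift)
  then have "area \<xi> + area ?\<nu> = \<xi> 0 + (\<Sum>i<N. \<xi> (Suc i) + ?\<nu> i)"
    using area_eq[OF n] by (simp add: sum.distrib)
  also have "(\<Sum>i<N. \<xi> (Suc i) + ?\<nu> i) = (\<Sum>i<N. min (\<mu> i) (\<kappa> i) + max (\<mu> (Suc i)) (\<kappa> (Suc i)))"
    by (rule sum.cong) (use *(3) in \<open>auto simp: lower_partner_def trans_le_add1\<close>)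
  also have "\<dots> = (\<Sum>i<N. min (\<mu> i) (\<kappa> i)) + (\<Sum>i<N. max (\<mu> (Suc i)) (\<kappa> (Suc i)))"
    by (rule sum.distrib)
  finally have 1: "area \<xi> + area ?\<nu> = \<xi> 0 + (\<Sum>i<N. min (\<mu> i) (\<kappa> i)) + (\<Sum>i<N. max (\<mu> (Suc i)) (\<kappa> (Suc i)))"
    by simp
  have 2: "max (\<mu> 0) (\<kappa> 0) + (\<Sum>i<N. max (\<mu> (Suc i)) (\<kappa> (Suc i))) = (\<Sum>i<N. max (\<mu> i) (\<kappa> i))"
    using sum.lessThan_Suc_shift[of "\<lambda>i. max (\<mu> i) (\<kappa> i)" N] N(1)[of N] N(2)[of N] by simp
  have 3: "(\<Sum>i<N. min (\<mu> i) (\<kappa> i)) + (\<Sum>i<N. max (\<mu> i) (\<kappa> i)) = area \<mu> + area \<kappa>"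
  proof -
    have "area \<mu> + area \<kappa> = (\<Sum>i<N. \<mu> i + \<kappa> i)" using area_eq[OF N(1)] area_eq[OF N(2)] by (simp add: sum.distrib)
    also have "\<dots> = (\<Sum>i<N. min (\<mu> i) (\<kappa> i) + max (\<mu> i) (\<kappa> i))" by (rule sum.cong) auto
    finally show ?thesis by (simp add: sum.distrib)
  qed
  from 1 2 3 *(1) show ?thesis unfolding excess_def by linarith
qed

definition strip_up_minus :: "nat \<Rightarrow> nat \<Rightarrow> weight \<Rightarrow> weight" where
  "strip_up_minus m i a = (if i \<le> m then strip_up (m - i) a else 0)"

text \<open>The counterpart of \<open>h_skew_h_mult\<close> for weights. A diagram \<xi> above \<mu>
  and \<kappa> corresponds to a pair of its excess i and a diagram \<nu> below both;
  \<open>partner_size\<close> turns the strip sizes k and m above into k - i and m - i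
  below.\<close>

lemma strip_down_strip_up: "strip_down k (strip_up m a) = (\<Sum>i\<le>k. strip_up_minus m i (strip_down (k - i) a))"
proof
  fix \<mu>
  have "strip_down k (strip_up m a) \<mu> = (\<Sum>(\<xi>, \<kappa>)\<in>Sigma {\<xi>. strip k \<mu> \<xi>} (\<lambda>\<xi>. {\<kappa>. strip m \<kappa> \<xi>}). a \<kappa>)"
    unfolding strip_down_def strip_up_def by (subst sum.Sigma) auto
  also have "\<dots> = (\<Sum>(i, \<nu>, \<kappa>)\<in>Sigma {i. i \<le> k \<and> i \<le> m} (\<lambda>i. Sigma {\<nu>. strip (m - i) \<nu> \<mu>} (\<lambda>\<nu>. {\<kappa>. strip (k - i) \<nu> \<kappa>})). a \<kappa>)"
  proof (rule sum.reindex_bij_witness[of _ "\<lambda>(i, \<nu>, \<kappa>). (upper_partner \<mu> \<kappa> i \<nu>, \<kappa>)"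
        "\<lambda>(\<xi>, \<kappa>). (excess \<mu> \<kappa> \<xi>, lower_partner \<mu> \<kappa> \<xi>, \<kappa>)"])
    fix x assume x: "x \<in> Sigma {\<xi>. strip k \<mu> \<xi>} (\<lambda>\<xi>. {\<kappa>. strip m \<kappa> \<xi>})"
    then obtain \<xi> \<kappa> where x_eq: "x = (\<xi>, \<kappa>)" and s: "strip k \<mu> \<xi>" "strip m \<kappa> \<xi>" by auto
    then have s': "hstrip \<mu> \<xi>" "hstrip \<kappa> \<xi>" "\<mu> \<in> diagrams" "\<kappa> \<in> diagrams" "area \<xi> = area \<mu> + k" "area \<xi> = area \<kappa> + m"
      by (auto simp: strip_def)
    note p = partner_down[OF s'(1,2)] partner_size[OF s'(1-4)]
    show "(case case x of (\<xi>, \<kappa>) \<Rightarrow> (excess \<mu> \<kappa> \<xi>, lower_partner \<mu> \<kappa> \<xi>, \<kappa>) of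
       (i, \<nu>, \<kappa>) \<Rightarrow> (upper_partner \<mu> \<kappa> i \<nu>, \<kappa>)) = x"
      using p by (simp add: x_eq)
    have "area (lower_partner \<mu> \<kappa> \<xi>) \<le> area \<mu>" "area (lower_partner \<mu> \<kappa> \<xi>) \<le> area \<kappa>"
      using p area_mono s' by blast+
    moreover have "lower_partner \<mu> \<kappa> \<xi> \<in> diagrams" using p s' hstrip_diagrams_lower by blast
    moreover have "excess \<mu> \<kappa> \<xi> \<le> k" "excess \<mu> \<kappa> \<xi> \<le> m"
      using p(4) s'(5,6) \<open>area (lower_partner \<mu> \<kappa> \<xi>) \<le> area \<mu>\<close> \<open>area (lower_partner \<mu> \<kappa> \<xi>) \<le> area \<kappa>\<close> by linarith+
    moreover have "area \<mu> = area (lower_partner \<mu> \<kappa> \<xi>) + (m - excess \<mu> \<kappa> \<xi>)"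
       "area \<kappa> = area (lower_partner \<mu> \<kappa> \<xi>) + (k - excess \<mu> \<kappa> \<xi>)"
      using p(4) s'(5,6) calculation by linarith+
    ultimately show "(case x of (\<xi>, \<kappa>) \<Rightarrow> (excess \<mu> \<kappa> \<xi>, lower_partner \<mu> \<kappa> \<xi>, \<kappa>))
       \<in> Sigma {i. i \<le> k \<and> i \<le> m} (\<lambda>i. Sigma {\<nu>. strip (m - i) \<nu> \<mu>} (\<lambda>\<nu>. {\<kappa>. strip (k - i) \<nu> \<kappa>}))"
      using p(1,2) s'(3,4) by (simp add: x_eq strip_def)
    show "(case case x of (\<xi>, \<kappa>) \<Rightarrow> (excess \<mu> \<kappa> \<xi>, lower_partner \<mu> \<kappa> \<xi>, \<kappa>) of
      (i, \<nu>, \<kappa>) \<Rightarrow> a \<kappa>) = (case x of (\<xi>, \<kappa>) \<Rightarrow> a \<kappa>)" by (simp add: x_eq)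
  next
    fix y assume y: "y \<in> Sigma {i. i \<le> k \<and> i \<le> m} (\<lambda>i. Sigma {\<nu>. strip (m - i) \<nu> \<mu>} (\<lambda>\<nu>. {\<kappa>. strip (k - i) \<nu> \<kappa>}))"
    then obtain i \<nu> \<kappa> where y_eq: "y = (i, \<nu>, \<kappa>)" and s: "i \<le> k" "i \<le> m" "strip (m - i) \<nu> \<mu>" "strip (k - i) \<nu> \<kappa>" by auto
    then have s': "hstrip \<nu> \<mu>" "hstrip \<nu> \<kappa>" "\<mu> \<in> diagrams" "\<kappa> \<in> diagrams" "area \<mu> = area \<nu> + (m - i)" "area \<kappa> = area \<nu> + (k - i)"
      by (auto simp: strip_def)
    note p = partner_up[OF s'(1,2), of i]
    note q = partner_size[OF p(1,2) s'(3,4), unfolded p(3,4)]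
    show "(case case y of (i, \<nu>, \<kappa>) \<Rightarrow> (upper_partner \<mu> \<kappa> i \<nu>, \<kappa>) of
       (\<xi>, \<kappa>) \<Rightarrow> (excess \<mu> \<kappa> \<xi>, lower_partner \<mu> \<kappa> \<xi>, \<kappa>)) = y"
      using p by (simp add: y_eq)
    show "(case y of (i, \<nu>, \<kappa>) \<Rightarrow> (upper_partner \<mu> \<kappa> i \<nu>, \<kappa>)) \<in> Sigma {\<xi>. strip k \<mu> \<xi>} (\<lambda>\<xi>. {\<kappa>. strip m \<kappa> \<xi>})"
    proof -
      have "area (upper_partner \<mu> \<kappa> i \<nu>) = area \<mu> + k" "area (upper_partner \<mu> \<kappa> i \<nu>) = area \<kappa> + m"
        using q s'(5,6) s(1,2) by linarith+
      then show ?thesis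
        using p(1,2) s'(3,4) hstrip_diagrams_upper[OF s'(3) p(1)] by (simp add: y_eq strip_def)
    qed
  qed
  also have "\<dots> = (\<Sum>i | i \<le> k \<and> i \<le> m. strip_up (m - i) (strip_down (k - i) a) \<mu>)"
    unfolding strip_down_def strip_up_def
    by (subst sum.Sigma[symmetric]) (auto intro!: sum.cong finite_SigmaI simp: sum.Sigma)
  also have "\<dots> = (\<Sum>i\<le>k. strip_up_minus m i (strip_down (k - i) a) \<mu>)"
    by (rule sum.mono_neutral_cong_left) (auto simp: strip_up_minus_def)
  finally show "strip_down k (strip_up m a) \<mu> = (\<Sum>i\<le>k. strip_up_minus m i (strip_down (k - i) a)) \<mu>"
    by (simp only: sum_fun_apply)
qed

text \<open>The counterpart of \<open>h_skew_T\<close>, from the same bijection with \<kappa> =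
  \<mu>: a strip of size k above \<mu> with excess k - i becomes a strip of size i below
  \<mu>.\<close>

lemma strip_down_one: "strip_down k (\<lambda>_. 1) = (\<Sum>i\<le>k. strip_up i (\<lambda>_. 1))"
proof
  fix \<mu>
  have "strip_down k (\<lambda>_. 1) \<mu> = (\<Sum>\<xi>\<in>{\<xi>. strip k \<mu> \<xi>}. 1)" by (simp add: strip_down_def)
  also have "\<dots> = (\<Sum>(i, \<nu>)\<in>Sigma {..k} (\<lambda>i. {\<nu>. strip i \<nu> \<mu>}). 1)"
  proof (rule sum.reindex_bij_witness[of _ "\<lambda>(i, \<nu>). upper_partner \<mu> \<mu> (k - i) \<nu>"
        "\<lambda>\<xi>. (k - excess \<mu> \<mu> \<xi>, lower_partner \<mu> \<mu> \<xi>)"])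
    fix \<xi> assume "\<xi> \<in> {\<xi>. strip k \<mu> \<xi>}"
    then have s': "hstrip \<mu> \<xi>" "\<mu> \<in> diagrams" "area \<xi> = area \<mu> + k" by (auto simp: strip_def)
    note p = partner_down[OF s'(1,1)] partner_size[OF s'(1,1,2,2)]
    have "area (lower_partner \<mu> \<mu> \<xi>) \<le> area \<mu>" using p area_mono s' by blast
    moreover have "lower_partner \<mu> \<mu> \<xi> \<in> diagrams" using p s' hstrip_diagrams_lower by blast
    ultimately show "(k - excess \<mu> \<mu> \<xi>, lower_partner \<mu> \<mu> \<xi>) \<in> Sigma {..k} (\<lambda>i. {\<nu>. strip i \<nu> \<mu>})"
      and "(case (k - excess \<mu> \<mu> \<xi>, lower_partner \<mu> \<mu> \<xi>) of (i, \<nu>) \<Rightarrow> upper_partner \<mu> \<mu> (k - i) \<nu>) = \<xi>"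
      using p s' by (auto simp: strip_def)
  next
    fix y assume y: "y \<in> Sigma {..k} (\<lambda>i. {\<nu>. strip i \<nu> \<mu>})"
    then obtain i \<nu> where y_eq: "y = (i, \<nu>)" and s: "i \<le> k" "strip i \<nu> \<mu>" by auto
    then have s': "hstrip \<nu> \<mu>" "\<mu> \<in> diagrams" "area \<mu> = area \<nu> + i" by (auto simp: strip_def)
    note p = partner_up[OF s'(1,1), of "k - i"]
    note q = partner_size[OF p(1,1) s'(2,2), unfolded p(3,4)]
    show "(k - excess \<mu> \<mu> (case y of (i, \<nu>) \<Rightarrow> upper_partner \<mu> \<mu> (k - i) \<nu>),
       lower_partner \<mu> \<mu> (case y of (i, \<nu>) \<Rightarrow> upper_partner \<mu> \<mu> (k - i) \<nu>)) = y"
      using p s by (simp add: y_eq)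
    show "(case y of (i, \<nu>) \<Rightarrow> upper_partner \<mu> \<mu> (k - i) \<nu>) \<in> {\<xi>. strip k \<mu> \<xi>}"
      using p q s s' hstrip_diagrams_upper[OF s'(2) p(1)] by (simp add: y_eq strip_def)
  qed auto
  also have "\<dots> = (\<Sum>i\<le>k. strip_up i (\<lambda>_. 1) \<mu>)"
    unfolding strip_up_def by (subst sum.Sigma[symmetric]) auto
  finally show "strip_down k (\<lambda>_. 1) \<mu> = (\<Sum>i\<le>k. strip_up i (\<lambda>_. 1)) \<mu>" by (simp only: sum_fun_apply)
qed

definition empty_indicator :: "(nat \<Rightarrow> nat) \<Rightarrow> real" where
  "empty_indicator l = (if l = (\<lambda>_. 0) then 1 else 0)"

lemma zero_diagrams [simp]: "(\<lambda>_. 0) \<in> diagrams" by (simp add: diagrams_def)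

lemma area_zero [simp]: "area (\<lambda>_. 0) = 0" by (simp add: area_def)

lemma strip_zero: "strip k \<mu> (\<lambda>_. 0) \<longleftrightarrow> k = 0 \<and> \<mu> = (\<lambda>_. 0)"
proof
  assume "strip k \<mu> (\<lambda>_. 0)"
  moreover from this have "\<mu> = (\<lambda>_. 0)" by (auto simp: strip_def hstrip_def)
  ultimately show "k = 0 \<and> \<mu> = (\<lambda>_. 0)" by (simp add: strip_def)
qed (simp add: strip_def hstrip_def)

lemma strip_down_empty_indicator: "strip_down k empty_indicator = (if k = 0 then empty_indicator else 0)"
proof
  fix \<mu>
  have "strip_down k empty_indicator \<mu> = (\<Sum>\<xi>\<in>{\<xi>. strip k \<mu> \<xi>} \<inter> {\<lambda>_. 0}. 1)"
    unfolding strip_down_def by (rule sum.mono_neutral_cong_right) (auto simp: empty_indicator_def)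
  also have "{\<xi>. strip k \<mu> \<xi>} \<inter> {\<lambda>_. 0} = (if k = 0 \<and> \<mu> = (\<lambda>_. 0) then {\<lambda>_. 0} else {})"
    by (auto simp: strip_zero)
  finally have "strip_down k empty_indicator \<mu> = (if k = 0 \<and> \<mu> = (\<lambda>_. 0) then 1 else 0)" by auto
  moreover have "(if k = 0 then empty_indicator else 0) \<mu> = (if k = 0 \<and> \<mu> = (\<lambda>_. 0) then 1 else 0)"
    by (auto simp: empty_indicator_def)
  ultimately show "strip_down k empty_indicator \<mu> = (if k = 0 then empty_indicator else 0) \<mu>" by simp
qed

lemma strip_down_add: "strip_down k (a + b) = strip_down k a + strip_down k b"
  by (rule ext) (simp add: strip_down_def sum.distrib)

lemma strip_down_zero: "strip_down k 0 = 0"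
  by (rule ext) (simp add: strip_down_def)

lemma strip_up_at_empty: "strip_up k a (\<lambda>_. 0) = (if k = 0 then a (\<lambda>_. 0) else 0)"
  unfolding strip_up_def strip_zero by auto

section \<open>The pairing of weights, tail sums and Kostka numbers\<close>

definition diagram_inner :: "nat \<Rightarrow> weight \<Rightarrow> weight \<Rightarrow> real" where
  "diagram_inner n a b = (\<Sum>\<xi>\<in>diagrams_of n. a \<xi> * b \<xi>)"

lemma diagram_inner_strip_up: "diagram_inner (n + k) (strip_up k a) b = diagram_inner n a (strip_down k b)"
proof -
  have "diagram_inner (n + k) (strip_up k a) b = (\<Sum>(\<xi>, \<mu>)\<in>Sigma (diagrams_of (n + k)) (\<lambda>\<xi>. {\<mu>. strip k \<mu> \<xi>}). a \<mu> * b \<xi>)"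
    unfolding diagram_inner_def strip_up_def sum_distrib_right by (subst sum.Sigma) auto
  also have "\<dots> = (\<Sum>(\<mu>, \<xi>)\<in>Sigma (diagrams_of n) (\<lambda>\<mu>. {\<xi>. strip k \<mu> \<xi>}). a \<mu> * b \<xi>)"
    by (rule sum.reindex_bij_witness[of _ prod.swap prod.swap]) (auto simp: diagrams_of_def strip_def)
  also have "\<dots> = diagram_inner n a (strip_down k b)"
    unfolding diagram_inner_def strip_down_def sum_distrib_left by (subst sum.Sigma) auto
  finally show ?thesis .
qed

lemma diagram_inner_0: "diagram_inner 0 a b = a (\<lambda>_. 0) * b (\<lambda>_. 0)"
proof -
  have "diagrams_of 0 = {\<lambda>_. 0}"
    using diagrams_of_bounds(2)[of _ 0] by (auto simp: diagrams_of_def)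
  then show ?thesis by (simp add: diagram_inner_def)
qed

text \<open>Dominance order read from the bottom: among diagrams of equal area, the dominating one
  has the smaller tails.\<close>

definition tail_area :: "nat \<Rightarrow> (nat \<Rightarrow> nat) \<Rightarrow> nat" where
  "tail_area j l = area (\<lambda>i. l (i + j))"

lemma shift_diagrams: "l \<in> diagrams \<Longrightarrow> (\<lambda>i. l (i + j)) \<in> diagrams"
proof -
  assume l: "l \<in> diagrams"
  obtain N where N: "\<And>i. i \<ge> N \<Longrightarrow> l i = 0" using diagrams_support[OF l] by auto
  show ?thesis using l by (intro diagramsI[of _ N]) (auto simp: N diagrams_def antimono_def)
qed

lemma tail_area_eq:
  assumes "\<And>i. i \<ge> N \<Longrightarrow> l i = 0"
  shows "tail_area j l = (\<Sum>i\<in>{j..<N}. l i)"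
proof (cases "j \<le> N")
  case True
  have "tail_area j l = (\<Sum>i<N - j. l (i + j))"
    unfolding tail_area_def by (rule area_eq) (use assms in auto)
  also have "\<dots> = (\<Sum>i\<in>{j..<N}. l i)"
    using True by (intro sum.reindex_bij_witness[of _ "\<lambda>i. i - j" "\<lambda>i. i + j"]) auto
  finally show ?thesis .
next
  case False
  then have "(\<lambda>i. l (i + j)) = (\<lambda>_. 0)" using assms by (intro ext) auto
  then show ?thesis using False by (simp add: tail_area_def)
qed

lemma tail_area_Suc:
  assumes "l \<in> diagrams" shows "tail_area j l = l j + tail_area (Suc j) l"
proof -
  obtain N where N: "\<And>i. i \<ge> N \<Longrightarrow> l i = 0" using diagrams_support[OF assms] by auto
  show ?thesis
  proof (cases "j < N")
    case True
    have "tail_area j l = (\<Sum>i\<in>{j..<N}. l i)" "tail_area (Suc j) l = (\<Sum>i\<in>{Suc j..<N}. l i)"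
      by (rule tail_area_eq; use N in blast)+
    then show ?thesis using True by (simp add: sum.atLeast_Suc_lessThan)
  next
    case False
    have "tail_area j l = (\<Sum>i\<in>{j..<N}. l i)" "tail_area (Suc j) l = (\<Sum>i\<in>{Suc j..<N}. l i)"
      by (rule tail_area_eq; use N in blast)+
    then show ?thesis using False N by simp
  qed
qed

text \<open>The number of semistandard tableaux with content \<open>\<alpha>\<close>, as chains of
  horizontal strips growing from the empty diagram. The last entry of \<open>\<alpha>\<close> is the
  innermost strip.\<close>

definition kostka :: "nat list \<Rightarrow> (nat \<Rightarrow> nat) \<Rightarrow> real" where
  "kostka \<alpha> = foldr strip_up \<alpha> empty_indicator"

text \<open>Interlacing bounds row i + 1 of \<xi> by row i of \<mu>, so removing the outer strip
  turns tail j + 1 of \<xi> into at most tail j of \<mu>, while the head of the list is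
  dropped.\<close>

lemma kostka_nonzero:
  "kostka \<alpha> \<xi> \<noteq> 0 \<Longrightarrow> \<xi> \<in> diagrams \<and> area \<xi> = sum_list \<alpha> \<and> (\<forall>j. tail_area j \<xi> \<le> sum_list (drop j \<alpha>))"
proof (induction \<alpha> arbitrary: \<xi>)
  case Nil
  then have "\<xi> = (\<lambda>_. 0)" by (auto simp: kostka_def empty_indicator_def split: if_splits)
  then show ?case by (simp add: tail_area_def)
next
  case (Cons k \<alpha>)
  have "(\<Sum>\<mu> | strip k \<mu> \<xi>. kostka \<alpha> \<mu>) \<noteq> 0" using Cons.prems by (simp add: kostka_def strip_up_def)
  then obtain \<mu> where \<mu>: "strip k \<mu> \<xi>" "kostka \<alpha> \<mu> \<noteq> 0"
    by (metis (mono_tags, lifting) mem_Collect_eq sum.neutral)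
  note IH = Cons.IH[OF \<mu>(2)]
  have \<xi>: "\<xi> \<in> diagrams" "area \<xi> = area \<mu> + k" "hstrip \<mu> \<xi>" using \<mu> by (auto simp: strip_def)
  have "tail_area j \<xi> \<le> sum_list (drop j (k # \<alpha>))" for j
  proof (cases j)
    case 0
    then show ?thesis using IH \<xi> by (simp add: tail_area_def)
  next
    case (Suc i)
    obtain N where N: "\<And>i. i \<ge> N \<Longrightarrow> \<xi> i = 0" using diagrams_support[OF \<xi>(1)] by auto
    have N': "\<mu> i = 0" if "i \<ge> N" for i
      using N[OF that] \<xi>(3) by (auto simp: hstrip_def) (metis le_zero_eq)
    have "area (\<lambda>x. \<xi> (x + Suc i)) = (\<Sum>x<N. \<xi> (x + Suc i))" by (rule area_eq) (use N in auto)
    also have "\<dots> \<le> (\<Sum>x<N. \<mu> (x + i))" using \<xi>(3) by (intro sum_mono) (auto simp: hstrip_def)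
    also have "\<dots> = area (\<lambda>x. \<mu> (x + i))" by (rule area_eq[symmetric]) (use N' in auto)
    finally have "tail_area j \<xi> \<le> tail_area i \<mu>" unfolding tail_area_def Suc .
    then show ?thesis using IH Suc by (simp add: order_trans)
  qed
  then show ?case using IH \<xi> by auto
qed

text \<open>Only one strip of size \<open>l 0\<close> can be removed from l: what remains has rows
  at least those of l without its first row, and the same area, hence equals it.\<close>

lemma kostka_diag:
  "l \<in> diagrams \<Longrightarrow> (\<And>i. i \<ge> r \<Longrightarrow> l i = 0) \<Longrightarrow> kostka (map l [0..<r]) l = 1"
proof (induction r arbitrary: l)
  case 0
  then have "l = (\<lambda>_. 0)" by auto
  then show ?case by (simp add: kostka_def empty_indicator_def)
next
  case (Suc r)
  let ?m = "\<lambda>i. l (i + 1)"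
  have m: "?m \<in> diagrams" using shift_diagrams Suc.prems by blast
  have area: "area l = area ?m + l 0" using tail_area_Suc[OF Suc.prems(1), of 0] by (simp add: tail_area_def)
  have "\<mu> = ?m" if "strip (l 0) \<mu> l" for \<mu>
  proof
    fix i
    have s: "\<And>i. ?m i \<le> \<mu> i" "area \<mu> = area ?m" "\<mu> \<in> diagrams" using that area by (auto simp: strip_def hstrip_def)
    have mz: "\<mu> j = 0" if "j \<ge> Suc r" for j
    proof -
      have "\<mu> j \<le> l j" using \<open>strip (l 0) \<mu> l\<close> by (simp add: strip_def hstrip_def)
      then show ?thesis using Suc.prems(2)[OF that] by simp
    qed
    have "(\<Sum>i<Suc r. ?m i) = area ?m" by (rule area_eq[symmetric]) (use Suc.prems in auto)
    also have "\<dots> = (\<Sum>i<Suc r. \<mu> i)" unfolding s(2)[symmetric] by (rule area_eq) (use mz in auto)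
    finally have "\<not> (\<exists>i<Suc r. ?m i < \<mu> i)"
      using sum_strict_mono_ex1[of "{..<Suc r}" ?m \<mu>] s(1) by auto
    then show "\<mu> i = ?m i"
    proof (cases "i < Suc r")
      case True
      then show ?thesis using s(1)[of i] \<open>\<not> (\<exists>i<Suc r. ?m i < \<mu> i)\<close> by (meson le_antisym not_le)
    qed (use mz[of i] Suc.prems(2)[of "i + 1"] in auto)
  qed
  moreover have "strip (l 0) ?m l"
    using m area Suc.prems(1) by (auto simp: strip_def hstrip_def diagrams_def antimono_def)
  ultimately have *: "{\<mu>. strip (l 0) \<mu> l} = {?m}" by blast
  have "map l [0..<Suc r] = l 0 # map ?m [0..<r]"
    by (subst upt_conv_Cons) (simp_all add: map_Suc_upt[symmetric] del: upt_Suc)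
  then have "kostka (map l [0..<Suc r]) l = strip_up (l 0) (kostka (map ?m [0..<r])) l"
    by (simp add: kostka_def)
  also have "\<dots> = kostka (map ?m [0..<r]) ?m" unfolding strip_up_def * by simp
  also have "\<dots> = 1" using Suc.IH[of ?m] m Suc.prems(2) by simp
  finally show ?case .
qed

text \<open>A number that strictly decreases when passing to a properly dominating diagram; it
  serves as the induction measure in \<open>orthonormal_characterization\<close>.\<close>

definition tail_area_sum :: "nat \<Rightarrow> (nat \<Rightarrow> nat) \<Rightarrow> nat" where
  "tail_area_sum n l = (\<Sum>j<n. tail_area j l)"

lemma tail_area_beyond: "l \<in> diagrams_of n \<Longrightarrow> j \<ge> n \<Longrightarrow> tail_area j l = 0"
  using tail_area_eq[of n l j] diagrams_of_bounds(2)[of l n] by simp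

lemma tail_area_sum_less:
  assumes "l \<in> diagrams_of n" "l' \<in> diagrams_of n" "\<And>j. tail_area j l \<le> tail_area j l'" "l \<noteq> l'"
  shows "tail_area_sum n l < tail_area_sum n l'"
proof -
  have "\<exists>j. tail_area j l \<noteq> tail_area j l'"
  proof (rule ccontr)
    assume "\<not> ?thesis"
    then have "l j = l' j" for j
      using tail_area_Suc[of l j] tail_area_Suc[of l' j] assms(1,2) by (auto simp: diagrams_of_def)
    then show False using assms(4) by blast
  qed
  then obtain j where j: "tail_area j l < tail_area j l'" using assms(3) by (meson le_neq_implies_less)
  then have "j < n" using tail_area_beyond[OF assms(2)] by (metis not_le not_less_zero)
  then show ?thesis unfolding tail_area_sum_def
    using j assms(3) by (intro sum_strict_mono_ex1) auto
qed

lemma sum_list_drop_rows: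
  assumes "l \<in> diagrams_of n" shows "sum_list (drop j (map l [0..<n])) = tail_area j l"
  using tail_area_eq[of n l j] diagrams_of_bounds(2)[OF assms]
  by (simp add: drop_map sum_list_distinct_conv_sum_set)

text \<open>Removing a horizontal strip means choosing, independently for each row i, a number of
  boxes between 0 and the difference to the next row; so the generating function factors.\<close>

lemma sum_lower_strips:
  assumes l: "l \<in> diagrams_of n"
  shows "(\<Sum>m\<le>n. e ^ m * strip_up m (\<lambda>_. 1) l) = (\<Prod>i<n. \<Sum>t\<le>l i - l (Suc i). (e::real) ^ t)"
proof -
  have ly: "l \<in> diagrams" "area l = n" and anti: "\<And>i. l (Suc i) \<le> l i"
    using l by (auto simp: diagrams_of_def diagrams_def antimono_def)
  have "(\<Prod>i<n. \<Sum>t\<le>l i - l (Suc i). e ^ t)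
      = (\<Sum>g\<in>PiE {..<n} (\<lambda>i. {..l i - l (Suc i)}). \<Prod>i<n. e ^ g i)"
    by (rule prod_sum_PiE) auto
  also have "\<dots> = (\<Sum>(m, \<mu>)\<in>Sigma {..n} (\<lambda>m. {\<mu>. strip m \<mu> l}). e ^ m)"
  proof (rule sum.reindex_bij_witness[of _ "\<lambda>(m, \<mu>). restrict (\<lambda>i. l i - \<mu> i) {..<n}"
      "\<lambda>g. (\<Sum>i<n. g i, \<lambda>i. if i < n then l i - g i else 0)"])
    fix g assume g: "g \<in> PiE {..<n} (\<lambda>i. {..l i - l (Suc i)})"
    then have gi: "g i \<le> l i - l (Suc i)" if "i < n" for i using that by auto
    let ?\<mu> = "\<lambda>i. if i < n then l i - g i else 0"
    have gl: "g i \<le> l i" if "i < n" for i using gi[OF that] by simp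
    show "(case (\<Sum>i<n. g i, ?\<mu>) of (m, \<mu>) \<Rightarrow> restrict (\<lambda>i. l i - \<mu> i) {..<n}) = g"
      using g gl by (auto simp: restrict_def PiE_def extensional_def fun_eq_iff)
    have h: "hstrip ?\<mu> l"
      unfolding hstrip_def
    proof (intro allI conjI)
      fix i
      show "?\<mu> i \<le> l i" by simp
      show "l (Suc i) \<le> ?\<mu> i"
        using gi[of i] anti[of i] diagrams_of_bounds(2)[OF l, of "Suc i"] by auto
    qed
    have "area ?\<mu> = (\<Sum>i<n. l i - g i)" by (subst area_eq[of n]) auto
    also have "\<dots> + (\<Sum>i<n. g i) = (\<Sum>i<n. l i)"
      unfolding sum.distrib[symmetric] by (rule sum.cong) (use gl in auto)
    finally have "area l = area ?\<mu> + (\<Sum>i<n. g i)" using area_eq[of n l] diagrams_of_bounds(2)[OF l] by simp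
    then show "(\<Sum>i<n. g i, ?\<mu>) \<in> Sigma {..n} (\<lambda>m. {\<mu>. strip m \<mu> l})"
      using h ly hstrip_diagrams_lower[OF ly(1) h] by (auto simp: strip_def)
    show "(case (\<Sum>i<n. g i, ?\<mu>) of (m, \<mu>) \<Rightarrow> e ^ m) = (\<Prod>i<n. e ^ g i)"
      by (simp add: power_sum)
  next
    fix y assume "y \<in> Sigma {..n} (\<lambda>m. {\<mu>. strip m \<mu> l})"
    then obtain m \<mu> where y: "y = (m, \<mu>)" and s: "hstrip \<mu> l" "area l = area \<mu> + m" "\<mu> \<in> diagrams"
      by (auto simp: strip_def)
    have le: "\<mu> i \<le> l i" "l (Suc i) \<le> \<mu> i" for i using s by (auto simp: hstrip_def)
    have z: "\<mu> i = 0" if "i \<ge> n" for i using le(1)[of i] diagrams_of_bounds(2)[OF l that] by simp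
    have "area \<mu> + (\<Sum>i<n. l i - \<mu> i) = (\<Sum>i<n. \<mu> i) + (\<Sum>i<n. l i - \<mu> i)" using area_eq[of n \<mu>] z by simp
    also have "\<dots> = (\<Sum>i<n. l i)" unfolding sum.distrib[symmetric] by (rule sum.cong) (use le in auto)
    also have "\<dots> = area l" using area_eq[of n l] diagrams_of_bounds(2)[OF l] by simp
    finally have "(\<Sum>i<n. l i - \<mu> i) = m" using s by simp
    then show "(\<Sum>i<n. (case y of (m, \<mu>) \<Rightarrow> restrict (\<lambda>i. l i - \<mu> i) {..<n}) i,
         \<lambda>i. if i < n then l i - (case y of (m, \<mu>) \<Rightarrow> restrict (\<lambda>i. l i - \<mu> i) {..<n}) i else 0) = y"
      using le z by (auto simp: y fun_eq_iff not_less)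
    show "(case y of (m, \<mu>) \<Rightarrow> restrict (\<lambda>i. l i - \<mu> i) {..<n}) \<in> PiE {..<n} (\<lambda>i. {..l i - l (Suc i)})"
      using le by (auto simp: y diff_le_mono2)
  qed
  also have "\<dots> = (\<Sum>m\<le>n. e ^ m * strip_up m (\<lambda>_. 1) l)"
    by (subst sum.Sigma[symmetric]) (auto simp: strip_up_def mult.commute)
  finally show ?thesis by simp
qed

section \<open>Orthonormal families triangular in the complete symmetric functions\<close>

text \<open>\<open>corresponds F a\<close> means that F is the sum of a(l) s_l over all diagrams l, without reference to Schur
  functions.\<close>

inductive corresponds :: "series \<Rightarrow> weight \<Rightarrow> bool" where
  corresponds_unit_coeff: "corresponds unit_coeff empty_indicator"
| corresponds_schur_series: "corresponds schur_series (\<lambda>_. 1)"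
| corresponds_zero: "corresponds 0 0"
| corresponds_add: "corresponds F a \<Longrightarrow> corresponds G b \<Longrightarrow> corresponds (F + G) (a + b)"
| corresponds_h_mult: "corresponds F a \<Longrightarrow> corresponds (h_mult m F) (strip_up m a)"

lemma corresponds_sum: "(\<And>i. i \<in> A \<Longrightarrow> corresponds (F i) (a i)) \<Longrightarrow> corresponds (\<Sum>i\<in>A. F i) (\<Sum>i\<in>A. a i)"
proof (induction A rule: infinite_finite_induct)
  case (insert x A)
  have "corresponds (F x + (\<Sum>i\<in>A. F i)) (a x + (\<Sum>i\<in>A. a i))"
    by (rule corresponds_add) (use insert in auto)
  then show ?case using insert.hyps by (simp only: sum.insert not_False_eq_True)
qed (simp_all only: sum.infinite sum.empty corresponds_zero not_False_eq_True)

text \<open>The heart of the comparison: every clause of \<open>corresponds\<close> survives the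
  adjoint of h_k, because each rule for \<open>h_skew\<close> has a rule for
  \<open>strip_down\<close> of the same shape.\<close>

lemma corresponds_h_skew: "corresponds F a \<Longrightarrow> corresponds (h_skew k F) (strip_down k a)"
proof (induction arbitrary: k rule: corresponds.induct)
  case corresponds_unit_coeff
  then show ?case unfolding h_skew_unit_coeff strip_down_empty_indicator
    by (cases "k = 0") (simp_all only: if_True if_False refl corresponds.corresponds_unit_coeff corresponds.corresponds_zero)
next
  case corresponds_schur_series
  have "h_skew k schur_series = (\<Sum>i\<le>k. h_mult i schur_series)" by (rule h_skew_T) (rule p_skew_schur_series)
  then show ?case unfolding strip_down_one by (simp only:) (intro corresponds_sum corresponds.corresponds_h_mult corresponds.corresponds_schur_series)
next
  case corresponds_zero
  then show ?case unfolding strip_down_zero h_skew_zero by (rule corresponds.corresponds_zero)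
next
  case (corresponds_add F a G b)
  then show ?case unfolding strip_down_add h_skew_add by (intro corresponds.corresponds_add)
next
  case (corresponds_h_mult F a m)
  have "corresponds (h_mult_minus m i (h_skew (k - i) F)) (strip_up_minus m i (strip_down (k - i) a))" for i
    using corresponds_h_mult.IH[of "k - i"] by (auto simp: h_mult_minus_def strip_up_minus_def intro: corresponds.corresponds_h_mult corresponds.corresponds_zero)
  then show ?case unfolding h_skew_h_mult strip_down_strip_up by (intro corresponds_sum)
qed

lemma corresponds_empty: "corresponds F a \<Longrightarrow> F {#} = a (\<lambda>_. 0)"
  by (induction rule: corresponds.induct) (auto simp: unit_coeff_def empty_indicator_def schur_series_empty conv_empty strip_up_at_empty h_coeff_def)

definition h_prod :: "nat list \<Rightarrow> series" where
  "h_prod \<alpha> = foldr h_mult \<alpha> unit_coeff"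

lemma corresponds_h_prod: "corresponds (h_prod \<alpha>) (kostka \<alpha>)"
  by (induction \<alpha>) (auto simp: h_prod_def kostka_def intro: corresponds.intros)

lemma partitions_of_0: "partitions_of 0 = {{#}}"
proof -
  have "p = {#}" if "0 \<notin># p" "sum_mset p = 0" for p :: "nat multiset"
    using that by (cases p) auto
  then show ?thesis by (auto simp: partitions_of_def is_partition_def)
qed

text \<open>The factors of the product are moved to the other side one by one, by adjointness in
  both worlds, until only the constant terms remain to be compared by
  \<open>corresponds_empty\<close>.\<close>

lemma p_inner_h_prod: "corresponds F a \<Longrightarrow> p_inner (sum_list \<alpha>) (h_prod \<alpha>) F = diagram_inner (sum_list \<alpha>) (kostka \<alpha>) a"
proof (induction \<alpha> arbitrary: F a)
  case Nil
  have "p_inner 0 unit_coeff F = F {#}" by (simp add: p_inner_def partitions_of_0 unit_coeff_def)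
  then show ?case using corresponds_empty[OF Nil] by (simp add: h_prod_def kostka_def diagram_inner_0 empty_indicator_def)
next
  case (Cons k \<alpha>)
  have "p_inner (sum_list (k # \<alpha>)) (h_prod (k # \<alpha>)) F = p_inner (sum_list \<alpha> + k) (h_mult k (h_prod \<alpha>)) F"
    by (simp add: h_prod_def add.commute)
  also have "\<dots> = p_inner (sum_list \<alpha>) (h_prod \<alpha>) (h_skew k F)" by (rule p_inner_h_mult)
  also have "\<dots> = diagram_inner (sum_list \<alpha>) (kostka \<alpha>) (strip_down k a)" by (rule Cons.IH) (rule corresponds_h_skew[OF Cons.prems])
  also have "\<dots> = diagram_inner (sum_list \<alpha> + k) (strip_up k (kostka \<alpha>)) a" by (rule diagram_inner_strip_up[symmetric])
  also have "\<dots> = diagram_inner (sum_list (k # \<alpha>)) (kostka (k # \<alpha>)) a" by (simp add: kostka_def add.commute)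
  finally show ?case .
qed

abbreviation row_list :: "nat \<Rightarrow> (nat \<Rightarrow> nat) \<Rightarrow> nat list" where
  "row_list n l \<equiv> map l [0..<n]"

lemma sum_row_list: "l \<in> diagrams_of n \<Longrightarrow> sum_list (row_list n l) = n"
  using sum_list_drop_rows[of l n 0] by (simp add: tail_area_def diagrams_of_def)

lemma p_inner_diff_left: "p_inner n (\<lambda>\<pi>. F \<pi> - G \<pi>) H = p_inner n F H - p_inner n G H"
  by (simp add: p_inner_def algebra_simps sum_subtractf)

lemma p_inner_lincomb_left: "p_inner n (\<lambda>\<pi>. \<Sum>i\<in>A. c i * F i \<pi>) H = (\<Sum>i\<in>A. c i * p_inner n (F i) H)"
proof -
  have "(\<lambda>\<pi>. \<Sum>i\<in>A. c i * F i \<pi>) = (\<Sum>i\<in>A. (\<lambda>\<pi>. c i * F i \<pi>))" by (rule ext) (simp add: sum_fun_apply)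
  then show ?thesis by (simp add: p_inner_sum_left p_inner_scale_left)
qed

lemma p_inner_self_0:
  assumes "p_inner n F F = 0" "\<pi> \<in> partitions_of n"
  shows "F \<pi> = 0"
proof -
  have "(\<Sum>\<pi>\<in>partitions_of n. real (z_part \<pi>) * F \<pi> * F \<pi>) = 0" using assms by (simp add: p_inner_def)
  then have "real (z_part \<pi>) * F \<pi> * F \<pi> = 0"
    using assms(2) by (subst (asm) sum_nonneg_eq_0_iff) (auto simp: mult.assoc)
  then show ?thesis using z_part_partition[OF assms(2)] by simp
qed

text \<open>Subtracting from h_l the components along the X of diagrams dominating l leaves a vector s with
  \<open>p_inner n s s = 1\<close> and \<open>p_inner n s (X p) = 1\<close>, so s - X p has norm 0.\<close>

theorem orthonormal_characterization:
  fixes X :: "'i \<Rightarrow> series" and l :: "'i \<Rightarrow> nat \<Rightarrow> nat"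
  assumes surj: "l ` I = diagrams_of n"
    and norm: "\<And>p. p \<in> I \<Longrightarrow> p_inner n (X p) (X p) = 1"
    and orth: "\<And>p q. p \<in> I \<Longrightarrow> q \<in> I \<Longrightarrow> l p \<noteq> l q \<Longrightarrow> p_inner n (X p) (X q) = 0"
    and diag: "\<And>p. p \<in> I \<Longrightarrow> p_inner n (h_prod (row_list n (l p))) (X p) = 1"
  shows "p \<in> I \<Longrightarrow> corresponds F a \<Longrightarrow> p_inner n (X p) F = a (l p)"
proof (induction "tail_area_sum n (l p)" arbitrary: p F a rule: less_induct)
  case less
  define L where "L = l p"
  define h where "h = h_prod (row_list n L)"
  define K where "K = kostka (row_list n L)"
  define S where "S = {\<mu> \<in> diagrams_of n. \<mu> \<noteq> L \<and> K \<mu> \<noteq> 0}"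
  \<comment> \<open>An index is chosen for each diagram, since \<open>l\<close> is only known to be
    onto.\<close>
  define r where "r \<mu> = (SOME q. q \<in> I \<and> l q = \<mu>)" for \<mu>
  have r: "r \<mu> \<in> I" "l (r \<mu>) = \<mu>" if "\<mu> \<in> diagrams_of n" for \<mu>
  proof -
    have "\<exists>q. q \<in> I \<and> l q = \<mu>" using that surj by (metis imageE)
    from someI_ex[OF this] show "r \<mu> \<in> I" "l (r \<mu>) = \<mu>" unfolding r_def by auto
  qed
  have L: "L \<in> diagrams_of n" using less.prems(1) surj by (auto simp: L_def)
  have S: "finite S" "S \<subseteq> diagrams_of n" "L \<notin> S" by (auto simp: S_def)
  have IH: "p_inner n (X (r \<mu>)) F = a \<mu>" if "\<mu> \<in> S" "corresponds F a" for \<mu> F a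
  proof -
    have \<mu>: "\<mu> \<in> diagrams_of n" "\<mu> \<noteq> L" "K \<mu> \<noteq> 0" using that by (auto simp: S_def)
    \<comment> \<open>A nonzero Kostka number forces \<mu> to dominate L, which makes the measure of
      \<mu> smaller.\<close>
    have "tail_area j \<mu> \<le> tail_area j L" for j
      using kostka_nonzero[OF \<mu>(3)[unfolded K_def]] unfolding sum_list_drop_rows[OF L] by blast
    then have "tail_area_sum n \<mu> < tail_area_sum n L" using tail_area_sum_less \<mu> L by blast
    then show ?thesis using less.hyps[of "r \<mu>"] r[OF \<mu>(1)] that(2) unfolding L_def by auto
  qed
  define s where "s = (\<lambda>\<pi>. h \<pi> - (\<Sum>\<mu>\<in>S. K \<mu> * X (r \<mu>) \<pi>))"
  have s_left: "p_inner n s G = p_inner n h G - (\<Sum>\<mu>\<in>S. K \<mu> * p_inner n (X (r \<mu>)) G)" for G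
    unfolding s_def p_inner_diff_left p_inner_lincomb_left ..
  have hF: "p_inner n h F = (\<Sum>\<mu>\<in>S. K \<mu> * a \<mu>) + a L" if "corresponds F a" for F a
  proof -
    have "p_inner n h F = diagram_inner n K a"
      using p_inner_h_prod[OF that, of "row_list n L"] unfolding sum_row_list[OF L] h_def K_def .
    also have "\<dots> = (\<Sum>\<mu>\<in>insert L S. K \<mu> * a \<mu>)"
      unfolding diagram_inner_def by (rule sum.mono_neutral_right) (use L in \<open>auto simp: S_def\<close>)
    also have "K L = 1" unfolding K_def
      by (rule kostka_diag) (use L diagrams_of_bounds(2) in \<open>auto simp: diagrams_of_def\<close>)
    then have "(\<Sum>\<mu>\<in>insert L S. K \<mu> * a \<mu>) = (\<Sum>\<mu>\<in>S. K \<mu> * a \<mu>) + a L" using S by simp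
    finally show ?thesis .
  qed
  have sF: "p_inner n s F = a L" if "corresponds F a" for F a
    unfolding s_left hF[OF that] using IH[OF _ that] by simp
  \<comment> \<open>The induction hypothesis and \<open>sF\<close> are also applied to
    \<open>h\<close> itself. For this the series F and the weight a have to vary in the
    induction.\<close>
  have hK: "corresponds h K" unfolding h_def K_def by (rule corresponds_h_prod)
  have KL: "K L = 1" unfolding K_def
    by (rule kostka_diag) (use L diagrams_of_bounds(2) in \<open>auto simp: diagrams_of_def\<close>)
  have sX: "p_inner n s (X (r \<mu>)) = 0" if "\<mu> \<in> S" for \<mu>
  proof -
    have "p_inner n (X (r \<nu>)) (X (r \<mu>)) = (if \<nu> = \<mu> then 1 else 0)" if "\<nu> \<in> S" for \<nu>
    proof -
      have "\<nu> \<in> diagrams_of n" "\<mu> \<in> diagrams_of n" using that \<open>\<mu> \<in> S\<close> S by auto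
      then show ?thesis using r[of \<nu>] r[of \<mu>] norm[of "r \<mu>"] orth[of "r \<nu>" "r \<mu>"] by auto
    qed
    then have "(\<Sum>\<nu>\<in>S. K \<nu> * p_inner n (X (r \<nu>)) (X (r \<mu>))) = (\<Sum>\<nu>\<in>S. if \<nu> = \<mu> then K \<nu> else 0)"
      by (intro sum.cong) auto
    also have "\<dots> = K \<mu>" using S(1) that by simp
    also have "\<dots> = p_inner n h (X (r \<mu>))" using IH[OF that hK] by (simp add: p_inner_commute)
    finally show ?thesis unfolding s_left by simp
  qed
  have ss: "p_inner n s s = 1"
  proof -
    have "p_inner n h s = 1" using sF[OF hK] KL by (simp add: p_inner_commute)
    then show ?thesis using sX unfolding s_left[of s] by (simp add: p_inner_commute)
  qed
  have sp: "p_inner n s (X p) = 1"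
  proof -
    have "p_inner n (X (r \<mu>)) (X p) = 0" if "\<mu> \<in> S" for \<mu>
      by (rule orth) (use that r[of \<mu>] S less.prems(1) in \<open>auto simp: L_def\<close>)
    then show ?thesis unfolding s_left using diag[OF less.prems(1)] by (simp add: h_def L_def)
  qed
  have "p_inner n (\<lambda>\<pi>. s \<pi> - X p \<pi>) (\<lambda>\<pi>. s \<pi> - X p \<pi>) = 0"
    unfolding p_inner_diff_left p_inner_commute[of n _ "\<lambda>\<pi>. s \<pi> - X p \<pi>"]
    using ss sp norm[OF less.prems(1)] by (simp add: p_inner_commute)
  then have "s \<pi> = X p \<pi>" if "\<pi> \<in> partitions_of n" for \<pi>
    using p_inner_self_0[OF _ that] by fastforce
  then have "p_inner n (X p) F = p_inner n s F" by (simp add: p_inner_def)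
  then show ?case using sF[OF less.prems(2)] by (simp add: L_def)
qed

section \<open>Cycle types\<close>

text \<open>Relative to an arbitrary set, so that permutations can be built up by adding one point
  at a time and cut down by removing one orbit.\<close>

definition cycle_type_on :: "'a set \<Rightarrow> ('a \<Rightarrow> 'a) \<Rightarrow> nat multiset" where
  "cycle_type_on A g = image_mset card (mset_set (orbit g ` A))"

lemma permutes_permutation: "finite A \<Longrightarrow> p permutes A \<Longrightarrow> permutation p"
  by (auto simp: permutation_permutes)

lemma orbit_eq_of_mem: "permutation p \<Longrightarrow> y \<in> orbit p x \<Longrightarrow> orbit p y = orbit p x"
  by (meson cyclic_on_orbit' orbit_cyclic_eq3)

lemma orbit_closed_subset:
  assumes "f x \<in> S" "\<And>y. y \<in> S \<Longrightarrow> f y \<in> S"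
  shows "orbit f x \<subseteq> S"
proof
  fix y assume "y \<in> orbit f x"
  then show "y \<in> S" by induction (use assms in auto)
qed

context
  fixes A :: "'a set" and p :: "'a \<Rightarrow> 'a" and a b :: 'a
  assumes fin: "finite A" and p: "p permutes A" and a: "a \<notin> A" and b: "b \<in> A"
begin

lemma perm_p: "permutation p" using fin p by (rule permutes_permutation)

lemma p_closed: "y \<in> A \<Longrightarrow> p y \<in> A" using p by (simp add: permutes_in_image)

lemma orbit_A: "y \<in> A \<Longrightarrow> orbit p y \<subseteq> A" using p by (rule permutes_orbit_subset)

text \<open>Composing with the transposition inserts the new point a directly in front of b in the
  cycle of b: the preimage of b now goes to a, and a goes to b.\<close>

lemma insert_point_apply:
  "(transpose a b \<circ> p) a = b"
  "y \<in> A \<Longrightarrow> p y = b \<Longrightarrow> (transpose a b \<circ> p) y = a"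
  "y \<in> A \<Longrightarrow> p y \<noteq> b \<Longrightarrow> (transpose a b \<circ> p) y = p y"
proof -
  show "(transpose a b \<circ> p) a = b" using p a by (simp add: permutes_def)
  show "y \<in> A \<Longrightarrow> p y = b \<Longrightarrow> (transpose a b \<circ> p) y = a" by simp
  assume "y \<in> A" "p y \<noteq> b"
  then show "(transpose a b \<circ> p) y = p y" using p_closed[of y] a by (auto simp: transpose_def)
qed

lemma insert_point_permutation: "permutation (transpose a b \<circ> p)"
  by (intro permutation_compose perm_p permutation_swap_id)

lemma orbit_insert_point: "orbit (transpose a b \<circ> p) a = insert a (orbit p b)"
proof
  let ?g = "transpose a b \<circ> p"
  have bO: "b \<in> orbit p b" using perm_p by (rule permutation_self_in_orbit)
  show "orbit ?g a \<subseteq> insert a (orbit p b)"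
  proof (rule orbit_closed_subset)
    show "?g a \<in> insert a (orbit p b)" using bO insert_point_apply(1) by simp
    fix y assume y: "y \<in> insert a (orbit p b)"
    show "?g y \<in> insert a (orbit p b)"
    proof (cases "y = a")
      case False
      then have "y \<in> orbit p b" "y \<in> A" using y orbit_A[OF b] by auto
      then show ?thesis using insert_point_apply(2,3)[of y]
        by (cases "p y = b") (auto intro: orbit.step)
    qed (use bO insert_point_apply(1) in simp)
  qed
  have b': "b \<in> orbit ?g a" using orbit.base[of ?g a] insert_point_apply(1) by simp
  have "orbit p b \<subseteq> orbit ?g a \<inter> A"
  proof (rule orbit_closed_subset)
    have step: "p y \<in> orbit ?g a \<inter> A" if "y \<in> orbit ?g a \<inter> A" for y
    proof (cases "p y = b")
      case True
      then show ?thesis using b' b by simp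
    next
      case False
      then have "?g y = p y" using that insert_point_apply(3) by blast
      then have "p y \<in> orbit ?g a" using orbit.step[of y ?g a] that by simp
      then show ?thesis using p_closed that by blast
    qed
    then show "\<And>y. y \<in> orbit ?g a \<inter> A \<Longrightarrow> p y \<in> orbit ?g a \<inter> A" .
    show "p b \<in> orbit ?g a \<inter> A" using step[of b] b' b by blast
  qed
  moreover have "a \<in> orbit ?g a"
    using insert_point_permutation by (rule permutation_self_in_orbit)
  ultimately show "insert a (orbit p b) \<subseteq> orbit ?g a" by blast
qed

lemma orbit_insert_other:
  assumes y: "y \<in> A" "y \<notin> orbit p b"
  shows "orbit (transpose a b \<circ> p) y = orbit p y"
proof (rule orbit_cong)
  show "y \<in> orbit p y" using perm_p by (rule permutation_self_in_orbit)
  fix z assume z: "z \<in> orbit p y"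
  then have zA: "z \<in> A" using orbit_A y by blast
  have "p z \<noteq> b"
  proof
    assume "p z = b"
    then have "b \<in> orbit p y" using z orbit.step by metis
    then have "orbit p b = orbit p y" by (rule orbit_eq_of_mem[OF perm_p])
    then show False using y permutation_self_in_orbit[OF perm_p, of y] by simp
  qed
  then show "(transpose a b \<circ> p) z = p z" using insert_point_apply(3) zA by blast
qed

lemma cycle_type_on_insert_point:
  "card (orbit p b) \<in># cycle_type_on A p"
  "cycle_type_on (insert a A) (transpose a b \<circ> p)
    = add_mset (Suc (card (orbit p b))) (cycle_type_on A p - {#card (orbit p b)#})"
proof -
  let ?g = "transpose a b \<circ> p" and ?O = "orbit p b"
  have finO: "finite ?O" using orbit_A[OF b] fin finite_subset by blast
  have aO: "a \<notin> ?O" using orbit_A[OF b] a by blast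
  have split: "orbit p ` A = insert ?O (orbit p ` (A - ?O))"
    using b orbit_eq_of_mem[OF perm_p] by blast
  have nin: "?O \<notin> orbit p ` (A - ?O)"
  proof
    assume "?O \<in> orbit p ` (A - ?O)"
    then obtain y where "y \<notin> ?O" "?O = orbit p y" by auto
    then show False using permutation_self_in_orbit[OF perm_p, of y] by simp
  qed
  have g_eq: "orbit ?g y = orbit ?g a" if "y \<in> ?O" for y
    using orbit_eq_of_mem[OF insert_point_permutation] that orbit_insert_point by blast
  have "orbit ?g ` insert a A = insert (insert a ?O) (orbit ?g ` (A - ?O))"
  proof -
    have "insert a A = insert a (A \<inter> ?O) \<union> (A - ?O)" by blast
    then have "orbit ?g ` insert a A = insert (orbit ?g a) (orbit ?g ` (A \<inter> ?O)) \<union> orbit ?g ` (A - ?O)"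
      by (metis image_Un image_insert)
    moreover have "orbit ?g ` (A \<inter> ?O) \<subseteq> {orbit ?g a}" using g_eq by blast
    ultimately show ?thesis using orbit_insert_point by auto
  qed
  also have "orbit ?g ` (A - ?O) = orbit p ` (A - ?O)"
    by (rule image_cong) (use orbit_insert_other in auto)
  finally have g: "orbit ?g ` insert a A = insert (insert a ?O) (orbit p ` (A - ?O))" .
  have nin': "insert a ?O \<notin> orbit p ` (A - ?O)"
    using orbit_A a by blast
  have c: "cycle_type_on A p = add_mset (card ?O) (image_mset card (mset_set (orbit p ` (A - ?O))))"
    unfolding cycle_type_on_def split using nin fin by simp
  then show "card ?O \<in># cycle_type_on A p" by simp
  show "cycle_type_on (insert a A) ?g = add_mset (Suc (card ?O)) (cycle_type_on A p - {#card ?O#})"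
    unfolding c unfolding cycle_type_on_def g using nin' fin finO aO by simp
qed

lemma cycle_type_on_insert_fixed: "cycle_type_on (insert a A) p = add_mset 1 (cycle_type_on A p)"
proof -
  have "p a = a" using p a by (simp add: permutes_def)
  then have o: "orbit p a = {a}" by (simp add: orbit_eq_singleton_iff)
  have "{a} \<notin> orbit p ` A" using orbit_A a by blast
  then show ?thesis using fin by (simp add: cycle_type_on_def o)
qed

end

section \<open>Counting permutations by cycle type\<close>

lemma sum_over_orbits:
  assumes "finite A" "p permutes A"
  shows "(\<Sum>b\<in>A. f (card (orbit p b)) :: 'b :: comm_semiring_1)
    = (\<Sum>k\<in>set_mset (cycle_type_on A p). of_nat (count (cycle_type_on A p) k) * (of_nat k * f k))"
proof -
  have perm_p: "permutation p" using assms by (rule permutes_permutation)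
  have "(\<Sum>b\<in>A. f (card (orbit p b))) = (\<Sum>Q\<in>orbit p ` A. \<Sum>b\<in>{b \<in> A. orbit p b = Q}. f (card (orbit p b)))"
    by (rule sum.image_gen) (rule assms)
  also have "\<dots> = (\<Sum>Q\<in>orbit p ` A. of_nat (card Q) * f (card Q))"
  proof (rule sum.cong[OF refl])
    fix Q assume "Q \<in> orbit p ` A"
    then obtain x where x: "x \<in> A" "Q = orbit p x" by auto
    have "{b \<in> A. orbit p b = Q} = Q"
      using x orbit_eq_of_mem[OF perm_p] permutes_orbit_subset[OF assms(2) x(1)]
        permutation_self_in_orbit[OF perm_p] by auto
    then have "(\<Sum>b\<in>{b \<in> A. orbit p b = Q}. f (card (orbit p b))) = (\<Sum>b\<in>Q. f (card Q))"
      by (intro sum.cong) auto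
    then show "(\<Sum>b\<in>{b \<in> A. orbit p b = Q}. f (card (orbit p b))) = of_nat (card Q) * f (card Q)"
      by simp
  qed
  also have "\<dots> = (\<Sum>k\<in>#cycle_type_on A p. of_nat k * f k)"
    unfolding cycle_type_on_def by (simp add: sum_unfold_sum_mset multiset.map_comp o_def)
  finally show ?thesis unfolding sum_mset_image_eq_sum_count .
qed

text \<open>Partitions with a marked part k correspond to pairs of k and the remaining partition;
  the weight k m_k turns 1 / z of the whole into 1 / z of the rest.\<close>

lemma sum_partitions_remove_part:
  fixes G :: "nat \<Rightarrow> series"
  shows "(\<Sum>\<pi>\<in>partitions_of n. \<Sum>k\<in>set_mset \<pi>. real (count \<pi> k) * real k / real (z_part \<pi>) * G k (\<pi> - {#k#}))
    = (\<Sum>k=1..n. \<Sum>\<tau>\<in>partitions_of (n - k). G k \<tau> / real (z_part \<tau>))"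
proof -
  have "(\<Sum>\<pi>\<in>partitions_of n. \<Sum>k\<in>set_mset \<pi>. real (count \<pi> k) * real k / real (z_part \<pi>) * G k (\<pi> - {#k#}))
    = (\<Sum>(\<pi>, k)\<in>Sigma (partitions_of n) set_mset. real (count \<pi> k) * real k / real (z_part \<pi>) * G k (\<pi> - {#k#}))"
    by (subst sum.Sigma) auto
  also have "\<dots> = (\<Sum>(k, \<tau>)\<in>Sigma {1..n} (\<lambda>k. partitions_of (n - k)). G k \<tau> / real (z_part \<tau>))"
  proof (rule sum.reindex_bij_witness[of _ "\<lambda>(k, \<tau>). (add_mset k \<tau>, k)" "\<lambda>(\<pi>, k). (k, \<pi> - {#k#})"])
    fix x assume "x \<in> Sigma (partitions_of n) set_mset"
    then obtain \<pi> k where x: "x = (\<pi>, k)" "\<pi> \<in> partitions_of n" "k \<in># \<pi>" by auto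
    then obtain \<tau> where \<tau>: "\<pi> = add_mset k \<tau>" by (metis multi_member_split)
    have k: "k \<ge> 1" "k \<le> n" using x unfolding \<tau> by (auto simp: partitions_of_def is_partition_def)
    show "(case case x of (\<pi>, k) \<Rightarrow> (k, \<pi> - {#k#}) of (k, \<tau>) \<Rightarrow> (add_mset k \<tau>, k)) = x"
      by (simp add: x \<tau>)
    show "(case x of (\<pi>, k) \<Rightarrow> (k, \<pi> - {#k#})) \<in> Sigma {1..n} (\<lambda>k. partitions_of (n - k))"
      using x k by (auto simp: \<tau> partitions_of_def is_partition_def)
    show "(case case x of (\<pi>, k) \<Rightarrow> (k, \<pi> - {#k#}) of (k, \<tau>) \<Rightarrow> G k \<tau> / real (z_part \<tau>)) =
         (case x of (\<pi>, k) \<Rightarrow> real (count \<pi> k) * real k / real (z_part \<pi>) * G k (\<pi> - {#k#}))"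
      using scaled_inverse_z_part_add[OF k(1), of \<tau> "G k \<tau>"] by (simp add: x(1) \<tau> algebra_simps add_divide_distrib)
  next
    fix y assume "y \<in> Sigma {1..n} (\<lambda>k. partitions_of (n - k))"
    then show "(case y of (k, \<tau>) \<Rightarrow> (add_mset k \<tau>, k)) \<in> Sigma (partitions_of n) set_mset"
      and "(case case y of (k, \<tau>) \<Rightarrow> (add_mset k \<tau>, k) of (\<pi>, k) \<Rightarrow> (k, \<pi> - {#k#})) = y"
      by (auto simp: partitions_of_def is_partition_def)
  qed
  also have "\<dots> = (\<Sum>k=1..n. \<Sum>\<tau>\<in>partitions_of (n - k). G k \<tau> / real (z_part \<tau>))"
    by (subst sum.Sigma) auto
  finally show ?thesis .
qed

text \<open>There are n!/z_\<pi> permutations of cycle type \<pi>. The proof adds a point to A,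
  which becomes a fixed point or enters an existing cycle; stating the count as a sum of an
  arbitrary F lets the induction hypothesis absorb this choice.\<close>

theorem sum_over_cycle_types:
  fixes F :: "series"
  assumes "finite A"
  shows "(\<Sum>g | g permutes A. F (cycle_type_on A g))
     = fact (card A) * (\<Sum>\<pi>\<in>partitions_of (card A). F \<pi> / real (z_part \<pi>))"
  using assms
proof (induction A arbitrary: F rule: finite_induct)
  case empty
  then show ?case by (simp add: cycle_type_on_def partitions_of_0)
next
  case (insert a A)
  let ?n = "card A"
  \<comment> \<open>Sums F over all ways to add a point to a permutation of type M: as a fixed
    point, or in front of one of the k points of one of the cycles of length k.\<close>
  define F' where "F' M = F (add_mset 1 M)
     + (\<Sum>k\<in>set_mset M. real (count M k) * (real k * F (add_mset (Suc k) (M - {#k#}))))" for M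
  have "(\<Sum>g | g permutes insert a A. F (cycle_type_on (insert a A) g))
     = (\<Sum>b\<in>insert a A. \<Sum>q | q permutes A. F (cycle_type_on (insert a A) (transpose a b \<circ> q)))"
    by (rule sum_over_permutations_insert) (use insert in auto)
  also have "\<dots> = (\<Sum>q | q permutes A. F (cycle_type_on (insert a A) q))
       + (\<Sum>b\<in>A. \<Sum>q | q permutes A. F (cycle_type_on (insert a A) (transpose a b \<circ> q)))"
    using insert by simp
  also have "(\<Sum>b\<in>A. \<Sum>q | q permutes A. F (cycle_type_on (insert a A) (transpose a b \<circ> q)))
       = (\<Sum>q | q permutes A. \<Sum>b\<in>A. F (cycle_type_on (insert a A) (transpose a b \<circ> q)))"
    by (rule sum.swap)
  also have "(\<Sum>q | q permutes A. F (cycle_type_on (insert a A) q)) + \<dots> = (\<Sum>q | q permutes A. F' (cycle_type_on A q))"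
    unfolding sum.distrib[symmetric]
  proof (rule sum.cong[OF refl])
    fix q assume "q \<in> {q. q permutes A}"
    then have q: "q permutes A" by simp
    have "(\<Sum>b\<in>A. F (cycle_type_on (insert a A) (transpose a b \<circ> q)))
       = (\<Sum>b\<in>A. F (add_mset (Suc (card (orbit q b))) (cycle_type_on A q - {#card (orbit q b)#})))"
      by (rule sum.cong) (use cycle_type_on_insert_point(2)[OF insert.hyps(1) q insert.hyps(2)] in auto)
    also have "\<dots> = (\<Sum>k\<in>set_mset (cycle_type_on A q). real (count (cycle_type_on A q) k) * (real k * F (add_mset (Suc k) (cycle_type_on A q - {#k#}))))"
      by (rule sum_over_orbits[OF insert.hyps(1) q])
    moreover have "cycle_type_on (insert a A) q = add_mset 1 (cycle_type_on A q)"
    proof (cases "A = {}")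
      case True
      then show ?thesis using q by (simp add: cycle_type_on_def orbit_eq_singleton_iff[THEN iffD2])
    next
      case False
      then show ?thesis using cycle_type_on_insert_fixed[OF insert.hyps(1) q insert.hyps(2)] by blast
    qed
    ultimately show "F (cycle_type_on (insert a A) q) + (\<Sum>b\<in>A. F (cycle_type_on (insert a A) (transpose a b \<circ> q))) = F' (cycle_type_on A q)"
      by (simp add: F'_def)
  qed
  also have "\<dots> = fact ?n * (\<Sum>\<pi>\<in>partitions_of ?n. F' \<pi> / real (z_part \<pi>))" by (rule insert.IH)
  also have "(\<Sum>\<pi>\<in>partitions_of ?n. F' \<pi> / real (z_part \<pi>))
     = (\<Sum>\<pi>\<in>partitions_of ?n. F (add_mset 1 \<pi>) / real (z_part \<pi>))
      + (\<Sum>\<pi>\<in>partitions_of ?n. \<Sum>k\<in>set_mset \<pi>. real (count \<pi> k) * real k / real (z_part \<pi>) * F (add_mset (Suc k) (\<pi> - {#k#})))"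
    unfolding F'_def sum.distrib[symmetric]
    by (rule sum.cong) (auto simp: add_divide_distrib sum_divide_distrib mult_ac)
  also have "(\<Sum>\<pi>\<in>partitions_of ?n. \<Sum>k\<in>set_mset \<pi>. real (count \<pi> k) * real k / real (z_part \<pi>) * F (add_mset (Suc k) (\<pi> - {#k#})))
     = (\<Sum>k=1..?n. \<Sum>\<tau>\<in>partitions_of (?n - k). F (add_mset (Suc k) \<tau>) / real (z_part \<tau>))"
    by (rule sum_partitions_remove_part[where G = "\<lambda>k \<tau>. F (add_mset (Suc k) \<tau>)"])
  \<comment> \<open>A new fixed point is the case k = 0, as if a cycle of length 0 were
    lengthened.\<close>
  also have "(\<Sum>\<pi>\<in>partitions_of ?n. F (add_mset 1 \<pi>) / real (z_part \<pi>)) + \<dots>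
     = (\<Sum>k=0..?n. \<Sum>\<tau>\<in>partitions_of (?n - k). F (add_mset (Suc k) \<tau>) / real (z_part \<tau>))"
    by (subst sum.atLeast_Suc_atMost[of 0]) simp_all
  also have "\<dots> = (\<Sum>k=1..Suc ?n. \<Sum>\<tau>\<in>partitions_of (Suc ?n - k). F (add_mset k \<tau>) / real (z_part \<tau>))"
    by (rule sum.reindex_bij_witness[of _ "\<lambda>k. k - 1" Suc]) auto
  \<comment> \<open>After the shift, k is the length of the cycle of the new point. Reading the
    removal of a part backwards gives weights k m_k, whose sum over the parts is n + 1.\<close>
  also have "\<dots> = (\<Sum>\<pi>\<in>partitions_of (Suc ?n). \<Sum>k\<in>set_mset \<pi>. real (count \<pi> k) * real k / real (z_part \<pi>) * F (add_mset k (\<pi> - {#k#})))"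
    by (rule sum_partitions_remove_part[symmetric])
  also have "\<dots> = (\<Sum>\<pi>\<in>partitions_of (Suc ?n). real (Suc ?n) * (F \<pi> / real (z_part \<pi>)))"
  proof (rule sum.cong[OF refl])
    fix \<pi> assume "\<pi> \<in> partitions_of (Suc ?n)"
    then have "Suc ?n = (\<Sum>k\<in>set_mset \<pi>. count \<pi> k * k)"
      by (simp add: partitions_of_def sum_mset_eq_sum_count)
    then have n: "real (Suc ?n) = (\<Sum>k\<in>set_mset \<pi>. real (count \<pi> k) * real k)"
      by (metis (mono_tags, lifting) of_nat_mult of_nat_sum sum.cong)
    show "(\<Sum>k\<in>set_mset \<pi>. real (count \<pi> k) * real k / real (z_part \<pi>) * F (add_mset k (\<pi> - {#k#})))
       = real (Suc ?n) * (F \<pi> / real (z_part \<pi>))"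
      unfolding n sum_distrib_right by (rule sum.cong) (auto simp: insert_DiffM)
  qed
  also have "\<dots> = real (Suc ?n) * (\<Sum>\<pi>\<in>partitions_of (Suc ?n). F \<pi> / real (z_part \<pi>))"
    by (simp only: sum_distrib_left)
  finally show ?case using insert.hyps by (simp del: of_nat_Suc add: mult_ac)
qed

section \<open>Sign and conjugacy in terms of the cycle type\<close>

lemma part_sgn_insert_part:
  "k \<in># M \<Longrightarrow> part_sgn (add_mset (Suc k) (M - {#k#})) = - part_sgn M"
  by (auto simp: part_sgn_def dest!: multi_member_split)

lemma sign_eq_part_sgn:
  assumes "finite A" "g permutes A"
  shows "sign g = part_sgn (cycle_type_on A g)"
  using assms
proof (induction A arbitrary: g rule: finite_induct)
  case empty
  then show ?case by (simp add: part_sgn_def cycle_type_on_def)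
next
  case (insert a A)
  from insert.prems have "g \<in> {p. p permutes insert a A}" by simp
  then obtain b q where g: "g = transpose a b \<circ> q" "b \<in> insert a A" "q permutes A"
    unfolding permutes_insert by auto
  have pq: "permutation q" using insert.hyps(1) g(3) by (rule permutes_permutation)
  show ?case
  proof (cases "b = a")
    case True
    then have "g = q" using g by simp
    moreover have "cycle_type_on (insert a A) q = add_mset 1 (cycle_type_on A q)"
    proof (cases "A = {}")
      case True
      then show ?thesis using g by (simp add: cycle_type_on_def orbit_eq_singleton_iff[THEN iffD2])
    next
      case False
      then show ?thesis using cycle_type_on_insert_fixed[OF insert.hyps(1) g(3) insert.hyps(2)] by blast
    qed
    ultimately show ?thesis using insert.IH[OF g(3)] by (simp add: part_sgn_def)
  next
    case False
    then have b: "b \<in> A" using g by simp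
    have "sign g = - sign q"
      unfolding g(1) using False pq by (simp add: sign_compose permutation_swap_id sign_swap_id)
    moreover have "cycle_type_on (insert a A) g = add_mset (Suc (card (orbit q b))) (cycle_type_on A q - {#card (orbit q b)#})"
      unfolding g(1) by (rule cycle_type_on_insert_point(2)[OF insert.hyps(1) g(3) insert.hyps(2) b])
    ultimately show ?thesis
      using insert.IH[OF g(3)] cycle_type_on_insert_point(1)[OF insert.hyps(1) g(3) insert.hyps(2) b]
      by (simp add: part_sgn_insert_part)
  qed
qed

lemma orbit_power_bij:
  assumes "permutation p"
  shows "bij_betw (\<lambda>n. (p ^^ n) x) {0..<card (orbit p x)} (orbit p x)"
    and "(p ^^ card (orbit p x)) x = x"
    and "card (orbit p x) > 0"
proof -
  have x: "x \<in> orbit p x" using assms by (rule permutation_self_in_orbit)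
  have inj: "inj_on (\<lambda>n. (p ^^ n) x) {0..<funpow_dist1 p x x}" using x by (rule inj_on_funpow_dist1)
  have im: "orbit p x = (\<lambda>n. (p ^^ n) x) ` {0..<funpow_dist1 p x x}" using x by (rule orbit_conv_funpow_dist1)
  have c: "card (orbit p x) = funpow_dist1 p x x" using im card_image[OF inj] by simp
  show "bij_betw (\<lambda>n. (p ^^ n) x) {0..<card (orbit p x)} (orbit p x)"
    unfolding c bij_betw_def using inj im by simp
  show "(p ^^ card (orbit p x)) x = x" unfolding c using x by (rule funpow_dist1_prop)
  show "card (orbit p x) > 0" unfolding c by simp
qed

text \<open>Sends the n-th iterate of x under p to the n-th iterate of y under q; the equal orbit
  lengths make this compatible where the cycles close.\<close>

lemma intertwine_orbits:
  assumes p: "permutation p" and q: "permutation q" and c: "card (orbit p x) = card (orbit q y)"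
  shows "\<exists>\<sigma>. bij_betw \<sigma> (orbit p x) (orbit q y) \<and> (\<forall>z\<in>orbit p x. \<sigma> (p z) = q (\<sigma> z))"
proof -
  let ?k = "card (orbit p x)" and ?f = "\<lambda>n. (p ^^ n) x" and ?g = "\<lambda>n. (q ^^ n) y"
  note f = orbit_power_bij[OF p, of x]
  note g = orbit_power_bij[OF q, of y, folded c]
  let ?i = "inv_into {0..<?k} ?f"
  let ?\<sigma> = "?g \<circ> ?i"
  have "bij_betw ?\<sigma> (orbit p x) (orbit q y)"
    by (rule bij_betw_trans[OF bij_betw_inv_into[OF f(1)] g(1)])
  moreover have "?\<sigma> (p z) = q (?\<sigma> z)" if "z \<in> orbit p x" for z
  proof -
    have "z \<in> ?f ` {0..<?k}" using that f(1) unfolding bij_betw_def by simp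
    then obtain n where n: "n < ?k" "z = ?f n" by auto
    have i: "?i (?f m) = m" if "m < ?k" for m
      using f(1) that unfolding bij_betw_def by (intro inv_into_f_f) auto
    show ?thesis
    proof (cases "Suc n < ?k")
      case True
      have "p z = ?f (Suc n)" using n by simp
      then have "?\<sigma> (p z) = ?g (Suc n)" using i[OF True] by simp
      then show ?thesis using n i by simp
    next
      case False
      then have k: "Suc n = ?k" using n by simp
      have "p z = ?f (Suc n)" using n by simp
      also have "\<dots> = ?f 0" unfolding k using f(2) by simp
      finally have "?\<sigma> (p z) = y" using i[of 0] f(3) by simp
      moreover have "q (?\<sigma> z) = ?g (Suc n)" using n i by simp
      ultimately show ?thesis unfolding k using g(2) by simp
    qed
  qed
  ultimately show ?thesis by blast
qed

lemma cycle_type_on_remove_orbit: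
  assumes p: "permutation p" and fin: "finite A" and im: "p ` A = A" and x: "x \<in> A"
  shows "orbit p x \<subseteq> A" "p ` (A - orbit p x) = A - orbit p x"
    "cycle_type_on A p = add_mset (card (orbit p x)) (cycle_type_on (A - orbit p x) p)"
proof -
  let ?O = "orbit p x"
  show sub: "?O \<subseteq> A" by (rule orbit_closed_subset) (use im x in auto)
  have inj: "inj p" using p permutation_bijective bij_is_inj by blast
  have imO: "p ` ?O = ?O"
  proof -
    have "p ` ?O \<subseteq> ?O" by (auto intro: orbit.step)
    then show ?thesis
      using finite_subset[OF sub fin] inj by (meson endo_inj_surj inj_on_subset subset_UNIV)
  qed
  show "p ` (A - ?O) = A - ?O" using inj im imO by (simp add: image_set_diff)
  have split: "orbit p ` A = insert ?O (orbit p ` (A - ?O))"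
    using x orbit_eq_of_mem[OF p] by blast
  have nin: "?O \<notin> orbit p ` (A - ?O)"
  proof
    assume "?O \<in> orbit p ` (A - ?O)"
    then obtain y where "y \<notin> ?O" "?O = orbit p y" by auto
    then show False using permutation_self_in_orbit[OF p, of y] by simp
  qed
  show "cycle_type_on A p = add_mset (card ?O) (cycle_type_on (A - ?O) p)"
    unfolding cycle_type_on_def split using nin fin by simp
qed

text \<open>Orbits of equal size are paired and removed one at a time. Two invariant sets are
  allowed because the remainders may differ even when A = B at the start.\<close>

lemma intertwine:
  assumes "permutation p" "permutation q" "finite A" "finite B" "p ` A = A" "q ` B = B"
    "cycle_type_on A p = cycle_type_on B q"
  shows "\<exists>\<sigma>. bij_betw \<sigma> A B \<and> (\<forall>z\<in>A. \<sigma> (p z) = q (\<sigma> z))"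
  using assms
proof (induction "card A" arbitrary: A B rule: less_induct)
  case less
  note p = less.prems(1) and q = less.prems(2)
  show ?case
  proof (cases "A = {}")
    case True
    then have "cycle_type_on B q = {#}" using less.prems(7) by (simp add: cycle_type_on_def)
    then have "B = {}" using less.prems(4) by (simp add: cycle_type_on_def mset_set_empty_iff)
    then show ?thesis using True by (auto simp: bij_betw_def)
  next
    case False
    then obtain x where x: "x \<in> A" by blast
    note X = cycle_type_on_remove_orbit[OF p less.prems(3,5) x]
    have "card (orbit p x) \<in># cycle_type_on B q" using X(3) less.prems(7) by (metis union_single_eq_member)
    then obtain y where y: "y \<in> B" "card (orbit p x) = card (orbit q y)"
      using less.prems(4) by (auto simp: cycle_type_on_def)
    note Y = cycle_type_on_remove_orbit[OF q less.prems(4,6) y(1)]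
    obtain \<sigma>0 where \<sigma>0: "bij_betw \<sigma>0 (orbit p x) (orbit q y)" "\<And>z. z \<in> orbit p x \<Longrightarrow> \<sigma>0 (p z) = q (\<sigma>0 z)"
      using intertwine_orbits[OF p q y(2)] by auto
    have xo: "x \<in> orbit p x" using p by (rule permutation_self_in_orbit)
    have "A - orbit p x \<subset> A" using xo x by blast
    then have "card (A - orbit p x) < card A" using less.prems(3) by (intro psubset_card_mono)
    moreover have "cycle_type_on (A - orbit p x) p = cycle_type_on (B - orbit q y) q"
      using X(3) Y(3) less.prems(7) y(2) by simp
    ultimately obtain \<sigma>1 where \<sigma>1: "bij_betw \<sigma>1 (A - orbit p x) (B - orbit q y)"
        "\<And>z. z \<in> A - orbit p x \<Longrightarrow> \<sigma>1 (p z) = q (\<sigma>1 z)"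
      using less.hyps[of "A - orbit p x" "B - orbit q y"] p q less.prems(3,4) X(2) Y(2) by auto
    define \<sigma> where "\<sigma> z = (if z \<in> orbit p x then \<sigma>0 z else \<sigma>1 z)" for z
    have "bij_betw \<sigma> (orbit p x) (orbit q y)"
      using \<sigma>0(1) by (rule bij_betw_cong[THEN iffD1, rotated]) (simp add: \<sigma>_def)
    moreover have "bij_betw \<sigma> (A - orbit p x) (B - orbit q y)"
      using \<sigma>1(1) by (rule bij_betw_cong[THEN iffD1, rotated]) (simp add: \<sigma>_def)
    ultimately have "bij_betw \<sigma> (orbit p x \<union> (A - orbit p x)) (orbit q y \<union> (B - orbit q y))"
      by (rule bij_betw_combine) blast
    moreover have "orbit p x \<union> (A - orbit p x) = A" "orbit q y \<union> (B - orbit q y) = B"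
      using X(1) Y(1) by auto
    moreover have "\<sigma> (p z) = q (\<sigma> z)" if "z \<in> A" for z
    proof (cases "z \<in> orbit p x")
      case True
      then show ?thesis using \<sigma>0(2) orbit.step[OF True] by (simp add: \<sigma>_def)
    next
      case False
      then have "p z \<in> A - orbit p x" using X(2) that by blast
      then show ?thesis using \<sigma>1(2)[of z] False that by (simp add: \<sigma>_def)
    qed
    ultimately show ?thesis by metis
  qed
qed

lemma conjugate_of_same_cycle_type_on:
  assumes "finite A" "p permutes A" "q permutes A" "cycle_type_on A p = cycle_type_on A q"
  shows "\<exists>\<sigma>. \<sigma> permutes A \<and> q = \<sigma> \<circ> p \<circ> inv \<sigma>"
proof -
  have "permutation p" "permutation q" using assms permutes_permutation by blast+
  then obtain \<sigma> where \<sigma>: "bij_betw \<sigma> A A" "\<And>z. z \<in> A \<Longrightarrow> \<sigma> (p z) = q (\<sigma> z)"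
    using intertwine[of p q A A] assms permutes_image by blast
  define \<tau> where "\<tau> = perm_restrict \<sigma> A"
  have "bij_betw \<tau> A A"
    using \<sigma>(1) by (rule bij_betw_cong[THEN iffD1, rotated]) (simp add: \<tau>_def perm_restrict_simps)
  then have \<tau>: "\<tau> permutes A" by (rule bij_imp_permutes) (simp add: \<tau>_def perm_restrict_simps)
  have "\<tau> (p z) = q (\<tau> z)" for z
  proof (cases "z \<in> A")
    case True
    then have "p z \<in> A" using assms by (simp add: permutes_in_image)
    then show ?thesis using \<sigma>(2) True by (simp add: \<tau>_def perm_restrict_simps)
  next
    case False
    then have "p z = z" "q z = z" using assms by (auto simp: permutes_def)
    then show ?thesis using False by (simp add: \<tau>_def perm_restrict_simps)
  qed
  then have "q (\<tau> (inv \<tau> z)) = \<tau> (p (inv \<tau> z))" for z by simp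
  then have "q = \<tau> \<circ> p \<circ> inv \<tau>" using permutes_inverses[OF \<tau>] by (auto simp: fun_eq_iff)
  then show ?thesis using \<tau> by blast
qed

lemma cycle_type_on_inv: "finite A \<Longrightarrow> g permutes A \<Longrightarrow> cycle_type_on A (inv g) = cycle_type_on A g"
  by (simp add: cycle_type_on_def orbit_inv_eq permutes_permutation)

section \<open>Averages over Young subgroups\<close>

definition young_group :: "('a \<Rightarrow> nat) \<Rightarrow> 'a set \<Rightarrow> ('a \<Rightarrow> 'a) set" where
  "young_group lab A = {g. g permutes A \<and> (\<forall>k\<in>A. lab (g k) = lab k)}"

lemma young_group_split:
  fixes lab :: "'a \<Rightarrow> nat" and A :: "'a set" and m :: nat
  assumes fin: "finite A"
  defines "A0 \<equiv> {k \<in> A. lab k = m}" and "A1 \<equiv> {k \<in> A. lab k \<noteq> m}"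
  shows "bij_betw (\<lambda>(g, h). g \<circ> h) ({g. g permutes A0} \<times> young_group lab A1) (young_group lab A)"
    and "g permutes A0 \<Longrightarrow> h \<in> young_group lab A1 \<Longrightarrow> cycle_type_on A (g \<circ> h) = cycle_type_on A0 g + cycle_type_on A1 h"
proof -
  have A: "A = A0 \<union> A1" "A0 \<inter> A1 = {}" by (auto simp: A0_def A1_def)
  have appl: "(g \<circ> h) x = (if x \<in> A0 then g x else h x)" if "g permutes A0" "h permutes A1" for g h x
  proof (cases "x \<in> A0")
    case True
    then have "h x = x" using that A by (auto simp: permutes_def)
    then show ?thesis using True by simp
  next
    case False
    then have "h x \<notin> A0" using that A permutes_in_image[OF that(2), of x]
      by (cases "x \<in> A1") (auto simp: permutes_def)
    then show ?thesis using False that by (auto simp: permutes_def)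
  qed
  show "bij_betw (\<lambda>(g, h). g \<circ> h) ({g. g permutes A0} \<times> young_group lab A1) (young_group lab A)"
  proof (rule bij_betw_byWitness[where f' = "\<lambda>f. (perm_restrict f A0, perm_restrict f A1)"])
    show "\<forall>x\<in>{g. g permutes A0} \<times> young_group lab A1.
       (perm_restrict ((\<lambda>(g, h). g \<circ> h) x) A0, perm_restrict ((\<lambda>(g, h). g \<circ> h) x) A1) = x"
    proof clarsimp
      fix g h assume g: "g permutes A0" and "h \<in> young_group lab A1"
      then have h: "h permutes A1" by (simp add: young_group_def)
      have "perm_restrict (g \<circ> h) A0 x = g x" for x
        using appl[OF g h, of x] g by (auto simp: perm_restrict_def permutes_def)
      moreover have "perm_restrict (g \<circ> h) A1 x = h x" for x
        using appl[OF g h, of x] h A(2) by (auto simp: perm_restrict_def permutes_def)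
      ultimately show "perm_restrict (g \<circ> h) A0 = g \<and> perm_restrict (g \<circ> h) A1 = h" by blast
    qed
    have res: "perm_restrict f A0 permutes A0" "perm_restrict f A1 permutes A1" if f: "f \<in> young_group lab A" for f
    proof -
      have f': "inj_on f A'" for A' using f by (auto simp: young_group_def dest: permutes_inj_on)
      have "f ` A0 \<subseteq> A0" "f ` A1 \<subseteq> A1" 
        using f unfolding A0_def A1_def by (auto simp: young_group_def permutes_in_image)
      moreover have "finite A0" "finite A1" using fin by (auto simp: A0_def A1_def)
      ultimately have "f ` A0 = A0" "f ` A1 = A1"
        using f' endo_inj_surj by blast+
      then have "bij_betw f A0 A0" "bij_betw f A1 A1" using f' by (auto simp: bij_betw_def)
      then have "bij_betw (perm_restrict f A0) A0 A0" "bij_betw (perm_restrict f A1) A1 A1"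
        by (auto simp: perm_restrict_simps cong: bij_betw_cong)
      then show "perm_restrict f A0 permutes A0" "perm_restrict f A1 permutes A1"
        by (auto intro!: bij_imp_permutes simp: perm_restrict_simps)
    qed
    show "\<forall>f\<in>young_group lab A. (\<lambda>(g, h). g \<circ> h) (perm_restrict f A0, perm_restrict f A1) = f"
    proof clarsimp
      fix f assume f: "f \<in> young_group lab A"
      then have "f permutes A0 \<union> A1" using A by (simp add: young_group_def)
      then show "perm_restrict f A0 \<circ> perm_restrict f A1 = f"
        using perm_restrict_union[OF res[OF f] A(2)] by simp
    qed
    show "(\<lambda>(g, h). g \<circ> h) ` ({g. g permutes A0} \<times> young_group lab A1) \<subseteq> young_group lab A"
    proof clarsimp
      fix g h assume g: "g permutes A0" and hY: "h \<in> young_group lab A1"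
      then have h: "h permutes A1" by (simp add: young_group_def)
      have "g permutes A" "h permutes A" using g h A by (auto intro: permutes_subset)
      then have "g \<circ> h permutes A" by (rule permutes_compose[rotated])
      moreover have "lab ((g \<circ> h) k) = lab k" if "k \<in> A" for k
      proof (cases "k \<in> A0")
        case True
        then have "g k \<in> A0" using g by (simp add: permutes_in_image)
        then show ?thesis unfolding appl[OF g h] using True by (simp add: A0_def)
      next
        case False
        then have "k \<in> A1" using that A by blast
        then show ?thesis unfolding appl[OF g h] using False hY by (simp add: young_group_def)
      qed
      ultimately show "g \<circ> h \<in> young_group lab A" by (simp add: young_group_def)
    qed
    show "(\<lambda>f. (perm_restrict f A0, perm_restrict f A1)) ` young_group lab A \<subseteq> {g. g permutes A0} \<times> young_group lab A1"
    proof clarsimp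
      fix f assume f: "f \<in> young_group lab A"
      then have "lab (perm_restrict f A1 k) = lab k" if "k \<in> A1" for k
        using that by (auto simp: perm_restrict_simps young_group_def A1_def)
      then show "perm_restrict f A0 permutes A0 \<and> perm_restrict f A1 \<in> young_group lab A1"
        using res[OF f] by (simp add: young_group_def)
    qed
  qed
  assume g: "g permutes A0" and hY: "h \<in> young_group lab A1"
  then have h: "h permutes A1" by (simp add: young_group_def)
  have o0: "orbit (g \<circ> h) x = orbit g x" if "x \<in> A0" for x
    by (rule orbit_cong0[of _ A0]) (use that g appl[OF g h] in \<open>auto simp: permutes_in_image\<close>)
  have o1: "orbit (g \<circ> h) x = orbit h x" if "x \<in> A1" for x
  proof (rule orbit_cong0[of _ A1])
    have *: "(g \<circ> h) y = h y" if "y \<in> A1" for y using appl[OF g h, of y] that A(2) by auto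
    then show "\<And>y. y \<in> A1 \<Longrightarrow> (g \<circ> h) y = h y" .
    show "g \<circ> h \<in> A1 \<rightarrow> A1" using * h by (auto simp: permutes_in_image)
  qed (rule that)
  have "orbit (g \<circ> h) ` A = orbit g ` A0 \<union> orbit h ` A1"
    unfolding A(1) image_Un using o0 o1 by (metis (no_types, lifting) image_cong)
  moreover have "orbit g ` A0 \<inter> orbit h ` A1 = {}"
  proof -
    have "orbit g x \<noteq> orbit h y" if "x \<in> A0" "y \<in> A1" for x y
      using permutes_orbit_subset[OF g that(1)] permutes_orbit_subset[OF h that(2)] A(2) orbit_nonempty[of g x]
      by blast
    then show ?thesis by blast
  qed
  moreover have "finite A0" "finite A1" using fin by (auto simp: A0_def A1_def)
  ultimately show "cycle_type_on A (g \<circ> h) = cycle_type_on A0 g + cycle_type_on A1 h"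
    by (simp add: cycle_type_on_def mset_set_Union)
qed

text \<open>The inner sum on the right is the average of F over S_k acting on k further points. In
  \<open>sum_over_young_group\<close> these points form one level set.\<close>

lemma sum_h_mult:
  "(\<Sum>\<pi>\<in>partitions_of (k + n). h_mult k G \<pi> * F \<pi>)
     = (\<Sum>\<tau>\<in>partitions_of n. G \<tau> * (\<Sum>\<rho>\<in>partitions_of k. F (\<rho> + \<tau>) / real (z_part \<rho>)))"
proof -
  have "(\<Sum>\<pi>\<in>partitions_of (k + n). h_mult k G \<pi> * F \<pi>)
     = (\<Sum>\<pi>\<in>partitions_of (k + n). \<Sum>\<sigma> | \<sigma> \<subseteq># \<pi> \<and> sum_mset \<sigma> = k. 1 / real (z_part \<sigma>) * G (\<pi> - \<sigma>) * F \<pi>)"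
    unfolding conv_def sum_distrib_right
    by (intro sum.cong refl sum.mono_neutral_cong_right) (auto simp: finite_submultisets h_coeff_def)
  also have "\<dots> = (\<Sum>(\<pi>, \<sigma>)\<in>Sigma (partitions_of (k + n)) (\<lambda>\<pi>. {\<sigma>. \<sigma> \<subseteq># \<pi> \<and> sum_mset \<sigma> = k}). 1 / real (z_part \<sigma>) * G (\<pi> - \<sigma>) * F \<pi>)"
    by (subst sum.Sigma) (auto simp: finite_submultisets)
  also have "\<dots> = (\<Sum>(\<tau>, \<rho>)\<in>Sigma (partitions_of n) (\<lambda>_. partitions_of k). G \<tau> * (F (\<rho> + \<tau>) / real (z_part \<rho>)))"
  proof (rule sum.reindex_bij_witness[of _ "\<lambda>(\<tau>, \<rho>). (\<rho> + \<tau>, \<rho>)" "\<lambda>(\<pi>, \<sigma>). (\<pi> - \<sigma>, \<sigma>)"])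
    fix x assume "x \<in> Sigma (partitions_of (k + n)) (\<lambda>\<pi>. {\<sigma>. \<sigma> \<subseteq># \<pi> \<and> sum_mset \<sigma> = k})"
    then obtain \<pi> \<sigma> where x: "x = (\<pi>, \<sigma>)" "\<pi> \<in> partitions_of (k + n)" "\<sigma> \<subseteq># \<pi>" "sum_mset \<sigma> = k" by auto
    then obtain \<tau> where \<tau>: "\<pi> = \<sigma> + \<tau>" by (metis subset_mset.add_diff_inverse)
    show "(case case x of (\<pi>, \<sigma>) \<Rightarrow> (\<pi> - \<sigma>, \<sigma>) of (\<tau>, \<rho>) \<Rightarrow> (\<rho> + \<tau>, \<rho>)) = x"
      "(case x of (\<pi>, \<sigma>) \<Rightarrow> (\<pi> - \<sigma>, \<sigma>)) \<in> Sigma (partitions_of n) (\<lambda>_. partitions_of k)"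
      "(case case x of (\<pi>, \<sigma>) \<Rightarrow> (\<pi> - \<sigma>, \<sigma>) of (\<tau>, \<rho>) \<Rightarrow> G \<tau> * (F (\<rho> + \<tau>) / real (z_part \<rho>))) =
         (case x of (\<pi>, \<sigma>) \<Rightarrow> 1 / real (z_part \<sigma>) * G (\<pi> - \<sigma>) * F \<pi>)"
      using x(2,4) by (auto simp: x(1) \<tau> partitions_of_def is_partition_def)
  qed (auto simp: partitions_of_def is_partition_def)
  also have "\<dots> = (\<Sum>\<tau>\<in>partitions_of n. G \<tau> * (\<Sum>\<rho>\<in>partitions_of k. F (\<rho> + \<tau>) / real (z_part \<rho>)))"
    unfolding sum_distrib_left by (subst sum.Sigma) auto
  finally show ?thesis .
qed

text \<open>The cycle index of a product of symmetric groups is the product of the h of the level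
  sizes. The induction splits off the level set of the smallest label m; empty level sets contribute
  h_0 = 1.\<close>

theorem sum_over_young_group:
  fixes F :: "series"
  assumes "finite A" "\<And>k. k \<in> A \<Longrightarrow> m \<le> lab k \<and> lab k < N"
  shows "(\<Sum>g\<in>young_group lab A. F (cycle_type_on A g)) =
    real (card (young_group lab A)) *
    (\<Sum>\<pi>\<in>partitions_of (card A). h_prod (map (\<lambda>i. card {k \<in> A. lab k = i}) [m..<N]) \<pi> * F \<pi>)"
  using assms
proof (induction "N - m" arbitrary: m A F)
  case 0
  then have "A = {}" by fastforce
  moreover have "young_group lab {} = {id}" by (auto simp: young_group_def)
  ultimately show ?case using 0 by (simp add: cycle_type_on_def partitions_of_0 h_prod_def unit_coeff_def)
next
  case (Suc d)
  let ?A0 = "{k \<in> A. lab k = m}" and ?A1 = "{k \<in> A. lab k \<noteq> m}"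
  note split = young_group_split[OF Suc.prems(1), where lab = lab and m = m]
  have fin: "finite ?A0" "finite ?A1" using Suc.prems by auto
  have cA: "card A = card ?A0 + card ?A1"
  proof -
    have "A = ?A0 \<union> ?A1" by blast
    then show ?thesis using card_Un_disjoint[of ?A0 ?A1] fin by auto
  qed
  have card_eq: "card (young_group lab A) = fact (card ?A0) * card (young_group lab ?A1)"
    using bij_betw_same_card[OF split(1)] card_permutations[OF refl fin(1)] by (simp add: card_cartesian_product)
  define F' where "F' \<tau> = (\<Sum>\<rho>\<in>partitions_of (card ?A0). F (\<rho> + \<tau>) / real (z_part \<rho>))" for \<tau>
  have "(\<Sum>g\<in>young_group lab A. F (cycle_type_on A g))
     = (\<Sum>x\<in>{g. g permutes ?A0} \<times> young_group lab ?A1. F (cycle_type_on A (case x of (g, h) \<Rightarrow> g \<circ> h)))"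
    by (rule sum.reindex_bij_betw[OF split(1), symmetric])
  also have "\<dots> = (\<Sum>(g, h)\<in>{g. g permutes ?A0} \<times> young_group lab ?A1. F (cycle_type_on ?A0 g + cycle_type_on ?A1 h))"
    by (rule sum.cong) (use split(2) in auto)
  also have "\<dots> = (\<Sum>h\<in>young_group lab ?A1. \<Sum>g | g permutes ?A0. F (cycle_type_on ?A0 g + cycle_type_on ?A1 h))"
    unfolding sum.cartesian_product[symmetric] by (rule sum.swap)
  also have "\<dots> = (\<Sum>h\<in>young_group lab ?A1. fact (card ?A0) * F' (cycle_type_on ?A1 h))"
    unfolding F'_def using sum_over_cycle_types[OF fin(1), of "\<lambda>M. F (M + cycle_type_on ?A1 _)"] by simp
  also have "\<dots> = fact (card ?A0) * (\<Sum>h\<in>young_group lab ?A1. F' (cycle_type_on ?A1 h))"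
    by (simp only: sum_distrib_left)
  also have "(\<Sum>h\<in>young_group lab ?A1. F' (cycle_type_on ?A1 h)) = real (card (young_group lab ?A1)) *
     (\<Sum>\<pi>\<in>partitions_of (card ?A1). h_prod (map (\<lambda>i. card {k \<in> ?A1. lab k = i}) [Suc m..<N]) \<pi> * F' \<pi>)"
    by (rule Suc.hyps(1)) (use Suc.hyps(2) Suc.prems in \<open>auto simp: le_neq_implies_less Suc_leI\<close>)
  also have "map (\<lambda>i. card {k \<in> ?A1. lab k = i}) [Suc m..<N] = map (\<lambda>i. card {k \<in> A. lab k = i}) [Suc m..<N]"
    by (rule map_cong) (auto intro!: arg_cong[of _ _ card])
  also have "(\<Sum>\<pi>\<in>partitions_of (card ?A1). h_prod (map (\<lambda>i. card {k \<in> A. lab k = i}) [Suc m..<N]) \<pi> * F' \<pi>)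
     = (\<Sum>\<pi>\<in>partitions_of (card A). h_mult (card ?A0) (h_prod (map (\<lambda>i. card {k \<in> A. lab k = i}) [Suc m..<N])) \<pi> * F \<pi>)"
    unfolding cA F'_def by (rule sum_h_mult[symmetric])
  also have "h_mult (card ?A0) (h_prod (map (\<lambda>i. card {k \<in> A. lab k = i}) [Suc m..<N]))
     = h_prod (map (\<lambda>i. card {k \<in> A. lab k = i}) [m..<N])"
    using Suc.hyps(2) by (simp add: upt_conv_Cons h_prod_def)
  finally show ?case by (simp add: card_eq)
qed

section \<open>Left ideals of the group algebra\<close>

definition ind_sum :: "(nat \<Rightarrow> nat) set \<Rightarrow> galg" where
  "ind_sum S = (\<lambda>g. if g \<in> S then 1 else 0)"

definition sgn_sum :: "(nat \<Rightarrow> nat) set \<Rightarrow> galg" where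
  "sgn_sum S = (\<lambda>g. if g \<in> S then of_int (sign g) else 0)"

definition subgrp :: "nat \<Rightarrow> (nat \<Rightarrow> nat) set \<Rightarrow> bool" where
  "subgrp n S \<longleftrightarrow> S \<subseteq> sym_grp n \<and> id \<in> S \<and> (\<forall>g\<in>S. \<forall>h\<in>S. g \<circ> h \<in> S) \<and> (\<forall>g\<in>S. inv g \<in> S)"

text \<open>A collision makes the sum over C with signs, times h, times the sum over R vanish: inserting the
  transposition changes the sign.\<close>

definition collides :: "(nat \<Rightarrow> nat) set \<Rightarrow> (nat \<Rightarrow> nat) set \<Rightarrow> (nat \<Rightarrow> nat) \<Rightarrow> bool" where
  "collides C R h \<longleftrightarrow> (\<exists>x y. x \<noteq> y \<and> transpose x y \<in> C \<and> inv h \<circ> transpose x y \<circ> h \<in> R)"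

locale sym_algebra =
  fixes n :: nat
begin

abbreviation "G \<equiv> sym_grp n"
abbreviation gm :: "galg \<Rightarrow> galg \<Rightarrow> galg" (infixl "\<star>" 70) where "gm \<equiv> gmult n"
abbreviation "GA \<equiv> group_algebra n"

lemma finite_sym_grp [simp]: "finite G"
  by (simp add: sym_grp_def finite_permutations)

lemma sym_grp_id [simp]: "id \<in> G"
  by (simp add: sym_grp_def permutes_id)

lemma sym_grp_comp [simp]: "g \<in> G \<Longrightarrow> h \<in> G \<Longrightarrow> g \<circ> h \<in> G"
  by (simp add: sym_grp_def permutes_compose)

lemma sym_grp_inv [simp]: "g \<in> G \<Longrightarrow> inv g \<in> G"
  by (simp add: sym_grp_def permutes_inv)

lemma sym_grp_inverse [simp]: "g \<in> G \<Longrightarrow> inv g \<circ> g = id" "g \<in> G \<Longrightarrow> g \<circ> inv g = id"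
  by (auto simp: sym_grp_def permutes_inv_o)

lemma sym_grp_inv_inv [simp]: "g \<in> G \<Longrightarrow> inv (inv g) = g"
  by (auto simp: sym_grp_def permutes_inv_inv)

lemma sym_grp_inv_comp: "g \<in> G \<Longrightarrow> h \<in> G \<Longrightarrow> inv (g \<circ> h) = inv h \<circ> inv g"
  by (auto simp: sym_grp_def intro!: o_inv_distrib dest: permutes_bij)

lemma sym_grp_cancel: 
  "g \<in> G \<Longrightarrow> inv g \<circ> (g \<circ> h) = h" "g \<in> G \<Longrightarrow> g \<circ> (inv g \<circ> h) = h"
  by (simp_all add: o_assoc)

lemma sym_grp_permutation: "g \<in> G \<Longrightarrow> permutation g"
  by (auto simp: sym_grp_def permutation_permutes)

lemma sign_sym_inv: "g \<in> G \<Longrightarrow> sign (inv g) = sign g"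
  by (simp add: sign_inverse sym_grp_permutation)

lemma sign_sym_comp: "g \<in> G \<Longrightarrow> h \<in> G \<Longrightarrow> sign (g \<circ> h) = sign g * sign h"
  by (simp add: sign_compose sym_grp_permutation)

lemma sum_inv: "(\<Sum>h\<in>G. f (inv h)) = (\<Sum>h\<in>G. f h)"
  by (rule sum.reindex_bij_witness[of _ inv inv]) auto

lemma sum_left: "g \<in> G \<Longrightarrow> (\<Sum>h\<in>G. f (g \<circ> h)) = (\<Sum>h\<in>G. f h)"
  by (rule sum.reindex_bij_witness[of _ "\<lambda>h. inv g \<circ> h" "\<lambda>h. g \<circ> h"]) (auto simp: sym_grp_cancel)

lemma sum_conj: "h \<in> G \<Longrightarrow> (\<Sum>g\<in>G. f (inv h \<circ> g \<circ> h)) = (\<Sum>g\<in>G. f g)"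
  by (rule sum.reindex_bij_witness[of _ "\<lambda>g. h \<circ> g \<circ> inv h" "\<lambda>g. inv h \<circ> g \<circ> h"])
     (auto simp: o_assoc[symmetric] sym_grp_cancel)

lemma gmult_apply: "g \<in> G \<Longrightarrow> (x \<star> y) g = (\<Sum>h\<in>G. x h * y (inv h \<circ> g))"
  by (simp add: gmult_def)

lemma gmult_outside: "g \<notin> G \<Longrightarrow> (x \<star> y) g = 0"
  by (simp add: gmult_def)

lemma gmult_GA [simp]: "x \<star> y \<in> GA"
  by (simp add: group_algebra_def gmult_outside)

lemma gmult_assoc: "x \<star> y \<star> z = x \<star> (y \<star> z)"
proof
  fix g
  show "(x \<star> y \<star> z) g = (x \<star> (y \<star> z)) g"
  proof (cases "g \<in> G")
    case True
    have "(x \<star> (y \<star> z)) g = (\<Sum>h\<in>G. x h * (\<Sum>k\<in>G. y k * z (inv k \<circ> (inv h \<circ> g))))"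
      using True by (simp add: gmult_apply)
    also have "\<dots> = (\<Sum>h\<in>G. x h * (\<Sum>m\<in>G. y (inv h \<circ> m) * z (inv m \<circ> g)))"
    proof (rule sum.cong[OF refl])
      fix h assume h: "h \<in> G"
      have "(\<Sum>m\<in>G. y (inv h \<circ> m) * z (inv m \<circ> g))
         = (\<Sum>k\<in>G. y (inv h \<circ> (h \<circ> k)) * z (inv (h \<circ> k) \<circ> g))"
        by (rule sum_left[OF h, symmetric])
      also have "\<dots> = (\<Sum>k\<in>G. y k * z (inv k \<circ> (inv h \<circ> g)))"
        by (rule sum.cong) (auto simp: h sym_grp_cancel sym_grp_inv_comp o_assoc)
      finally show "x h * (\<Sum>k\<in>G. y k * z (inv k \<circ> (inv h \<circ> g))) = x h * (\<Sum>m\<in>G. y (inv h \<circ> m) * z (inv m \<circ> g))"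
        by simp
    qed
    also have "\<dots> = (\<Sum>m\<in>G. \<Sum>h\<in>G. x h * y (inv h \<circ> m) * z (inv m \<circ> g))"
      unfolding sum_distrib_left by (subst sum.swap) (simp add: mult.assoc)
    also have "\<dots> = (x \<star> y \<star> z) g"
      using True by (simp add: gmult_apply sum_distrib_right)
    finally show ?thesis by simp
  qed (simp add: gmult_outside)
qed

lemma gmult_gscale_left: "gscale c x \<star> y = gscale c (x \<star> y)"
  by (rule ext) (simp add: gmult_def gscale_def sum_distrib_left mult.assoc)

lemma gmult_gscale_right: "x \<star> gscale c y = gscale c (x \<star> y)"
  by (rule ext) (simp add: gmult_def gscale_def sum_distrib_left mult_ac)

lemma gmult_sum_left: "(\<Sum>i\<in>I. x i) \<star> y = (\<Sum>i\<in>I. x i \<star> y)"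
proof
  fix g
  show "((\<Sum>i\<in>I. x i) \<star> y) g = (\<Sum>i\<in>I. x i \<star> y) g"
    unfolding sum_fun_apply gmult_def
    by (auto simp: sum_distrib_right sum_fun_apply intro: sum.swap)
qed

lemma gmult_sum_right: "y \<star> (\<Sum>i\<in>I. x i) = (\<Sum>i\<in>I. y \<star> x i)"
proof
  fix g
  show "(y \<star> (\<Sum>i\<in>I. x i)) g = (\<Sum>i\<in>I. y \<star> x i) g"
    unfolding sum_fun_apply gmult_def
    by (auto simp: sum_distrib_left sum_fun_apply intro: sum.swap)
qed

lemma gbasis_left: "g \<in> G \<Longrightarrow> k \<in> G \<Longrightarrow> (gbasis g \<star> x) k = x (inv g \<circ> k)"
proof -
  assume g: "g \<in> G" and k: "k \<in> G"
  have "(gbasis g \<star> x) k = (\<Sum>h\<in>G. if h = g then x (inv h \<circ> k) else 0)"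
    unfolding gmult_apply[OF k] by (rule sum.cong) (auto simp: gbasis_def)
  then show ?thesis using g by simp
qed

lemma gbasis_right: "g \<in> G \<Longrightarrow> k \<in> G \<Longrightarrow> (x \<star> gbasis g) k = x (k \<circ> inv g)"
proof -
  assume g: "g \<in> G" and k: "k \<in> G"
  have *: "(inv h \<circ> k = g) \<longleftrightarrow> (h = k \<circ> inv g)" if "h \<in> G" for h
  proof
    assume "inv h \<circ> k = g"
    then have "k = h \<circ> g" using that sym_grp_cancel(2) by metis
    then show "h = k \<circ> inv g" using g by (simp add: o_assoc[symmetric])
  next
    assume "h = k \<circ> inv g"
    then show "inv h \<circ> k = g" using g k by (simp add: sym_grp_inv_comp o_assoc[symmetric])
  qed
  have "(x \<star> gbasis g) k = (\<Sum>h\<in>G. if h = k \<circ> inv g then x h else 0)"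
    unfolding gmult_apply[OF k] by (rule sum.cong) (auto simp: gbasis_def *)
  then show ?thesis using g k by simp
qed

lemma gbasis_mult: "g \<in> G \<Longrightarrow> h \<in> G \<Longrightarrow> gbasis g \<star> gbasis h = gbasis (g \<circ> h)"
proof
  fix k assume g: "g \<in> G" "h \<in> G"
  show "(gbasis g \<star> gbasis h) k = gbasis (g \<circ> h) k"
  proof (cases "k \<in> G")
    case True
    have "(inv g \<circ> k = h) \<longleftrightarrow> (k = g \<circ> h)"
      using g sym_grp_cancel[OF g(1)] by metis
    then show ?thesis using g True by (simp add: gbasis_left) (simp add: gbasis_def)
  next
    case False
    then show ?thesis using g by (auto simp: gmult_outside gbasis_def)
  qed
qed

lemma GA_expand: "x \<in> GA \<Longrightarrow> x = (\<Sum>h\<in>G. gscale (x h) (gbasis h))"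
proof
  fix g assume "x \<in> GA"
  then show "x g = (\<Sum>h\<in>G. gscale (x h) (gbasis h)) g"
    by (auto simp: sum_fun_apply gscale_def gbasis_def group_algebra_def if_distrib cong: if_cong)
qed

text \<open>Up to the factor n!, the trace of left multiplication on the whole group algebra; hence
  its invariance under cyclic rotation.\<close>

definition tr :: "galg \<Rightarrow> complex" where
  "tr x = x id"

lemma tr_gmult: "tr (x \<star> y) = (\<Sum>h\<in>G. x h * y (inv h))"
  unfolding tr_def gmult_apply[OF sym_grp_id] by (rule sum.cong) (auto simp: comp_def id_def)

lemma tr_gscale: "tr (gscale c x) = c * tr x"
  by (simp add: tr_def gscale_def)

lemma tr_commute: "tr (x \<star> y) = tr (y \<star> x)"
proof -
  have "tr (x \<star> y) = (\<Sum>h\<in>G. x (inv h) * y (inv (inv h)))" unfolding tr_gmult by (rule sum_inv[symmetric])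
  then show ?thesis by (simp add: tr_gmult mult.commute)
qed

text \<open>The linear anti-automorphism inverting each permutation, without complex conjugation. It
  turns statements about b a into statements about a b.\<close>

definition gstar :: "galg \<Rightarrow> galg" where
  "gstar x = (\<lambda>g. if g \<in> G then x (inv g) else 0)"

lemma gstar_gmult: "gstar (x \<star> y) = gstar y \<star> gstar x"
proof
  fix g
  show "gstar (x \<star> y) g = (gstar y \<star> gstar x) g"
  proof (cases "g \<in> G")
    case True
    have "gstar (x \<star> y) g = (\<Sum>h\<in>G. x h * y (inv h \<circ> inv g))" using True by (simp add: gstar_def gmult_apply)
    also have "\<dots> = (\<Sum>h\<in>G. x (inv g \<circ> h) * y (inv (inv g \<circ> h) \<circ> inv g))"
      using sum_left[of "inv g" "\<lambda>h. x h * y (inv h \<circ> inv g)"] True by simp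
    also have "\<dots> = (\<Sum>h\<in>G. x (inv g \<circ> h) * y (inv h))"
      by (rule sum.cong) (use True in \<open>auto simp: sym_grp_inv_comp o_assoc[symmetric]\<close>)
    also have "\<dots> = (\<Sum>h\<in>G. gstar y h * gstar x (inv h \<circ> g))"
      by (rule sum.cong) (use True in \<open>auto simp: gstar_def sym_grp_inv_comp\<close>)
    also have "\<dots> = (gstar y \<star> gstar x) g" using True by (simp add: gmult_apply)
    finally show ?thesis .
  qed (simp add: gstar_def gmult_outside)
qed

lemma gstar_gbasis: "g \<in> G \<Longrightarrow> gstar (gbasis g) = gbasis (inv g)"
  by (rule ext) (auto simp: gstar_def gbasis_def)

lemma gstar_gscale: "gstar (gscale c x) = gscale c (gstar x)"
  by (rule ext) (auto simp: gstar_def gscale_def)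

text \<open>Since P projects onto V, the trace of f on V is the trace of f P on the group algebra,
  which can be read off in the basis of permutations. This removes the dependence on the basis
  selected by \<open>SOME\<close>.\<close>

lemma trace_on_projection:
  assumes V: "galg.subspace V" "V \<subseteq> GA"
    and Plin: "\<And>c x. P (\<Sum>h\<in>G. gscale (c h) (x h)) = (\<Sum>h\<in>G. gscale (c h) (P (x h)))"
    and PV: "\<And>x. x \<in> GA \<Longrightarrow> P x \<in> V" and Pid: "\<And>v. v \<in> V \<Longrightarrow> P v = v"
    and flin: "\<And>(B :: galg set) c. finite B \<Longrightarrow> f (\<Sum>b\<in>B. gscale (c b) b) = (\<Sum>b\<in>B. gscale (c b) (f b))"
    and fV: "\<And>v. v \<in> V \<Longrightarrow> f v \<in> V"
  shows "trace_on V f = (\<Sum>h\<in>G. f (P (gbasis h)) h)"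
proof -
  define B where "B = (SOME B. galg.independent B \<and> galg.span B = V)"
  obtain B' where "B' \<subseteq> V" "galg.independent B'" "V \<subseteq> galg.span B'"
    using galg.maximal_independent_subset[of V] by auto
  then have "galg.independent B' \<and> galg.span B' = V"
    using V(1) galg.span_subspace by blast
  then have B: "galg.independent B" "galg.span B = V"
    unfolding B_def using someI_ex[of "\<lambda>B. galg.independent B \<and> galg.span B = V"] by auto
  have BV: "B \<subseteq> V" using B(2) galg.span_superset by blast
  have "B \<subseteq> galg.span (gbasis ` G)"
  proof
    fix b assume "b \<in> B"
    then have "b \<in> GA" using BV V(2) by blast
    then have "b = (\<Sum>h\<in>G. gscale (b h) (gbasis h))" by (rule GA_expand)
    moreover have "(\<Sum>h\<in>G. gscale (b h) (gbasis h)) \<in> galg.span (gbasis ` G)"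
      by (intro galg.span_sum galg.span_scale galg.span_base) auto
    ultimately show "b \<in> galg.span (gbasis ` G)" by simp
  qed
  then have fin: "finite B"
    using galg.independent_span_bound[of "gbasis ` G" B] B(1) by simp
  let ?r = "galg.representation B"
  have rep: "v = (\<Sum>b\<in>B. gscale (?r v b) b)" if "v \<in> V" for v
    using galg.sum_representation_eq[OF B(1) _ fin subset_refl, of v] that B(2) by simp
  have r_sum: "?r (\<Sum>h\<in>G. gscale (c h) (x h)) b = (\<Sum>h\<in>G. c h * ?r (x h) b)" if "\<And>h. h \<in> G \<Longrightarrow> x h \<in> V" for c x b
  proof -
    have "?r (\<Sum>h\<in>G. gscale (c h) (x h)) = (\<lambda>b. \<Sum>h\<in>G. ?r (gscale (c h) (x h)) b)"
      by (rule galg.representation_sum[OF B(1)]) (use that B(2) in \<open>auto intro: galg.span_scale\<close>)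
    then have "?r (\<Sum>h\<in>G. gscale (c h) (x h)) b = (\<Sum>h\<in>G. ?r (gscale (c h) (x h)) b)" by simp
    also have "\<dots> = (\<Sum>h\<in>G. c h * ?r (x h) b)"
      by (rule sum.cong) (use that B in \<open>auto simp: galg.representation_scale\<close>)
    finally show ?thesis .
  qed
  have "(\<Sum>h\<in>G. f (P (gbasis h)) h) = (\<Sum>h\<in>G. \<Sum>b\<in>B. ?r (P (gbasis h)) b * f b h)"
  proof (rule sum.cong[OF refl])
    fix h assume "h \<in> G"
    then have "gbasis h \<in> GA" by (auto simp: gbasis_def group_algebra_def)
    then have "P (gbasis h) = (\<Sum>b\<in>B. gscale (?r (P (gbasis h)) b) b)" using PV rep by blast
    then have "f (P (gbasis h)) = (\<Sum>b\<in>B. gscale (?r (P (gbasis h)) b) (f b))"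
      using flin[OF fin, of "?r (P (gbasis h))"] by simp
    then show "f (P (gbasis h)) h = (\<Sum>b\<in>B. ?r (P (gbasis h)) b * f b h)"
      by (simp add: sum_fun_apply gscale_def)
  qed
  also have "\<dots> = (\<Sum>b\<in>B. \<Sum>h\<in>G. f b h * ?r (P (gbasis h)) b)"
    by (subst sum.swap) (simp add: mult.commute)
  also have "\<dots> = (\<Sum>b\<in>B. ?r (f b) b)"
  proof (rule sum.cong[OF refl])
    fix b assume "b \<in> B"
    then have fb: "f b \<in> V" using fV BV by blast
    have "(\<Sum>h\<in>G. f b h * ?r (P (gbasis h)) b) = ?r (\<Sum>h\<in>G. gscale (f b h) (P (gbasis h))) b"
      by (rule r_sum[symmetric]) (auto intro!: PV simp: gbasis_def group_algebra_def)
    also have "(\<Sum>h\<in>G. gscale (f b h) (P (gbasis h))) = P (f b)"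
      unfolding Plin[symmetric] using GA_expand[of "f b"] fb V(2) by auto
    finally show "(\<Sum>h\<in>G. f b h * ?r (P (gbasis h)) b) = ?r (f b) b" using Pid[OF fb] by simp
  qed
  finally show ?thesis unfolding trace_on_def B_def[symmetric] Let_def by simp
qed

text \<open>As y / c is idempotent, right multiplication by it is a projection onto the left ideal,
  and the trace can be computed by \<open>trace_on_projection\<close>.\<close>

lemma trace_left_ideal:
  assumes yy: "y \<star> y = gscale c y" and c: "c \<noteq> 0" and g: "g \<in> G"
  shows "trace_on {x \<star> y | x. x \<in> GA} (gmult n (gbasis g))
    = (\<Sum>h\<in>G. y (inv h \<circ> inv g \<circ> h)) / c"
proof -
  let ?V = "{x \<star> y | x. x \<in> GA}" and ?P = "\<lambda>x. gscale (1 / c) (x \<star> y)"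
  have GA_scale: "gscale d x \<in> GA" if "x \<in> GA" for d x using that by (auto simp: group_algebra_def gscale_def)
  have scale_P: "gscale d (x \<star> y) \<in> ?V" if "x \<in> GA" for d x
    using GA_scale[OF that, of d] gmult_gscale_left[of d x y, symmetric] by blast
  have "trace_on ?V (gmult n (gbasis g)) = (\<Sum>h\<in>G. (gbasis g \<star> ?P (gbasis h)) h)"
  proof (rule trace_on_projection)
    show "galg.subspace ?V"
    proof (rule galg.subspaceI)
      have "0 \<in> GA" by (simp add: group_algebra_def)
      moreover have "0 \<star> y = 0" by (rule ext) (simp add: gmult_def)
      ultimately show "0 \<in> ?V" by (metis (mono_tags, lifting) mem_Collect_eq)
    next
      fix u v assume "u \<in> ?V" "v \<in> ?V"
      then obtain x x' where x: "u = x \<star> y" "v = x' \<star> y" "x \<in> GA" "x' \<in> GA" by blast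
      have "u + v = (x + x') \<star> y" unfolding x
        by (rule ext) (simp add: gmult_def distrib_right sum.distrib)
      moreover have "x + x' \<in> GA" using x by (simp add: group_algebra_def)
      ultimately show "u + v \<in> ?V" by blast
    qed (use scale_P in blast)
    show "?V \<subseteq> GA" by auto
    show "?P x \<in> ?V" if "x \<in> GA" for x using scale_P that by blast
    show "?P v = v" if v: "v \<in> ?V" for v
    proof -
      from v obtain x where x: "v = x \<star> y" by blast
      show ?thesis unfolding x
        by (simp only: gmult_assoc yy gmult_gscale_right galg.scale_scale) (simp add: c)
    qed
    show "gbasis g \<star> v \<in> ?V" if v: "v \<in> ?V" for v
    proof -
      from v obtain x where x: "v = x \<star> y" by blast
      show ?thesis unfolding x gmult_assoc[symmetric]
        by (intro CollectI exI[of _ "gbasis g \<star> x"] conjI refl gmult_GA)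
    qed
  next
    fix d :: "(nat \<Rightarrow> nat) \<Rightarrow> complex" and x :: "(nat \<Rightarrow> nat) \<Rightarrow> galg"
    show "?P (\<Sum>h\<in>G. gscale (d h) (x h)) = (\<Sum>h\<in>G. gscale (d h) (?P (x h)))"
      unfolding gmult_sum_left gmult_gscale_left galg.scale_sum_right by (simp add: mult.commute)
  next
    fix B :: "galg set" and d
    show "gbasis g \<star> (\<Sum>b\<in>B. gscale (d b) b) = (\<Sum>b\<in>B. gscale (d b) (gbasis g \<star> b))"
      unfolding gmult_sum_right gmult_gscale_right ..
  qed
  also have "\<dots> = (\<Sum>h\<in>G. y (inv h \<circ> inv g \<circ> h) / c)"
  proof (rule sum.cong[OF refl])
    fix h assume h: "h \<in> G"
    have "(gbasis g \<star> ?P (gbasis h)) h = ?P (gbasis h) (inv g \<circ> h)" using g h by (rule gbasis_left)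
    also have "\<dots> = y (inv h \<circ> (inv g \<circ> h)) / c"
      using g h by (simp add: gscale_def gbasis_left)
    finally show "(gbasis g \<star> ?P (gbasis h)) h = y (inv h \<circ> inv g \<circ> h) / c" by (simp add: o_assoc)
  qed
  finally show ?thesis by (simp add: sum_divide_distrib)
qed

section \<open>Absorption of group elements and collisions\<close>

lemma ind_sum_absorb:
  assumes "subgrp n S" "t \<in> S"
  shows "gbasis t \<star> ind_sum S = ind_sum S"
proof
  fix k
  have t: "t \<in> sym_grp n" and sub: "S \<subseteq> sym_grp n" using assms by (auto simp: subgrp_def)
  have "inv t \<circ> k \<in> S \<longleftrightarrow> k \<in> S"
    using assms sym_grp_cancel[OF t] unfolding subgrp_def by metis
  then show "(gbasis t \<star> ind_sum S) k = ind_sum S k"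
    using t sub by (cases "k \<in> sym_grp n") (auto simp: gbasis_left gmult_outside ind_sum_def)
qed

lemma sgn_sum_absorb:
  assumes "subgrp n S" "t \<in> S"
  shows "sgn_sum S \<star> gbasis t = gscale (of_int (sign t)) (sgn_sum S)"
proof
  fix k
  have t: "t \<in> sym_grp n" and sub: "S \<subseteq> sym_grp n" using assms by (auto simp: subgrp_def)
  show "(sgn_sum S \<star> gbasis t) k = gscale (of_int (sign t)) (sgn_sum S) k"
  proof (cases "k \<in> sym_grp n")
    case True
    have "k \<circ> inv t \<in> S \<longleftrightarrow> k \<in> S"
    proof
      assume "k \<circ> inv t \<in> S"
      then have "k \<circ> inv t \<circ> t \<in> S" using assms by (auto simp: subgrp_def)
      then show "k \<in> S" using t by (simp add: o_assoc[symmetric])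
    qed (use assms in \<open>auto simp: subgrp_def\<close>)
    then show ?thesis
      using True t by (simp add: gbasis_right sgn_sum_def gscale_def sign_sym_comp sign_sym_inv mult.commute)
  next
    case False
    then show ?thesis using sub by (auto simp: gmult_outside sgn_sum_def gscale_def)
  qed
qed

lemma collision_zero:
  assumes C: "subgrp n C" and R: "subgrp n R" and h: "h \<in> sym_grp n" and col: "collides C R h"
  shows "sgn_sum C \<star> gbasis h \<star> ind_sum R = 0"
proof -
  obtain x y where xy: "x \<noteq> y" "transpose x y \<in> C" "inv h \<circ> transpose x y \<circ> h \<in> R"
    using col by (auto simp: collides_def)
  let ?t = "transpose x y"
  have t: "?t \<in> sym_grp n" and t': "inv h \<circ> ?t \<circ> h \<in> sym_grp n"
    using C R xy by (auto simp: subgrp_def)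
  have "sgn_sum C \<star> gbasis h \<star> ind_sum R = sgn_sum C \<star> gbasis h \<star> (gbasis (inv h \<circ> ?t \<circ> h) \<star> ind_sum R)"
    using ind_sum_absorb[OF R xy(3)] by simp
  also have "\<dots> = sgn_sum C \<star> (gbasis h \<star> gbasis (inv h \<circ> ?t \<circ> h)) \<star> ind_sum R"
    by (simp add: gmult_assoc)
  also have "gbasis h \<star> gbasis (inv h \<circ> ?t \<circ> h) = gbasis ?t \<star> gbasis h"
    using h t t' by (simp add: gbasis_mult sym_grp_cancel o_assoc[symmetric])
  also have "sgn_sum C \<star> (gbasis ?t \<star> gbasis h) \<star> ind_sum R = sgn_sum C \<star> gbasis ?t \<star> gbasis h \<star> ind_sum R"
    by (simp add: gmult_assoc)
  also have "\<dots> = gscale (- 1) (sgn_sum C \<star> gbasis h \<star> ind_sum R)"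
    using xy(1) by (simp only: sgn_sum_absorb[OF C xy(2)] gmult_gscale_left sign_swap_id if_False of_int_minus of_int_1)
  finally have eq: "sgn_sum C \<star> gbasis h \<star> ind_sum R = gscale (- 1) (sgn_sum C \<star> gbasis h \<star> ind_sum R)" .
  show ?thesis
  proof
    fix g
    have "(sgn_sum C \<star> gbasis h \<star> ind_sum R) g = - (sgn_sum C \<star> gbasis h \<star> ind_sum R) g"
      using fun_cong[OF eq, of g] by (simp add: gscale_def)
    then show "(sgn_sum C \<star> gbasis h \<star> ind_sum R) g = 0 g" by simp
  qed
qed

end

text \<open>Isolates what the theory of Young symmetrizers takes from tableaux: the row and column
  groups meet trivially, and a permutation outside C R always has a collision.\<close>

locale young = sym_algebra n for n :: nat +
  fixes R C :: "(nat \<Rightarrow> nat) set"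
  assumes R: "subgrp n R" and C: "subgrp n C" and RC: "R \<inter> C = {id}"
    and dichotomy: "\<And>h. h \<in> sym_grp n \<Longrightarrow> (\<exists>c\<in>C. \<exists>r\<in>R. h = c \<circ> r) \<or> collides C R h"
begin

abbreviation "a \<equiv> ind_sum R"
abbreviation "b \<equiv> sgn_sum C"
abbreviation "y \<equiv> a \<star> b"
text \<open>The only candidate for c in y y = c y, because y has coefficient 1 at the
  identity.\<close>

abbreviation "cst \<equiv> tr (y \<star> y)"

lemma sub: "R \<subseteq> G" "C \<subseteq> G" using R C by (auto simp: subgrp_def)

lemma finite_C: "finite C" and finite_R: "finite R"
  using sub finite_subset[OF _ finite_sym_grp] by auto

lemma card_C: "card C > 0"
  using C finite_C by (auto simp: subgrp_def card_gt_0_iff)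

lemma b_expand: "b = (\<Sum>c\<in>C. gscale (of_int (sign c)) (gbasis c))"
  by (rule ext) (use finite_C in \<open>simp add: sum_fun_apply sgn_sum_def gscale_def gbasis_def if_distrib cong: if_cong\<close>)

lemma a_expand: "a = (\<Sum>r\<in>R. gbasis r)"
  by (rule ext) (use finite_R in \<open>simp add: sum_fun_apply ind_sum_def gbasis_def if_distrib cong: if_cong\<close>)

lemma gstar_a: "gstar a = a"
proof
  fix g
  have "inv g \<in> R \<longleftrightarrow> g \<in> R" if "g \<in> G"
    using R that unfolding subgrp_def by (metis sym_grp_inv_inv)
  then show "gstar a g = a g"
    using sub by (auto simp: gstar_def ind_sum_def)
qed

lemma gstar_b: "gstar b = b"
proof
  fix g
  have "inv g \<in> C \<longleftrightarrow> g \<in> C" if "g \<in> G"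
    using C that unfolding subgrp_def by (metis sym_grp_inv_inv)
  then show "gstar b g = b g"
    using sub by (auto simp: gstar_def sgn_sum_def sign_sym_inv)
qed

lemma gstar_y: "gstar y = b \<star> a"
  by (simp add: gstar_gmult gstar_a gstar_b)

lemma ba_inv: "h \<in> G \<Longrightarrow> (b \<star> a) h = y (inv h)"
  using fun_cong[OF gstar_y, of h] by (simp add: gstar_def)

lemma bb: "b \<star> b = gscale (of_nat (card C)) b"
proof -
  have "b \<star> b = (\<Sum>c\<in>C. gscale (of_int (sign c)) (b \<star> gbasis c))"
    by (subst (2) b_expand) (simp add: gmult_sum_right gmult_gscale_right)
  also have "\<dots> = (\<Sum>c\<in>C. b)"
  proof (rule sum.cong[OF refl])
    fix c assume "c \<in> C"
    then show "gscale (of_int (sign c)) (b \<star> gbasis c) = b"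
      using sgn_sum_absorb[OF C, of c]
      by (simp add: gscale_def fun_eq_iff mult.assoc[symmetric] of_int_mult[symmetric] del: of_int_mult)
  qed
  finally show ?thesis by (simp add: gscale_def fun_eq_iff sum_fun_apply)
qed

text \<open>A trivial intersection makes the factorization c r unique, so a single term of the
  convolution survives.\<close>

lemma ba_value:
  assumes c: "c \<in> C" and r: "r \<in> R"
  shows "(b \<star> a) (c \<circ> r) = of_int (sign c)"
proof -
  have cG: "c \<in> G" and rG: "r \<in> G" using c r sub by auto
  have "(b \<star> a) (c \<circ> r) = (\<Sum>h\<in>G. if h = c then of_int (sign c) else 0)"
    unfolding gmult_apply[OF sym_grp_comp[OF cG rG]]
  proof (rule sum.cong[OF refl])
    fix h assume h: "h \<in> G"
    show "b h * a (inv h \<circ> (c \<circ> r)) = (if h = c then of_int (sign c) else 0)"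
    proof (cases "h \<in> C \<and> inv h \<circ> (c \<circ> r) \<in> R")
      case True
      then have "inv h \<circ> (c \<circ> r) \<circ> inv r \<in> R" using R r by (auto simp: subgrp_def)
      then have "inv h \<circ> c \<in> R" using rG by (simp add: o_assoc[symmetric])
      moreover have "inv h \<circ> c \<in> C" using C True c by (auto simp: subgrp_def)
      ultimately have "inv h \<circ> c = id" using RC by blast
      then have "h = c" using sym_grp_cancel(2)[OF h, of c] by simp
      then show ?thesis using True by (simp add: sgn_sum_def ind_sum_def)
    next
      case False
      moreover have "inv c \<circ> (c \<circ> r) = r" using cG by (rule sym_grp_cancel)
      ultimately have "h \<noteq> c" using c r by auto
      then show ?thesis using False by (auto simp: sgn_sum_def ind_sum_def)
    qed
  qed
  then show ?thesis using cG by simp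
qed

text \<open>If h = c r, then b absorbs c with its sign and a absorbs r. Otherwise a collision
  annihilates the left side, and the coefficient on the right vanishes because b a is supported on C
  R.\<close>

lemma b_h_a:
  assumes h: "h \<in> G"
  shows "b \<star> gbasis h \<star> a = gscale ((b \<star> a) h) (b \<star> a)"
proof (cases "\<exists>c\<in>C. \<exists>r\<in>R. h = c \<circ> r")
  case True
  then obtain c r where cr: "c \<in> C" "r \<in> R" "h = c \<circ> r" by auto
  then have G: "c \<in> G" "r \<in> G" using sub by auto
  have "b \<star> gbasis h \<star> a = (b \<star> gbasis c) \<star> (gbasis r \<star> a)"
    using G by (simp add: cr(3) gbasis_mult[symmetric] gmult_assoc)
  also have "\<dots> = gscale (of_int (sign c)) (b \<star> a)"
    by (simp add: sgn_sum_absorb[OF C cr(1)] ind_sum_absorb[OF R cr(2)] gmult_gscale_left)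
  finally show ?thesis using ba_value[OF cr(1,2)] cr(3) by simp
next
  case False
  then have "collides C R h" using dichotomy[OF h] by blast
  then have 1: "b \<star> gbasis h \<star> a = 0" using collision_zero[OF C R h] by blast
  have "(b \<star> a) h = 0"
    unfolding gmult_apply[OF h]
  proof (rule sum.neutral, rule ballI)
    fix k assume k: "k \<in> G"
    have "h = k \<circ> (inv k \<circ> h)" using sym_grp_cancel(2)[OF k, of h] by simp
    then show "b k * a (inv k \<circ> h) = 0" using False by (auto simp: sgn_sum_def ind_sum_def)
  qed
  then show ?thesis using 1 by (simp add: gscale_def fun_eq_iff)
qed

lemma a_h_b:
  assumes h: "h \<in> G"
  shows "a \<star> gbasis h \<star> b = gscale (y h) y"
proof -
  have "gstar (b \<star> gbasis (inv h) \<star> a) = gstar (gscale ((b \<star> a) (inv h)) (b \<star> a))"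
    using b_h_a[of "inv h"] h by simp
  then show ?thesis
    using h by (simp add: gstar_gmult gstar_a gstar_b gstar_gbasis gstar_gscale ba_inv gmult_assoc)
qed

lemma a_x_b:
  assumes "x \<in> group_algebra n"
  shows "a \<star> x \<star> b = gscale (tr (x \<star> (b \<star> a))) y"
proof -
  have "a \<star> x \<star> b = (\<Sum>h\<in>G. gscale (x h) (a \<star> gbasis h \<star> b))"
    by (subst GA_expand[OF assms]) (simp add: gmult_sum_left gmult_sum_right gmult_gscale_left gmult_gscale_right)
  also have "\<dots> = (\<Sum>h\<in>G. gscale (x h) (gscale (y h) y))"
    by (rule sum.cong) (simp_all add: a_h_b)
  also have "\<dots> = gscale (\<Sum>h\<in>G. x h * y h) y"
    by (simp add: galg.scale_sum_left)
  also have "(\<Sum>h\<in>G. x h * y h) = tr (x \<star> (b \<star> a))"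
    by (simp add: tr_gmult ba_inv)
  finally show ?thesis .
qed

lemma trace_rotate: "tr (b \<star> x) = tr (x \<star> b)" by (rule tr_commute)

lemma yy: "y \<star> y = gscale cst y"
proof -
  have "y \<star> y = a \<star> (b \<star> a) \<star> b" by (simp add: gmult_assoc)
  also have "\<dots> = gscale (tr ((b \<star> a) \<star> (b \<star> a))) y" by (rule a_x_b) simp
  also have "tr ((b \<star> a) \<star> (b \<star> a)) = tr (b \<star> (a \<star> b \<star> a))" by (simp add: gmult_assoc)
  also have "\<dots> = cst" unfolding trace_rotate by (simp add: gmult_assoc)
  finally show ?thesis .
qed

lemma real_y: "y g \<in> \<real>" and real_bab: "(b \<star> a \<star> b) g \<in> \<real>"
proof -
  have r: "(u \<star> v) g \<in> \<real>" if "\<And>g. u g \<in> \<real>" "\<And>g. v g \<in> \<real>" for u v g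
    using that by (auto simp: gmult_def)
  have "a g \<in> \<real>" "b g \<in> \<real>" for g by (auto simp: ind_sum_def sgn_sum_def)
  then show "y g \<in> \<real>" "(b \<star> a \<star> b) g \<in> \<real>" by (auto intro!: r)
qed

text \<open>Ties \<open>cst\<close> to the square of the symmetric element b a b, by cyclic rotation
  and b b = |C| b.\<close>

lemma cst_trace_bab: "tr ((b \<star> a \<star> b) \<star> (b \<star> a \<star> b)) = of_nat (card C) * (of_nat (card C) * cst)"
proof -
  have "tr ((b \<star> a \<star> b) \<star> (b \<star> a \<star> b)) = tr (b \<star> a \<star> (b \<star> b) \<star> a \<star> b)" by (simp add: gmult_assoc)
  also have "\<dots> = of_nat (card C) * tr (b \<star> (a \<star> b \<star> a \<star> b))"
    unfolding bb by (simp add: gmult_gscale_right gmult_gscale_left gmult_assoc tr_gscale)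
  also have "tr (b \<star> (a \<star> b \<star> a \<star> b)) = tr (a \<star> b \<star> a \<star> (b \<star> b))"
    unfolding trace_rotate by (simp add: gmult_assoc)
  also have "\<dots> = of_nat (card C) * cst"
    unfolding bb by (simp add: gmult_gscale_right gmult_assoc tr_gscale)
  finally show ?thesis .
qed

lemma bab_id: "tr (b \<star> a \<star> b) = of_nat (card C)"
proof -
  have "tr (b \<star> a \<star> b) = tr (b \<star> (a \<star> b))" by (simp add: gmult_assoc)
  also have "\<dots> = tr (a \<star> (b \<star> b))" unfolding trace_rotate by (simp add: gmult_assoc)
  also have "\<dots> = of_nat (card C) * tr y" unfolding bb by (simp add: gmult_gscale_right tr_gscale)
  also have "tr y = tr (b \<star> a)" by (rule tr_commute)
  also have "\<dots> = 1" using ba_value[of id id] R C by (simp add: subgrp_def tr_def)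
  finally show ?thesis by simp
qed

text \<open>The element b a b is fixed by the involution g -> g^-1, so its square has trace equal to the sum of its
  squared coefficients.\<close>

lemma cst_nonzero: "cst \<noteq> 0"
proof
  assume "cst = 0"
  let ?w = "b \<star> a \<star> b"
  have "gstar ?w = ?w" by (simp add: gstar_gmult gstar_a gstar_b gmult_assoc)
  then have sym: "?w (inv h) = ?w h" if "h \<in> G" for h
  proof -
    have "gstar ?w h = ?w (inv h)" using that unfolding gstar_def by (rule if_P)
    then show ?thesis unfolding \<open>gstar ?w = ?w\<close> by simp
  qed
  have "(\<Sum>h\<in>G. ?w h * ?w h) = tr (?w \<star> ?w)"
    unfolding tr_gmult by (rule sum.cong) (simp_all only: sym)
  \<comment> \<open>All coefficients of w are real, so the vanishing of the sum of their squares
    makes each of them 0; but w has coefficient |C| at the identity.\<close>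
  also have "\<dots> = 0" unfolding cst_trace_bab using \<open>cst = 0\<close> by simp
  finally have "(\<Sum>h\<in>G. Re (?w h) * Re (?w h)) = 0"
  proof -
    assume 0: "(\<Sum>h\<in>G. ?w h * ?w h) = 0"
    have "(\<Sum>h\<in>G. Re (?w h) * Re (?w h)) = Re (\<Sum>h\<in>G. ?w h * ?w h)"
      using real_bab by (auto simp: complex_is_Real_iff intro!: sum.cong)
    then show ?thesis unfolding 0 by simp
  qed
  then have "Re (?w id) * Re (?w id) = 0"
    by (subst (asm) sum_nonneg_eq_0_iff) auto
  then have "Re (tr ?w) = 0" by (simp only: tr_def mult_eq_0_iff disj_absorb)
  then show False unfolding bab_id using card_C by simp
qed

section \<open>The character of the left ideal and its pairings\<close>

definition chr :: "(nat \<Rightarrow> nat) \<Rightarrow> complex" where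
  "chr g = (\<Sum>h\<in>G. y (inv h \<circ> inv g \<circ> h)) / cst"

lemma trace_specht:
  "g \<in> G \<Longrightarrow> trace_on {x \<star> y | x. x \<in> group_algebra n} (gmult n (gbasis g)) = chr g"
  unfolding chr_def by (rule trace_left_ideal[OF yy cst_nonzero])

lemma real_cst: "cst \<in> \<real>"
  unfolding tr_gmult by (intro sum_in_Reals Reals_mult real_y)

lemma real_chr: "chr g \<in> \<real>"
  unfolding chr_def by (intro Reals_divide real_cst sum_in_Reals real_y)

lemma chr_conj:
  assumes "k \<in> G" "g \<in> G"
  shows "chr (k \<circ> g \<circ> inv k) = chr g"
proof -
  have "(\<Sum>h\<in>G. y (inv h \<circ> inv (k \<circ> g \<circ> inv k) \<circ> h))
      = (\<Sum>h\<in>G. y (inv (inv k \<circ> h) \<circ> inv g \<circ> (inv k \<circ> h)))"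
    by (rule sum.cong) (use assms in \<open>auto simp: sym_grp_inv_comp o_assoc\<close>)
  also have "\<dots> = (\<Sum>h\<in>G. y (inv h \<circ> inv g \<circ> h))"
    using sum_left[of "inv k" "\<lambda>h. y (inv h \<circ> inv g \<circ> h)"] assms by simp
  finally show ?thesis by (simp add: chr_def)
qed

text \<open>Against a class function the conjugations by h in \<open>chr\<close> have no effect, so
  each h contributes the same sum. A pairing of two characters becomes a pairing of one with a Young
  symmetrizer.\<close>

lemma sum_class_chr:
  assumes F: "\<And>g h. g \<in> G \<Longrightarrow> h \<in> G \<Longrightarrow> F (h \<circ> g \<circ> inv h) = F g"
    and Finv: "\<And>g. g \<in> G \<Longrightarrow> F (inv g) = F g"
  shows "(\<Sum>g\<in>G. F g * chr g) = of_nat (card G) * (\<Sum>k\<in>G. F k * y k) / cst"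
proof -
  have "(\<Sum>g\<in>G. F g * chr g) = (\<Sum>h\<in>G. \<Sum>g\<in>G. F (inv g) * y (inv h \<circ> inv g \<circ> h)) / cst"
    unfolding chr_def times_divide_eq_right sum_divide_distrib[symmetric] sum_distrib_left
    by (subst sum.swap) (simp add: Finv)
  also have "(\<Sum>h\<in>G. \<Sum>g\<in>G. F (inv g) * y (inv h \<circ> inv g \<circ> h)) = (\<Sum>h\<in>G. \<Sum>k\<in>G. F k * y k)"
  proof (rule sum.cong[OF refl])
    fix h assume h: "h \<in> G"
    have "(\<Sum>g\<in>G. F (inv g) * y (inv h \<circ> inv g \<circ> h)) = (\<Sum>g\<in>G. F g * y (inv h \<circ> g \<circ> h))"
      by (rule sum_inv)
    also have "\<dots> = (\<Sum>g\<in>G. F (inv h \<circ> g \<circ> h) * y (inv h \<circ> g \<circ> h))"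
      by (rule sum.cong) (use F[of _ "inv h"] h in auto)
    also have "\<dots> = (\<Sum>k\<in>G. F k * y k)"
      by (rule sum_conj[OF h])
    finally show "(\<Sum>g\<in>G. F (inv g) * y (inv h \<circ> inv g \<circ> h)) = (\<Sum>k\<in>G. F k * y k)" .
  qed
  finally show ?thesis by simp
qed

text \<open>The right side is, up to \<open>cst\<close>, the trace of the operator taking v to x v y
  on the group algebra. It can be evaluated once x h y is known for every permutation h.\<close>

lemma sum_y_chr: "(\<Sum>k\<in>G. x k * chr k) = (\<Sum>h\<in>G. (x \<star> gbasis h \<star> y) h) / cst"
proof -
  have "(x \<star> gbasis h \<star> y) h = (\<Sum>k\<in>G. x k * y (inv h \<circ> inv k \<circ> h))" if h: "h \<in> G" for h
    unfolding gmult_assoc gmult_apply[OF h]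
    by (rule sum.cong) (use h in \<open>auto simp: gbasis_left o_assoc\<close>)
  then have "(\<Sum>h\<in>G. (x \<star> gbasis h \<star> y) h) = (\<Sum>h\<in>G. \<Sum>k\<in>G. x k * y (inv h \<circ> inv k \<circ> h))" by simp
  also have "\<dots> = (\<Sum>k\<in>G. \<Sum>h\<in>G. x k * y (inv h \<circ> inv k \<circ> h))" by (rule sum.swap)
  finally show ?thesis by (simp add: chr_def sum_distrib_left sum_divide_distrib)
qed

text \<open>Inside y h y stands b h a, a multiple of b a, so everything reduces to y y. With
  \<open>sum_class_chr\<close> this gives the character norm 1.\<close>

lemma sum_y_chr_self: "(\<Sum>k\<in>G. y k * chr k) = cst"
proof -
  have "(\<Sum>h\<in>G. (y \<star> gbasis h \<star> y) h) = (\<Sum>h\<in>G. cst * (y (inv h) * y h))"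
  proof (rule sum.cong[OF refl])
    fix h assume h: "h \<in> G"
    have "y \<star> gbasis h \<star> y = a \<star> (b \<star> gbasis h \<star> a) \<star> b" by (simp add: gmult_assoc)
    also have "\<dots> = gscale (y (inv h)) (y \<star> y)"
      unfolding b_h_a[OF h] by (simp add: gmult_gscale_left gmult_gscale_right ba_inv h gmult_assoc)
    finally show "(y \<star> gbasis h \<star> y) h = cst * (y (inv h) * y h)"
      by (subst (asm) yy) (simp add: gscale_def)
  qed
  also have "\<dots> = cst * (\<Sum>h\<in>G. y h * y (inv h))"
    by (simp add: sum_distrib_left mult.commute)
  also have "(\<Sum>h\<in>G. y h * y (inv h)) = cst" by (rule tr_gmult[symmetric])
  finally show ?thesis unfolding sum_y_chr using cst_nonzero by simp
qed

text \<open>In other words, the sign character of C occurs exactly once in the left ideal.\<close>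

lemma sum_b_chr: "(\<Sum>k\<in>C. of_int (sign k) * chr k) = of_nat (card C)"
proof -
  have "(\<Sum>k\<in>C. of_int (sign k) * chr k) = (\<Sum>k\<in>G. b k * chr k)"
    by (rule sum.mono_neutral_cong_left) (use sub in \<open>auto simp: sgn_sum_def\<close>)
  also have "\<dots> = (\<Sum>h\<in>G. (b \<star> gbasis h \<star> y) h) / cst" by (rule sum_y_chr)
  also have "(\<Sum>h\<in>G. (b \<star> gbasis h \<star> y) h) = (\<Sum>h\<in>G. (b \<star> a \<star> b) h * y (inv h))"
  proof (rule sum.cong[OF refl])
    fix h assume h: "h \<in> G"
    have "b \<star> gbasis h \<star> y = (b \<star> gbasis h \<star> a) \<star> b" by (simp add: gmult_assoc)
    also have "\<dots> = gscale (y (inv h)) (b \<star> a \<star> b)"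
      unfolding b_h_a[OF h] by (simp add: gmult_gscale_left ba_inv h)
    finally show "(b \<star> gbasis h \<star> y) h = (b \<star> a \<star> b) h * y (inv h)" by (simp add: gscale_def)
  qed
  also have "\<dots> = tr ((b \<star> a \<star> b) \<star> y)" by (rule tr_gmult[symmetric])
  also have "\<dots> = tr (b \<star> (a \<star> b \<star> a \<star> b))" by (simp add: gmult_assoc)
  also have "\<dots> = tr (a \<star> b \<star> a \<star> (b \<star> b))" unfolding trace_rotate by (simp add: gmult_assoc)
  also have "\<dots> = of_nat (card C) * cst"
    unfolding bb by (simp add: gmult_gscale_right gmult_assoc tr_gscale)
  finally show ?thesis using cst_nonzero by simp
qed

end

text \<open>Inside y' h y stands b' h a, which every collision annihilates, so the trace in
  \<open>sum_y_chr\<close> is that of the zero operator.\<close>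

lemma young_orthogonal:
  assumes "young n R C" "young n R' C'"
    and col: "\<And>h. h \<in> sym_grp n \<Longrightarrow> collides C' R h"
  shows "(\<Sum>k\<in>sym_grp n. gmult n (ind_sum R') (sgn_sum C') k * young.chr n R C k) = 0"
proof -
  interpret Y: young n R C by fact
  interpret Y': young n R' C' by fact
  have "gmult n (gmult n Y'.y (gbasis h)) Y.y = 0" if h: "h \<in> sym_grp n" for h
  proof -
    have "gmult n (gmult n Y'.y (gbasis h)) Y.y
       = gmult n (gmult n Y'.a (gmult n (gmult n Y'.b (gbasis h)) Y.a)) Y.b" by (simp add: Y.gmult_assoc)
    also have "gmult n (gmult n Y'.b (gbasis h)) Y.a = 0"
      by (rule Y.collision_zero[OF Y'.C Y.R h col[OF h]])
    finally show ?thesis by (simp add: gmult_def fun_eq_iff)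
  qed
  then show ?thesis unfolding Y.sum_y_chr by simp
qed

section \<open>Young tableaux and the Specht characters\<close>

text \<open>The rows of the conjugate diagram as a function padded with zeros, with columns counted
  from 0; \<open>conjugate_part\<close> counts them from 1.\<close>

definition conj_fun :: "nat multiset \<Rightarrow> nat \<Rightarrow> nat" where
  "conj_fun p j = size (filter_mset (\<lambda>i. j < i) p)"

text \<open>Differences of consecutive rows of the conjugate diagram are the multiplicities of the
  parts; this turns \<open>sum_lower_strips\<close> into a product over multiplicities.\<close>

lemma conj_fun_Suc: "conj_fun p j = count p (Suc j) + conj_fun p (Suc j)"
  by (induction p) (auto simp: conj_fun_def)

lemma sum_conj_fun: "(\<And>i. i \<in># p \<Longrightarrow> i \<le> N) \<Longrightarrow> (\<Sum>j<N. conj_fun p j) = sum_mset p"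
proof (induction p)
  case (add x p)
  have "conj_fun (add_mset x p) j = conj_fun p j + (if j < x then 1 else 0)" for j
    by (simp add: conj_fun_def)
  then have "(\<Sum>j<N. conj_fun (add_mset x p) j) = (\<Sum>j<N. conj_fun p j) + (\<Sum>j<N. if j < x then 1 else 0)"
    by (simp add: sum.distrib)
  also have "(\<Sum>j<N. if j < x then 1 else 0 :: nat) = (\<Sum>j<x. 1)"
    by (rule sum.mono_neutral_cong_right) (use add.prems[of x] in auto)
  finally show ?case using add by simp
qed (simp add: conj_fun_def)

lemma part_le: "i \<in># p \<Longrightarrow> i \<le> sum_mset (p :: nat multiset)"
  by (auto dest!: multi_member_split)

lemma conj_fun_zero: "sum_mset p \<le> j \<Longrightarrow> conj_fun p j = 0"
  unfolding conj_fun_def using part_le[of _ p] by (auto simp: filter_mset_eq_conv[of _ _ "{#}"] not_less dest: le_trans)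

lemma conj_fun_diagrams_of: "conj_fun p \<in> diagrams_of (sum_mset p)"
proof -
  have "antimono (conj_fun p)"
    unfolding decseq_Suc_iff by (intro allI) (metis conj_fun_Suc le_add2)
  then have "conj_fun p \<in> diagrams" using conj_fun_zero by (intro diagramsI)
  moreover have "area (conj_fun p) = sum_mset p"
    using area_eq[of "sum_mset p" "conj_fun p"] conj_fun_zero sum_conj_fun[of p "sum_mset p"] part_le by simp
  ultimately show ?thesis by (simp add: diagrams_of_def)
qed

lemma conj_fun_surj: "conj_fun ` partitions_of n = diagrams_of n"
proof
  show "conj_fun ` partitions_of n \<subseteq> diagrams_of n"
    using conj_fun_diagrams_of by (auto simp: partitions_of_def)
  show "diagrams_of n \<subseteq> conj_fun ` partitions_of n"
  proof
    fix l assume l: "l \<in> diagrams_of n"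
    then have anti: "\<And>i j. i \<le> j \<Longrightarrow> l j \<le> l i" by (auto simp: diagrams_of_def diagrams_def antimono_def)
    \<comment> \<open>\<open>f i\<close> is the length of column i of l, and \<open>p\<close>
      collects the nonempty columns. The equivalence \<open>f\<close> below says that transposition
      exchanges rows and columns.\<close>
    define f where "f i = card {j. j < n \<and> i < l j}" for i
    define p where "p = image_mset f (mset_set {..<l 0})"
    have f: "j < f i \<longleftrightarrow> i < l j" for i j
    proof
      assume ij: "i < l j"
      have "j < n" using ij diagrams_of_bounds(2)[OF l, of j] by (cases "j < n") auto
      then have "{..j} \<subseteq> {j. j < n \<and> i < l j}" using anti ij by (auto intro: less_le_trans)
      then have "card {..j} \<le> f i" unfolding f_def by (intro card_mono) auto
      then show "j < f i" by simp
    next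
      assume jf: "j < f i"
      show "i < l j"
      proof (rule ccontr)
        assume ij: "\<not> i < l j"
        have "{j. j < n \<and> i < l j} \<subseteq> {..<j}"
        proof clarify
          fix k assume "i < l k"
          then show "k < j" using ij anti[of j k] by (cases "k < j") auto
        qed
        then have "f i \<le> card {..<j}" unfolding f_def by (intro card_mono) auto
        then show False using jf by simp
      qed
    qed
    have c: "conj_fun p = l"
    proof
      fix j
      have "conj_fun p j = card {i \<in> {..<l 0}. j < f i}"
        by (simp add: conj_fun_def p_def filter_mset_image_mset)
      also have "{i \<in> {..<l 0}. j < f i} = {..<l j}" using anti[of 0 j] by (auto simp: f)
      finally show "conj_fun p j = l j" by simp
    qed
    have "f i \<noteq> 0" if "i < l 0" for i
      using f[of 0 i] that by simp
    then have "is_partition p"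
      unfolding is_partition_def p_def by (auto simp: image_iff simp del: not_gr_zero)
    moreover have "sum_mset p = n"
      using conj_fun_diagrams_of[of p] l c by (simp add: diagrams_of_def)
    ultimately show "l \<in> conj_fun ` partitions_of n" using c by (auto simp: partitions_of_def)
  qed
qed

section \<open>Rows and columns of the standard filling\<close>

definition brow :: "nat multiset \<Rightarrow> nat \<Rightarrow> nat" where "brow p k = fst (boxes p ! k)"
definition bcol :: "nat multiset \<Rightarrow> nat \<Rightarrow> nat" where "bcol p k = snd (boxes p ! k)"
definition diagram :: "nat multiset \<Rightarrow> (nat \<times> nat) set" where
  "diagram p = {(i, j). i < length (rows p) \<and> j < rows p ! i}"

lemma mset_rows: "mset (rows p) = p"
  by (simp add: rows_def)

lemma length_boxes: "length (boxes p) = sum_mset p"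
proof -
  have "length (boxes p) = sum_list (map ((!) (rows p)) [0..<length (rows p)])"
    by (simp add: boxes_def length_concat comp_def)
  also have "\<dots> = sum_list (rows p)" by (simp only: map_nth)
  finally show ?thesis by (metis mset_rows sum_mset_sum_list)
qed

lemma set_boxes: "set (boxes p) = diagram p"
  by (auto simp: boxes_def diagram_def)

lemma distinct_boxes: "distinct (boxes p)"
proof (rule card_distinct)
  have "diagram p = Sigma {..<length (rows p)} (\<lambda>i. {..<rows p ! i})" by (auto simp: diagram_def)
  then have "card (set (boxes p)) = (\<Sum>i<length (rows p). rows p ! i)" by (simp add: set_boxes)
  also have "\<dots> = sum_list (rows p)" by (simp add: sum_list_sum_nth atLeast0LessThan)
  also have "\<dots> = length (boxes p)" unfolding length_boxes by (metis mset_rows sum_mset_sum_list)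
  finally show "card (set (boxes p)) = length (boxes p)" .
qed

lemma boxes_bij: "bij_betw (\<lambda>k. (brow p k, bcol p k)) {..<sum_mset p} (diagram p)"
proof -
  have "bij_betw ((!) (boxes p)) {..<length (boxes p)} (set (boxes p))"
    by (rule bij_betw_nth[OF distinct_boxes]) auto
  then show ?thesis by (simp add: length_boxes set_boxes brow_def bcol_def)
qed

lemma card_filter_bij:
  assumes "bij_betw f A B"
  shows "card {x \<in> A. P (f x)} = card {y \<in> B. P y}"
proof (rule bij_betw_same_card)
  have "f ` {x \<in> A. P (f x)} = {y \<in> B. P y}"
    using assms unfolding bij_betw_def by blast
  moreover have "inj_on f {x \<in> A. P (f x)}"
    using assms unfolding bij_betw_def by (auto intro: inj_on_subset)
  ultimately show "bij_betw f {x \<in> A. P (f x)} {y \<in> B. P y}" by (simp add: bij_betw_def)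
qed

lemma card_bcol:
  "card {k. k < sum_mset p \<and> bcol p k = j} = conj_fun p j"
proof -
  have "card {k. k < sum_mset p \<and> bcol p k = j} = card {x \<in> diagram p. snd x = j}"
    using card_filter_bij[OF boxes_bij[of p], of "\<lambda>x. snd x = j"] by simp
  also have "{x \<in> diagram p. snd x = j} = (\<lambda>i. (i, j)) ` {i. i < length (rows p) \<and> j < rows p ! i}"
    by (auto simp: diagram_def)
  also have "card \<dots> = card {i. i < length (rows p) \<and> j < rows p ! i}"
    by (rule card_image) (simp add: inj_on_def)
  also have "\<dots> = length (filter (\<lambda>i. j < i) (rows p))"
    by (simp add: length_filter_conv_card)
  also have "\<dots> = size (filter_mset (\<lambda>i. j < i) (mset (rows p)))" by (metis mset_filter size_mset)
  finally show ?thesis by (simp add: mset_rows conj_fun_def)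
qed

lemma card_brow_bcol:
  "r < length (rows p) \<Longrightarrow> card {k. k < sum_mset p \<and> brow p k = r \<and> bcol p k < m} = min m (rows p ! r)"
proof -
  assume r: "r < length (rows p)"
  have "card {k. k < sum_mset p \<and> brow p k = r \<and> bcol p k < m} = card {x \<in> diagram p. fst x = r \<and> snd x < m}"
    using card_filter_bij[OF boxes_bij[of p], of "\<lambda>x. fst x = r \<and> snd x < m"] by simp
  also have "{x \<in> diagram p. fst x = r \<and> snd x < m} = (\<lambda>j. (r, j)) ` {..<min m (rows p ! r)}"
    using r by (auto simp: diagram_def)
  also have "card \<dots> = min m (rows p ! r)"
    by (subst card_image) (simp_all add: inj_on_def)
  finally show ?thesis .
qed

lemma brow_less: "k < sum_mset p \<Longrightarrow> brow p k < length (rows p) \<and> bcol p k < rows p ! brow p k"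
  using boxes_bij[of p] by (auto simp: bij_betw_def diagram_def)

lemma card_brow:
  assumes "r < length (rows p)"
  shows "card {k. k < sum_mset p \<and> brow p k = r} = rows p ! r"
proof -
  have "{k. k < sum_mset p \<and> brow p k = r} = {k. k < sum_mset p \<and> brow p k = r \<and> bcol p k < rows p ! r}"
    using brow_less[of _ p] by auto
  then show ?thesis using card_brow_bcol[OF assms, of "rows p ! r"] by simp
qed

lemma bcol_less: "k < sum_mset p \<Longrightarrow> bcol p k < sum_mset p"
proof -
  assume k: "k < sum_mset p"
  have "rows p ! brow p k \<in># p" using brow_less[OF k] by (metis mset_rows nth_mem set_mset_mset)
  then show ?thesis using brow_less[OF k] part_le by (meson less_le_trans)
qed

section \<open>Row and column groups as stabilisers of labels\<close>

definition label_group :: "nat \<Rightarrow> (nat \<Rightarrow> nat) \<Rightarrow> (nat \<Rightarrow> nat) set" where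
  "label_group n f = {g \<in> sym_grp n. \<forall>k<n. f (g k) = f k}"

lemma row_group_eq: "row_group p = label_group (sum_mset p) (brow p)"
  and column_group_eq: "column_group p = label_group (sum_mset p) (bcol p)"
  by (simp_all add: row_group_def column_group_def label_group_def brow_def bcol_def)

lemma label_group_young_group: "label_group n f = young_group f {..<n}"
  by (auto simp: label_group_def young_group_def sym_grp_def)

lemma sym_grp_less: "g \<in> sym_grp n \<Longrightarrow> g k < n \<longleftrightarrow> k < n"
  using permutes_in_image[of g "{..<n}" k] by (simp add: sym_grp_def)

lemma sym_grp_fixes: "g \<in> sym_grp n \<Longrightarrow> k \<ge> n \<Longrightarrow> g k = k"
  by (auto simp: sym_grp_def permutes_def)

lemma sym_grp_inv_apply: "g \<in> sym_grp n \<Longrightarrow> g (inv g k) = k" "g \<in> sym_grp n \<Longrightarrow> inv g (g k) = k"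
  by (auto simp: sym_grp_def permutes_inverses)

lemma subgrp_label_group: "subgrp n (label_group n f)"
  unfolding subgrp_def
proof (intro conjI ballI)
  show "label_group n f \<subseteq> sym_grp n" by (auto simp: label_group_def)
  show "id \<in> label_group n f" by (simp add: label_group_def sym_algebra.sym_grp_id)
  fix g h assume g: "g \<in> label_group n f" and h: "h \<in> label_group n f"
  then have G: "g \<in> sym_grp n" "h \<in> sym_grp n" by (auto simp: label_group_def)
  show "g \<circ> h \<in> label_group n f"
    using g h sym_grp_less[OF G(2)] by (auto simp: label_group_def sym_algebra.sym_grp_comp)
next
  fix g assume g: "g \<in> label_group n f"
  then have G: "g \<in> sym_grp n" by (auto simp: label_group_def)
  then have I: "inv g \<in> sym_grp n" by (rule sym_algebra.sym_grp_inv)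
  have "f (inv g k) = f k" if "k < n" for k
  proof -
    have "f (g (inv g k)) = f (inv g k)" using g that sym_grp_less[OF I, of k] by (simp add: label_group_def)
    then show ?thesis by (simp add: sym_grp_inv_apply[OF G])
  qed
  then show "inv g \<in> label_group n f" using I by (simp add: label_group_def)
qed

lemma transpose_label_group:
  "x < n \<Longrightarrow> y < n \<Longrightarrow> f x = f y \<Longrightarrow> transpose x y \<in> label_group n f"
  by (auto simp: label_group_def sym_grp_def transpose_def intro!: permutes_swap_id)

text \<open>Think of h as relabelling the filling, so that entry x stands in row
  \<open>r (inv h x)\<close>. Two entries sharing that row and a column of the other filling can be
  swapped, and their transposition is a collision.\<close>

lemma no_collision_inj:
  assumes h: "h \<in> sym_grp n" and nc: "\<not> collides (label_group n c) (label_group n r) h"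
    and xy: "x < n" "y < n" "x \<noteq> y" "c x = c y"
  shows "r (inv h x) \<noteq> r (inv h y)"
proof
  assume eq: "r (inv h x) = r (inv h y)"
  have I: "inv h \<in> sym_grp n" using h by (rule sym_algebra.sym_grp_inv)
  have "inv h \<circ> transpose x y \<circ> h = transpose (inv h x) (inv h y)"
  proof
    fix z
    have "h z = x \<longleftrightarrow> z = inv h x" "h z = y \<longleftrightarrow> z = inv h y" using sym_grp_inv_apply[OF h] by metis+
    then show "(inv h \<circ> transpose x y \<circ> h) z = transpose (inv h x) (inv h y) z"
      using sym_grp_inv_apply[OF h] by (auto simp: transpose_def)
  qed
  moreover have "transpose (inv h x) (inv h y) \<in> label_group n r"
    by (rule transpose_label_group) (use xy eq sym_grp_less[OF I] in auto)
  moreover have "transpose x y \<in> label_group n c" by (rule transpose_label_group) (use xy in auto)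
  ultimately show False using nc xy(3) unfolding collides_def by metis
qed

lemma card_row_preimage:
  assumes h: "h \<in> sym_grp n"
  shows "card {x. x < n \<and> P (inv h x)} = card {k. k < n \<and> P k}"
proof (rule bij_betw_same_card)
  have I: "inv h \<in> sym_grp n" using h by (rule sym_algebra.sym_grp_inv)
  show "bij_betw (inv h) {x. x < n \<and> P (inv h x)} {k. k < n \<and> P k}"
    by (rule bij_betw_byWitness[where f' = h])
       (use sym_grp_inv_apply[OF h] sym_grp_less[OF I] sym_grp_less[OF h] in auto)
qed

context
  fixes p q :: "nat multiset" and h :: "nat \<Rightarrow> nat"
  assumes pq: "sum_mset p = sum_mset q"
    and h: "h \<in> sym_grp (sum_mset p)"
    and nc: "\<not> collides (column_group q) (row_group p) h"
begin

lemma card_by_rows: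
  "card {x. x < sum_mset p \<and> bcol q x < m}
     = (\<Sum>r<length (rows p). card {x. x < sum_mset p \<and> brow p (inv h x) = r \<and> bcol q x < m})"
proof -
  have I: "inv h \<in> sym_grp (sum_mset p)" using h by (rule sym_algebra.sym_grp_inv)
  have "{x. x < sum_mset p \<and> bcol q x < m}
     = (\<Union>r\<in>{..<length (rows p)}. {x. x < sum_mset p \<and> brow p (inv h x) = r \<and> bcol q x < m})"
    using brow_less[of _ p] sym_grp_less[OF I] by auto
  then show ?thesis by (simp only:) (subst card_UN_disjoint; auto)
qed

lemma card_row_le:
  assumes r: "r < length (rows p)"
  shows "card {x. x < sum_mset p \<and> brow p (inv h x) = r \<and> bcol q x < m} \<le> min m (rows p ! r)"
proof -
  let ?S = "{x. x < sum_mset p \<and> brow p (inv h x) = r \<and> bcol q x < m}"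
  have "inj_on (bcol q) ?S"
  proof (rule inj_onI)
    fix x y assume "x \<in> ?S" "y \<in> ?S" "bcol q x = bcol q y"
    then show "x = y"
      using no_collision_inj[OF h nc[unfolded row_group_eq column_group_eq, folded pq], of x y] by auto
  qed
  then have "card ?S = card (bcol q ` ?S)" by (simp add: card_image)
  also have "\<dots> \<le> card {..<m}" by (rule card_mono) auto
  finally have 1: "card ?S \<le> m" by simp
  have "card ?S \<le> card {x. x < sum_mset p \<and> brow p (inv h x) = r}" by (rule card_mono) auto
  also have "\<dots> = card {k. k < sum_mset p \<and> brow p k = r}" by (rule card_row_preimage[OF h])
  also have "\<dots> = rows p ! r" by (rule card_brow[OF r])
  finally show ?thesis using 1 by simp
qed

lemma card_bcol_less_rows: "card {x. x < sum_mset p \<and> bcol p x < m} = (\<Sum>r<length (rows p). min m (rows p ! r))"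
proof -
  have "{x. x < sum_mset p \<and> bcol p x < m}
     = (\<Union>r\<in>{..<length (rows p)}. {x. x < sum_mset p \<and> brow p x = r \<and> bcol p x < m})"
    using brow_less[of _ p] by auto
  then have "card {x. x < sum_mset p \<and> bcol p x < m} = (\<Sum>r<length (rows p). card {x. x < sum_mset p \<and> brow p x = r \<and> bcol p x < m})"
    by (simp only:) (subst card_UN_disjoint; auto)
  then show ?thesis by (simp add: card_brow_bcol)
qed

text \<open>Without a collision, each row of p meets the first m columns of q in at most m boxes.\<close>

lemma column_dominance:
  "card {x. x < sum_mset p \<and> bcol q x < m} \<le> card {x. x < sum_mset p \<and> bcol p x < m}"
  unfolding card_by_rows card_bcol_less_rows by (rule sum_mono) (use card_row_le in auto)

text \<open>For q = p the row bounds of \<open>card_row_le\<close> add up to the actual number of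
  boxes, so each is an equality. Hence every entry can be moved within its column to the row it has
  in the filling relabelled by h; this column permutation d makes d h preserve rows.\<close>

lemma no_collision_factor:
  assumes "q = p"
  shows "\<exists>c\<in>column_group p. \<exists>r\<in>row_group p. h = c \<circ> r"
proof -
  let ?n = "sum_mset p" and ?\<rho> = "\<lambda>x. brow p (inv h x)"
  have I: "inv h \<in> sym_grp ?n" using h by (rule sym_algebra.sym_grp_inv)
  have eq: "card {x. x < ?n \<and> ?\<rho> x = r \<and> bcol p x < m} = min m (rows p ! r)"
    if r: "r < length (rows p)" for r m
  proof (rule ccontr)
    assume "card {x. x < ?n \<and> ?\<rho> x = r \<and> bcol p x < m} \<noteq> min m (rows p ! r)"
    then have "card {x. x < ?n \<and> ?\<rho> x = r \<and> bcol p x < m} < min m (rows p ! r)"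
      using card_row_le[OF r, of m, unfolded assms] by (rule le_neq_implies_less[rotated])
    \<comment> \<open>One strict inequality would make the total too small, although both sums count
      the boxes in the first m columns.\<close>
    then have "(\<Sum>r<length (rows p). card {x. x < ?n \<and> ?\<rho> x = r \<and> bcol p x < m}) < (\<Sum>r<length (rows p). min m (rows p ! r))"
      using card_row_le r unfolding assms by (intro sum_strict_mono_ex1) auto
    then show False using card_by_rows[of m] card_bcol_less_rows[of m] unfolding assms by simp
  qed
  have in_diag: "(?\<rho> x, bcol p x) \<in> diagram p" if x: "x < ?n" for x
  proof -
    have r: "?\<rho> x < length (rows p)" using brow_less[of "inv h x" p] sym_grp_less[OF I] x by simp
    let ?r = "?\<rho> x"
    let ?A = "{x. x < ?n \<and> ?\<rho> x = ?r \<and> bcol p x < rows p ! ?r}" and ?B = "{x. x < ?n \<and> ?\<rho> x = ?r}"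
    have "card ?B = card {k. k < ?n \<and> brow p k = ?r}" by (rule card_row_preimage[OF h])
    \<comment> \<open>The equality for m equal to the full row length shows that every entry of the
      relabelled row lies in a column that the row really has.\<close>
    also have "\<dots> = card ?A" using card_brow[OF r] eq[OF r, of "rows p ! ?r"] by simp
    finally have "card ?B = card ?A" .
    then have "?A = ?B" by (intro card_subset_eq) auto
    then have "bcol p x < rows p ! ?r" using x by blast
    then show ?thesis using r by (simp add: diagram_def)
  qed
  define pos where "pos = inv_into {..<?n} (\<lambda>k. (brow p k, bcol p k))"
  have pos: "pos d < ?n" "brow p (pos d) = fst d" "bcol p (pos d) = snd d" if "d \<in> diagram p" for d
  proof -
    have d: "d \<in> (\<lambda>k. (brow p k, bcol p k)) ` {..<?n}" using boxes_bij[of p] that by (simp add: bij_betw_def)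
    show "pos d < ?n" unfolding pos_def using inv_into_into[OF d] by simp
    have "(brow p (pos d), bcol p (pos d)) = d" unfolding pos_def using f_inv_into_f[OF d] by simp
    then show "brow p (pos d) = fst d" "bcol p (pos d) = snd d" by (metis fst_conv snd_conv)+
  qed
  \<comment> \<open>The target box combines the row of x in the relabelled filling with the column
    of x in the standard one; \<open>in_diag\<close> guarantees that it exists.\<close>
  define d where "d x = (if x < ?n then pos (?\<rho> x, bcol p x) else x)" for x
  have d: "d x < ?n" "brow p (d x) = ?\<rho> x" "bcol p (d x) = bcol p x" if "x < ?n" for x
    using pos[OF in_diag[OF that]] that by (auto simp: d_def)
  have "inj_on d {..<?n}"
  proof (rule inj_onI)
    fix x y assume xy: "x \<in> {..<?n}" "y \<in> {..<?n}" "d x = d y"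
    then have "?\<rho> x = ?\<rho> y" "bcol p x = bcol p y" using d(2,3)[of x] d(2,3)[of y] by auto
    then show "x = y"
      using no_collision_inj[OF h nc[unfolded row_group_eq column_group_eq, folded pq], of x y] xy assms by auto
  qed
  moreover have "d ` {..<?n} \<subseteq> {..<?n}" using d by auto
  ultimately have "bij_betw d {..<?n} {..<?n}"
    by (simp add: bij_betw_def endo_inj_surj)
  then have "d permutes {..<?n}" by (rule bij_imp_permutes) (simp add: d_def)
  then have dG: "d \<in> sym_grp ?n" by (simp add: sym_grp_def)
  then have "d \<in> column_group p" using d by (simp add: column_group_eq label_group_def)
  then have "inv d \<in> column_group p" using subgrp_label_group by (auto simp: column_group_eq subgrp_def)
  moreover have "d \<circ> h \<in> row_group p"
    using d(2) sym_grp_less[OF h] sym_grp_inv_apply[OF h] dG h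
    by (simp add: row_group_eq label_group_def sym_algebra.sym_grp_comp del: o_apply) simp
  moreover have "h = inv d \<circ> (d \<circ> h)" by (rule sym_algebra.sym_grp_cancel(1)[OF dG, symmetric])
  ultimately show ?thesis by blast
qed

end

lemma young_partition: "young (sum_mset p) (row_group p) (column_group p)"
proof
  let ?n = "sum_mset p"
  show "subgrp ?n (row_group p)" "subgrp ?n (column_group p)"
    unfolding row_group_eq column_group_eq by (rule subgrp_label_group)+
  show "row_group p \<inter> column_group p = {id}"
  proof
    show "{id} \<subseteq> row_group p \<inter> column_group p"
      using subgrp_label_group[of ?n] by (auto simp: row_group_eq column_group_eq subgrp_def)
    show "row_group p \<inter> column_group p \<subseteq> {id}"
    proof clarify
      fix g assume g: "g \<in> row_group p" "g \<in> column_group p"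
      then have G: "g \<in> sym_grp ?n" by (simp add: row_group_def)
      have "g k = k" for k
      proof (cases "k < ?n")
        case True
        have "(brow p (g k), bcol p (g k)) = (brow p k, bcol p k)"
          using g True by (simp add: row_group_eq column_group_eq label_group_def)
        then show ?thesis
          using boxes_bij[of p] True sym_grp_less[OF G, of k] by (auto simp: bij_betw_def inj_on_def)
      next
        case False
        then show ?thesis using sym_grp_fixes[OF G] by simp
      qed
      then show "g = id" by (simp add: fun_eq_iff)
    qed
  qed
  fix h assume "h \<in> sym_grp ?n"
  then show "(\<exists>c\<in>column_group p. \<exists>r\<in>row_group p. h = c \<circ> r) \<or> collides (column_group p) (row_group p) h"
    using no_collision_factor[OF refl, of h p] by blast
qed

section \<open>From Young symmetrizers to the values of the characters\<close>

lemma young_symmetrizer_eq: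
  "young_symmetrizer p = gmult (sum_mset p) (ind_sum (row_group p)) (sgn_sum (column_group p))"
proof -
  interpret young "sum_mset p" "row_group p" "column_group p" by (rule young_partition)
  show ?thesis unfolding young_symmetrizer_def a_expand[symmetric] b_expand[symmetric] ..
qed

abbreviation pchr :: "nat multiset \<Rightarrow> (nat \<Rightarrow> nat) \<Rightarrow> complex" where
  "pchr p \<equiv> young.chr (sum_mset p) (row_group p) (column_group p)"

lemma specht_character_eq: "g \<in> sym_grp (sum_mset p) \<Longrightarrow> specht_character p g = pchr p g"
  unfolding specht_character_def specht_def young_symmetrizer_eq
  by (rule young.trace_specht[OF young_partition])

lemma cycle_type_eq: "cycle_type n g = cycle_type_on {..<n} g"
  by (simp add: cycle_type_def cycle_type_on_def)

lemma pchr_same_cycle_type_on: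
  assumes "g \<in> sym_grp (sum_mset p)" "g' \<in> sym_grp (sum_mset p)" "cycle_type_on {..<sum_mset p} g = cycle_type_on {..<sum_mset p} g'"
  shows "pchr p g = pchr p g'"
proof -
  obtain s where s: "s permutes {..<sum_mset p}" "g' = s \<circ> g \<circ> inv s"
    using conjugate_of_same_cycle_type_on[of "{..<sum_mset p}" g g'] assms by (auto simp: sym_grp_def)
  then show ?thesis
    using young.chr_conj[OF young_partition, of s p g] assms by (simp add: sym_grp_def)
qed

lemma chi_cycle_type_on:
  assumes g: "g \<in> sym_grp (sum_mset p)"
  shows "\<chi> p (cycle_type_on {..<sum_mset p} g) = pchr p g"
proof -
  let ?g = "SOME g'. g' \<in> sym_grp (sum_mset p) \<and> cycle_type (sum_mset p) g' = cycle_type_on {..<sum_mset p} g"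
  have "\<exists>g'. g' \<in> sym_grp (sum_mset p) \<and> cycle_type (sum_mset p) g' = cycle_type_on {..<sum_mset p} g"
    using g by (auto simp: cycle_type_eq)
  from someI_ex[OF this] have g': "?g \<in> sym_grp (sum_mset p)" "cycle_type_on {..<sum_mset p} ?g = cycle_type_on {..<sum_mset p} g"
    by (auto simp: cycle_type_eq)
  have "\<chi> p (cycle_type_on {..<sum_mset p} g) = pchr p ?g"
    unfolding \<chi>_def by (rule specht_character_eq[OF g'(1)])
  also have "\<dots> = pchr p g" by (rule pchr_same_cycle_type_on[OF g'(1) g g'(2)])
  finally show ?thesis .
qed

text \<open>Obtained from the count rather than by constructing a permutation: if none had type
  \<pi>, the sum of the indicator of \<pi> would vanish, yet it is a multiple of 1 / z_\<pi> >
  0.\<close>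

lemma cycle_type_on_surj:
  assumes "\<pi> \<in> partitions_of n"
  shows "\<exists>g\<in>sym_grp n. cycle_type_on {..<n} g = \<pi>"
proof (rule ccontr)
  assume "\<not> ?thesis"
  then have "(\<Sum>g | g permutes {..<n}. (if cycle_type_on {..<n} g = \<pi> then 1 else 0 :: real)) = 0"
    by (intro sum.neutral) (auto simp: sym_grp_def)
  then have "(\<Sum>\<sigma>\<in>partitions_of n. (if \<sigma> = \<pi> then 1 else 0) / real (z_part \<sigma>)) = 0"
    using sum_over_cycle_types[of "{..<n}" "\<lambda>\<sigma>. if \<sigma> = \<pi> then 1 else 0"] by simp
  moreover have "(\<Sum>\<sigma>\<in>partitions_of n. (if \<sigma> = \<pi> then 1 else 0) / real (z_part \<sigma>)) = 1 / real (z_part \<pi>)"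
    using assms by (simp add: if_distrib[of "\<lambda>x. x / _"] cong: if_cong)
  ultimately show False using z_part_partition[OF assms] by simp
qed

lemma chi_real: "\<pi> \<in> partitions_of (sum_mset p) \<Longrightarrow> \<chi> p \<pi> = of_real (Re (\<chi> p \<pi>))"
  using cycle_type_on_surj[of \<pi> "sum_mset p"] chi_cycle_type_on[of _ p] young.real_chr[OF young_partition, of p]
  by (metis of_real_Re)

text \<open>The power sum coefficients of the Frobenius characteristic of sgn * chi, whence the division by z.\<close>

definition twisted_char :: "nat multiset \<Rightarrow> series" where
  "twisted_char p \<pi> = of_int (part_sgn \<pi>) * Re (\<chi> p \<pi>) / real (z_part \<pi>)"

lemma part_sgn_square: "(of_int (part_sgn \<pi>) :: real) * of_int (part_sgn \<pi>) = 1"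
  by (simp add: part_sgn_def power_add[symmetric] mult_2[symmetric] of_int_mult[symmetric] del: of_int_mult)

text \<open>The two signs cancel, and \<open>sum_over_cycle_types\<close> turns the weights 1 / z
  into a sum over the group.\<close>

lemma p_inner_twisted_char:
  assumes p: "sum_mset p = n" and q: "sum_mset q = n"
  shows "fact n * p_inner n (twisted_char p) (twisted_char q) = Re (\<Sum>g\<in>sym_grp n. pchr p g * pchr q g)"
proof -
  have "fact n * p_inner n (twisted_char p) (twisted_char q)
     = fact (card {..<n}) * (\<Sum>\<pi>\<in>partitions_of (card {..<n}). (Re (\<chi> p \<pi>) * Re (\<chi> q \<pi>)) / real (z_part \<pi>))"
  proof -
    have "real (z_part \<pi>) * twisted_char p \<pi> * twisted_char q \<pi> = (Re (\<chi> p \<pi>) * Re (\<chi> q \<pi>)) / real (z_part \<pi>)"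
      if "\<pi> \<in> partitions_of n" for \<pi>
    proof -
      have "real (z_part \<pi>) * twisted_char p \<pi> * twisted_char q \<pi>
        = (of_int (part_sgn \<pi>) * of_int (part_sgn \<pi>)) * (Re (\<chi> p \<pi>) * Re (\<chi> q \<pi>)) / real (z_part \<pi>)"
        using z_part_partition[OF that] by (simp add: twisted_char_def)
      then show ?thesis unfolding part_sgn_square by simp
    qed
    then show ?thesis unfolding p_inner_def by simp
  qed
  also have "\<dots> = (\<Sum>g\<in>sym_grp n. Re (\<chi> p (cycle_type_on {..<n} g)) * Re (\<chi> q (cycle_type_on {..<n} g)))"
    unfolding sym_grp_def by (rule sum_over_cycle_types[symmetric]) simp
  also have "\<dots> = (\<Sum>g\<in>sym_grp n. Re (pchr p g * pchr q g))"
  proof (rule sum.cong[OF refl])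
    fix g assume g: "g \<in> sym_grp n"
    have "pchr p g \<in> \<real>" "pchr q g \<in> \<real>"
      using young.real_chr[OF young_partition] by blast+
    then have "Re (pchr p g * pchr q g) = Re (pchr p g) * Re (pchr q g)"
      by (simp add: complex_is_Real_iff)
    then show "Re (\<chi> p (cycle_type_on {..<n} g)) * Re (\<chi> q (cycle_type_on {..<n} g)) = Re (pchr p g * pchr q g)"
      using chi_cycle_type_on[of g p] chi_cycle_type_on[of g q] g p q by simp
  qed
  finally show ?thesis by simp
qed

lemma sum_chr_product:
  assumes p: "sum_mset p = n" and q: "sum_mset q = n"
  shows "(\<Sum>g\<in>sym_grp n. pchr p g * pchr q g) = of_nat (card (sym_grp n)) *
     (\<Sum>k\<in>sym_grp n. gmult n (ind_sum (row_group q)) (sgn_sum (column_group q)) k * pchr p k) /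
     sym_algebra.tr (gmult n (gmult n (ind_sum (row_group q)) (sgn_sum (column_group q)))
        (gmult n (ind_sum (row_group q)) (sgn_sum (column_group q))))"
proof -
  interpret Q: young n "row_group q" "column_group q" using young_partition[of q] q by simp
  have conj: "pchr p (h \<circ> g \<circ> inv h) = pchr p g" if "g \<in> sym_grp n" "h \<in> sym_grp n" for g h
    using young.chr_conj[OF young_partition, of h p g] that p by simp
  have inv: "pchr p (inv g) = pchr p g" if "g \<in> sym_grp n" for g
    by (rule pchr_same_cycle_type_on) (use that p in \<open>auto simp: cycle_type_on_inv sym_grp_def permutes_inv\<close>)
  show ?thesis
    using Q.sum_class_chr[of "pchr p", OF conj inv] q by (simp add: mult.commute)
qed

lemma twisted_char_norm:
  assumes p: "p \<in> partitions_of n"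
  shows "p_inner n (twisted_char p) (twisted_char p) = 1"
proof -
  have n: "sum_mset p = n" using p by (simp add: partitions_of_def)
  interpret P: young n "row_group p" "column_group p" using young_partition[of p] n by simp
  have "(\<Sum>g\<in>sym_grp n. pchr p g * pchr p g) = of_nat (card (sym_grp n))"
    unfolding sum_chr_product[OF n n] using P.sum_y_chr_self P.cst_nonzero n by simp
  also have "card (sym_grp n) = fact n"
    unfolding sym_grp_def by (rule card_permutations) auto
  finally have "fact n * p_inner n (twisted_char p) (twisted_char p) = fact n"
    using p_inner_twisted_char[OF n n] by simp
  then show ?thesis by simp
qed

lemma card_bcol_less:
  assumes "sum_mset p = n"
  shows "card {x. x < n \<and> bcol p x < m} = (\<Sum>j<m. conj_fun p j)"
proof -
  have "{x. x < n \<and> bcol p x < m} = (\<Union>j\<in>{..<m}. {x. x < n \<and> bcol p x = j})" by auto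
  then have "card {x. x < n \<and> bcol p x < m} = (\<Sum>j<m. card {x. x < n \<and> bcol p x = j})"
    by (simp only:) (subst card_UN_disjoint; auto)
  then show ?thesis using card_bcol[of p] assms by simp
qed

text \<open>If every permutation collides in one of the two directions, that direction gives
  orthogonality. Otherwise \<open>column_dominance\<close> holds both ways, all partial sums of
  column lengths agree, and so do the conjugate diagrams.\<close>

lemma twisted_char_orth:
  assumes "p \<in> partitions_of n" "q \<in> partitions_of n" "conj_fun p \<noteq> conj_fun q"
  shows "p_inner n (twisted_char p) (twisted_char q) = 0"
proof -
  have zero: "p_inner n (twisted_char p) (twisted_char q) = 0"
    if p: "sum_mset p = n" and q: "sum_mset q = n"
      and c: "\<And>h. h \<in> sym_grp n \<Longrightarrow> collides (column_group q) (row_group p) h" for p q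
  proof -
    have "(\<Sum>k\<in>sym_grp n. gmult n (ind_sum (row_group q)) (sgn_sum (column_group q)) k * pchr p k) = 0"
      using young_orthogonal[of n "row_group p" "column_group p" "row_group q" "column_group q"]
        young_partition[of p] young_partition[of q] p q c by simp
    then have "fact n * p_inner n (twisted_char p) (twisted_char q) = 0"
      unfolding p_inner_twisted_char[OF p q] sum_chr_product[OF p q] by simp
    then show ?thesis by simp
  qed
  have n: "sum_mset p = n" "sum_mset q = n" using assms by (auto simp: partitions_of_def)
  show ?thesis
  proof (cases "\<forall>h\<in>sym_grp n. collides (column_group q) (row_group p) h")
    case True
    then show ?thesis using zero n by blast
  next
    case 1: False
    show ?thesis
    proof (cases "\<forall>h\<in>sym_grp n. collides (column_group p) (row_group q) h")
      case True
      then have "p_inner n (twisted_char q) (twisted_char p) = 0" using zero[of q p] n by blast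
      then show ?thesis by (simp add: p_inner_commute)
    next
      case 2: False
      from 1 2 obtain h h' where h: "h \<in> sym_grp n" "\<not> collides (column_group q) (row_group p) h"
        and h': "h' \<in> sym_grp n" "\<not> collides (column_group p) (row_group q) h'" by blast
      have "(\<Sum>j<m. conj_fun q j) = (\<Sum>j<m. conj_fun p j)" for m
        using column_dominance[of p q h m] column_dominance[of q p h' m] h h' n
          card_bcol_less[of p n m] card_bcol_less[of q n m] by simp
      then have "(\<Sum>j<Suc m. conj_fun q j) - (\<Sum>j<m. conj_fun q j) = (\<Sum>j<Suc m. conj_fun p j) - (\<Sum>j<m. conj_fun p j)" for m
        by metis
      then have "conj_fun q m = conj_fun p m" for m by simp
      then show ?thesis using assms(3) by (simp add: fun_eq_iff)
    qed
  qed
qed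

text \<open>The level sets of the column group are the columns, so pairing with h_l is averaging
  over that group. The sign in \<open>twisted_char\<close> then becomes the sign of the group
  element, and \<open>sum_b_chr\<close> evaluates the average.\<close>

lemma twisted_char_diag:
  assumes p: "p \<in> partitions_of n"
  shows "p_inner n (h_prod (row_list n (conj_fun p))) (twisted_char p) = 1"
proof -
  have n: "sum_mset p = n" using p by (simp add: partitions_of_def)
  interpret P: young n "row_group p" "column_group p" using young_partition[of p] n by simp
  define F where "F \<pi> = of_int (part_sgn \<pi>) * Re (\<chi> p \<pi>)" for \<pi>
  have C: "column_group p = young_group (bcol p) {..<n}"
    using n by (simp add: column_group_eq label_group_young_group)
  have rl: "map (\<lambda>i. card {k \<in> {..<n}. bcol p k = i}) [0..<n] = row_list n (conj_fun p)"
    using card_bcol[of p] n by simp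
  have "p_inner n (h_prod (row_list n (conj_fun p))) (twisted_char p) = (\<Sum>\<pi>\<in>partitions_of n. h_prod (row_list n (conj_fun p)) \<pi> * F \<pi>)"
    unfolding p_inner_def by (rule sum.cong) (auto simp: twisted_char_def F_def dest: z_part_partition)
  then have "real (card (column_group p)) * p_inner n (h_prod (row_list n (conj_fun p))) (twisted_char p)
     = (\<Sum>g\<in>column_group p. F (cycle_type_on {..<n} g))"
    using sum_over_young_group[of "{..<n}" 0 "bcol p" n F] bcol_less[of _ p] n unfolding C rl by simp
  also have "\<dots> = (\<Sum>g\<in>column_group p. Re (of_int (sign g) * pchr p g))"
  proof (rule sum.cong[OF refl])
    fix g assume "g \<in> column_group p"
    then have g: "g \<in> sym_grp n" using P.sub by blast
    then have "sign g = part_sgn (cycle_type_on {..<n} g)" by (intro sign_eq_part_sgn) (auto simp: sym_grp_def)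
    then show "F (cycle_type_on {..<n} g) = Re (of_int (sign g) * pchr p g)"
      using chi_cycle_type_on[of g p] g n by (simp add: F_def)
  qed
  also have "\<dots> = Re (of_nat (card (column_group p)))"
    unfolding Re_sum[symmetric] using P.sum_b_chr n by simp
  finally show ?thesis using P.card_C by simp
qed

section \<open>The product formula and its two specialisations\<close>

theorem p_inner_twisted_char_corresponds:
  assumes "p \<in> partitions_of n" "corresponds F a"
  shows "p_inner n (twisted_char p) F = a (conj_fun p)"
  by (rule orthonormal_characterization[of conj_fun "partitions_of n"])
     (use assms conj_fun_surj twisted_char_norm twisted_char_orth twisted_char_diag in auto)

text \<open>H(e) is expanded into the h_m; by \<open>corresponds_h_mult\<close> the coefficient of
  h_m H(1) Q at the conjugate diagram counts the horizontal strips of size m that can be removed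
  from it.\<close>

lemma multiplicity_formula:
  assumes p: "p \<in> partitions_of n"
  shows "p_inner n (twisted_char p) (conv (h_series e) schur_series) = (\<Prod>i<n. \<Sum>t\<le>count p (Suc i). e ^ t)"
proof -
  have "p_inner n (twisted_char p) (conv (h_series e) schur_series) = p_inner n (twisted_char p) (\<lambda>\<pi>. \<Sum>m\<le>n. e ^ m * h_mult m schur_series \<pi>)"
    unfolding p_inner_def by (rule sum.cong) (auto simp: conv_h_series partitions_of_def)
  also have "\<dots> = (\<Sum>m\<le>n. e ^ m * p_inner n (h_mult m schur_series) (twisted_char p))"
    unfolding p_inner_commute[of n "twisted_char p"] by (rule p_inner_lincomb_left)
  also have "\<dots> = (\<Sum>m\<le>n. e ^ m * strip_up m (\<lambda>_. 1) (conj_fun p))"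
    using p_inner_twisted_char_corresponds[OF p corresponds_h_mult[OF corresponds_schur_series]] by (simp add: p_inner_commute)
  also have "\<dots> = (\<Prod>i<n. \<Sum>t\<le>conj_fun p i - conj_fun p (Suc i). e ^ t)"
    by (rule sum_lower_strips) (use conj_fun_diagrams_of[of p] p in \<open>simp add: partitions_of_def\<close>)
  also have "\<dots> = (\<Prod>i<n. \<Sum>t\<le>count p (Suc i). e ^ t)"
  proof -
    have "conj_fun p i - conj_fun p (Suc i) = count p (Suc i)" for i
      using conj_fun_Suc[of p i] by simp
    then show ?thesis by simp
  qed
  finally show ?thesis .
qed

lemma of_real_of_rat: "of_real (real_of_rat r) = (of_rat r :: complex)"
  by (cases r) (simp add: of_rat_rat)

lemma signed_coefficient_sum:
  assumes p: "p \<in> partitions_of n" and e: "e = 1 \<or> e = - 1"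
    and A: "\<And>\<pi>. real_of_rat (A \<pi>) = real_of_rat (C_even \<pi>) + e * real_of_rat (C_odd \<pi>)"
  shows "(\<Sum>\<pi>\<in>partitions_of n. of_int (part_sgn \<pi>) * of_rat (A \<pi>) * \<chi> p \<pi>)
    = of_real (\<Prod>i<n. \<Sum>t\<le>count p (Suc i). e ^ t)"
proof -
  have n: "sum_mset p = n" using p by (simp add: partitions_of_def)
  have "(\<Sum>\<pi>\<in>partitions_of n. of_int (part_sgn \<pi>) * of_rat (A \<pi>) * \<chi> p \<pi>)
     = (\<Sum>\<pi>\<in>partitions_of n. of_real (real (z_part \<pi>) * twisted_char p \<pi> * conv (h_series e) schur_series \<pi>))"
  proof (rule sum.cong[OF refl])
    fix \<pi> assume \<pi>: "\<pi> \<in> partitions_of n"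
    have "(of_rat (A \<pi>) :: complex) = of_real (real_of_rat (A \<pi>))" by (rule of_real_of_rat[symmetric])
    also have "real_of_rat (A \<pi>) = conv (h_series e) schur_series \<pi>" unfolding A by (rule even_odd_split[OF e])
    finally have 1: "(of_rat (A \<pi>) :: complex) = of_real (conv (h_series e) schur_series \<pi>)" .
    have 2: "\<chi> p \<pi> = of_real (Re (\<chi> p \<pi>))" using chi_real \<pi> n by blast
    have 3: "real (z_part \<pi>) * twisted_char p \<pi> = of_int (part_sgn \<pi>) * Re (\<chi> p \<pi>)"
      using z_part_partition[OF \<pi>] by (simp add: twisted_char_def)
    show "of_int (part_sgn \<pi>) * of_rat (A \<pi>) * \<chi> p \<pi> = of_real (real (z_part \<pi>) * twisted_char p \<pi> * conv (h_series e) schur_series \<pi>)"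
      unfolding 1 3 by (subst 2) (simp add: mult_ac)
  qed
  also have "\<dots> = of_real (p_inner n (twisted_char p) (conv (h_series e) schur_series))" by (simp add: p_inner_def)
  finally show ?thesis unfolding multiplicity_formula[OF p] .
qed

lemma alternating_sum: "(\<Sum>t\<le>c. (- 1) ^ t) = (if even c then 1 else 0 :: real)"
  by (induction c) auto

text \<open>The multiplicities are the differences of \<open>conj_fun\<close>, which is eventually
  0; so all differences are even exactly if all values are.\<close>

lemma even_conjugate_iff:
  assumes "sum_mset p = n"
  shows "(\<forall>i<n. even (count p (Suc i))) \<longleftrightarrow> (\<forall>j\<in>#conjugate_part p. even j)"
proof -
  have fin: "finite {j. 1 \<le> j \<and> (\<exists>i\<in>#p. j \<le> i)}"
    by (rule finite_subset[of _ "{..sum_mset p}"]) (use part_le[of _ p] in \<open>auto intro: order_trans\<close>)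
  have cf: "conj_fun p j = size (filter_mset (\<lambda>i. Suc j \<le> i) p)" for j
    by (simp add: conj_fun_def Suc_le_eq)
  have "(\<forall>j\<in>#conjugate_part p. even j) \<longleftrightarrow> (\<forall>j. even (conj_fun p j))"
  proof
    assume a: "\<forall>j\<in>#conjugate_part p. even j"
    show "\<forall>j. even (conj_fun p j)"
    proof
      fix j
      show "even (conj_fun p j)"
      proof (cases "\<exists>i\<in>#p. Suc j \<le> i")
        case True
        then have "conj_fun p j \<in># conjugate_part p"
          unfolding cf conjugate_part_def using fin by auto
        then show ?thesis using a by blast
      next
        case False
        then have none: "filter_mset (\<lambda>i. Suc j \<le> i) p = {#}" by (auto simp: filter_mset_eq_conv[of _ _ "{#}"])
        show ?thesis unfolding cf none by simp
      qed
    qed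
  next
    assume a: "\<forall>j. even (conj_fun p j)"
    show "\<forall>j\<in>#conjugate_part p. even j"
    proof
      fix c assume "c \<in># conjugate_part p"
      then obtain j where j: "1 \<le> j" "c = size (filter_mset (\<lambda>i. j \<le> i) p)"
        using fin by (auto simp: conjugate_part_def)
      then have "c = conj_fun p (j - 1)" unfolding cf by simp
      then show "even c" using a by simp
    qed
  qed
  also have "\<dots> \<longleftrightarrow> (\<forall>i<n. even (count p (Suc i)))"
  proof
    assume "\<forall>j. even (conj_fun p j)"
    then show "\<forall>i<n. even (count p (Suc i))" using conj_fun_Suc[of p] by (metis even_add)
  next
    assume a: "\<forall>i<n. even (count p (Suc i))"
    \<comment> \<open>Induction downwards from index n, where \<open>conj_fun\<close>
      vanishes.\<close>
    have "even (conj_fun p (n - d))" if "d \<le> n" for d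
      using that
    proof (induction d)
      case 0
      then show ?case using conj_fun_zero[of p n] assms by simp
    next
      case (Suc d)
      then have "conj_fun p (n - Suc d) = count p (Suc (n - Suc d)) + conj_fun p (n - d)"
        using conj_fun_Suc[of p "n - Suc d"] by (simp add: Suc_diff_Suc)
      then show ?case using Suc a by simp
    qed
    then have "even (conj_fun p j)" if "j \<le> n" for j using that by (metis diff_diff_cancel diff_le_self)
    moreover have "conj_fun p j = 0" if "j \<ge> n" for j using conj_fun_zero that assms by simp
    ultimately show "\<forall>j. even (conj_fun p j)" by (metis even_zero nle_le)
  qed
  finally show ?thesis by blast
qed

theorem theorem9p3:
  fixes p :: "nat multiset"
  assumes "is_partition p"
  shows "a_plus p = of_nat (\<Prod>i\<in>set_mset p. count p i + 1) \<and>
         a_minus p = (if \<forall>j\<in>#conjugate_part p. even j then 1 else 0)"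
proof
  let ?n = "sum_mset p"
  have p: "p \<in> partitions_of ?n" using assms by (simp add: partitions_of_def)
  have "a_plus p = of_real (\<Prod>i<?n. \<Sum>t\<le>count p (Suc i). 1 ^ t)"
    unfolding a_plus_def by (rule signed_coefficient_sum[OF p]) (simp_all add: C_coeff_def of_rat_add)
  also have "(\<Prod>i<?n. \<Sum>t\<le>count p (Suc i). 1 ^ t :: real) = of_nat (\<Prod>i<?n. count p (Suc i) + 1)"
    by (simp add: add.commute)
  also have "(\<Prod>i<?n. count p (Suc i) + 1) = (\<Prod>i\<in>Suc ` {..<?n}. count p i + 1)"
    by (simp add: prod.reindex)
  also have "\<dots> = (\<Prod>i\<in>set_mset p. count p i + 1)"
  proof (rule prod.mono_neutral_right)
    show "set_mset p \<subseteq> Suc ` {..<?n}"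
    proof
      fix i assume "i \<in># p"
      then have "i \<noteq> 0" "i \<le> ?n" using assms part_le[of i p] by (auto simp: is_partition_def intro: gr0I)
      then show "i \<in> Suc ` {..<?n}" by (cases i) auto
    qed
  qed (auto simp: not_in_iff)
  finally show "a_plus p = of_nat (\<Prod>i\<in>set_mset p. count p i + 1)" by simp
  have "a_minus p = of_real (\<Prod>i<?n. \<Sum>t\<le>count p (Suc i). (- 1) ^ t)"
    unfolding a_minus_def by (rule signed_coefficient_sum[OF p]) (simp_all add: D_coeff_def of_rat_diff)
  also have "(\<Prod>i<?n. \<Sum>t\<le>count p (Suc i). (- 1) ^ t :: real) = (if \<forall>i<?n. even (count p (Suc i)) then 1 else 0)"
    unfolding alternating_sum by auto
  finally show "a_minus p = (if \<forall>j\<in>#conjugate_part p. even j then 1 else 0)"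
    unfolding even_conjugate_iff[OF refl] by simp
qed

end
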